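(* Consider the following one-parameter families (parameter $t\in\mathbb A^1$) of hypersurfaces in four-dimensional weighted projective spaces, each given as the zero locus of the displayed polynomial: $\mathcal A_1(t)$: $x_1^8x_3+x_2x_3^7+x_2^7x_4+x_4^7+x_5^2-tx_1x_2x_3x_4x_5$ in $W\mathbb P^4(75,84,86,98,343)$; $\mathcal A_2(t)$: $x_1^8x_2+x_2^7x_3+x_3^7+x_4^4+x_4x_5^2-tx_1x_2x_3x_4x_5$ in $W\mathbb P^4(43,48,56,98,147)$; $\mathcal A_3(t)$: $x_2^8+x_1^7x_3+x_3^7+x_1x_4^4+x_4x_5^2-tx_1x_2x_3x_4x_5$ in $W\mathbb P^4(48,49,56,86,153)$; $\mathcal A_4(t)$: $x_1x_2^7+x_1^7x_3+x_3^7+x_2x_4^4+x_4x_5^2-tx_1x_2x_3x_4x_5$ in $W\mathbb P^4(42,43,49,75,134)$; $\mathcal B_1(t)$: $x_1^{10}x_2+x_2^9x_3+x_3^9+x_4^5+x_5^2-tx_1x_2x_3x_4x_5$ in $W\mathbb P^4(73,80,90,162,405)$; $\mathcal B_2(t)$: $x_1^9x_2+x_2^9+x_1x_3^8+x_3x_4^5+x_5^2-tx_1x_2x_3x_4x_5$ in $W\mathbb P^4(64,72,73,115,324)$; $\mathcal B_3(t)$: $x_1^9x_2+x_2^9+x_1x_3^5+x_4^5+x_3x_5^2-tx_1x_2x_3x_4x_5$ in $W\mathbb P^4(40,45,73,81,166)$; $\mathcal B_4(t)$: $x_1^9+x_2^8+x_2x_3^5+x_1x_4^5+x_4x_5^2-tx_1x_2x_3x_4x_5$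 in $W\mathbb P^4(40,45,63,64,148)$; $\mathcal C_1(t)$: $x_1^6x_3+x_2x_3^5+x_2^5x_4+x_4^5+x_5^3-tx_1x_2x_3x_4x_5$ in $W\mathbb P^4(52,60,63,75,125)$; $\mathcal C_2(t)$: $x_2^6+x_1^5x_3+x_3^5+x_1x_4^4+x_4x_5^3-tx_1x_2x_3x_4x_5$ in $W\mathbb P^4(48,50,60,63,79)$; $\mathcal D_1(t)$: $x_1^5x_3+x_3^4x_4+x_2x_4^4+x_2^4x_5+x_5^4-tx_1x_2x_3x_4x_5$ in $W\mathbb P^4(41,48,51,52,64)$; $\mathcal D_2(t)$: $x_3^5+x_1^5x_4+x_2x_4^4+x_2^4x_5+x_5^4-tx_1x_2x_3x_4x_5$ in $W\mathbb P^4(51,60,64,65,80)$. Let $W_5(t),W_6(t),W_8(t),W_{10}(t)$ be the mirror families defined in the context. Then the following birational equivalences (denoted $\approx$, between members with the same parameter $t$) hold: $$\mathcal A_1(t)\approx\mathcal A_2(t)\approx\mathcal A_3(t)\approx\mathcal A_4(t)\approx W_8(t),$$ $$\mathcal B_1(t)\approx\mathcal B_2(t)\approx\mathcal B_3(t)\approx\mathcal B_4(t)\approx W_{10}(t),$$ $$\mathcal C_1(t)\approx\mathcal C_2(t)\approx W_6(t),$$ $$\mathcal D_1(t)\approx\mathcal D_2(t)\approx W_5(t).$$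
   Context: Everything is over $\mathbb C$. $W\mathbb P^4(w_1,\dots,w_5)$ is the weighted projective space $(\mathbb C^5\setminus\{0\})/\sim$ with $(x_1,\dots,x_5)\sim(\lambda^{w_1}x_1,\dots,\lambda^{w_5}x_5)$ for $\lambda\in\mathbb C^*$. For $j=5,6,8,10$ put $w=(1,1,1,1,1)$, $(1,1,1,1,2)$, $(1,1,1,1,4)$, $(1,1,1,2,5)$ respectively, so $\sum_i w_i=j$ and $w_i\mid j$. The hypergeometric Calabi-Yau family $V_j(t)$ is the family of hypersurfaces $$V_j(t)=\Big\{\sum_{i=1}^5 x_i^{j/w_i}-t\,x_1x_2x_3x_4x_5=0\Big\}\subset W\mathbb P^4(w_1,\dots,w_5).$$ Let $G=G_j$ be the finite group of diagonal automorphisms $(x_1:\dots:x_5)\mapsto(\epsilon_1x_1:\dots:\epsilon_5x_5)$ with $\epsilon_i^{j/w_i}=1$ for all $i$ and $\prod_i\epsilon_i=1$ (modulo those acting trivially); it acts on every $V_j(t)$. The mirror $W_j(t)$ of $V_j(t)$ is a resolution of singularities of the quotient $V_j(t)/G$ (only its birational class matters here). *)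

theory Defs
  imports "HOL-Analysis.Analysis"
begin

section \<open>Spaces with functions\<close>

text \<open>
  Complex varieties are treated in the classical language of spaces with functions: a topological
  space together with, for every open \<open>U\<close>, a set of complex-valued functions regarded as regular
  on \<open>U\<close>. A regular function is represented by a total HOL function of which only the values
  on \<open>U\<close> are relevant; \<open>Reg X U\<close> carries no meaning if \<open>U\<close> is not open.
\<close>

record 'a fspace =
  Top :: "'a topology"
  Reg :: "'a set \<Rightarrow> ('a \<Rightarrow> complex) set"

abbreviation pts :: "'a fspace \<Rightarrow> 'a set" where
  "pts X \<equiv> topspace (Top X)"

definition is_morphism :: "'a fspace \<Rightarrow> 'b fspace \<Rightarrow> ('a \<Rightarrow> 'b) \<Rightarrow> bool" where
  "is_morphism X Y f \<longleftrightarrow>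
     continuous_map (Top X) (Top Y) f \<and>
     (\<forall>V h. openin (Top Y) V \<longrightarrow> h \<in> Reg Y V \<longrightarrow> h \<circ> f \<in> Reg X {x \<in> pts X. f x \<in> V})"

definition is_isomorphism :: "'a fspace \<Rightarrow> 'b fspace \<Rightarrow> ('a \<Rightarrow> 'b) \<Rightarrow> bool" where
  "is_isomorphism X Y f \<longleftrightarrow>
     (\<exists>g. homeomorphic_maps (Top X) (Top Y) f g \<and> is_morphism X Y f \<and> is_morphism Y X g)"

definition isomorphic :: "'a fspace \<Rightarrow> 'b fspace \<Rightarrow> bool" where
  "isomorphic X Y \<longleftrightarrow> (\<exists>f. is_isomorphism X Y f)"

text \<open>
  The structure induced on a subset \<open>S\<close>: regular functions are those that are locally restrictions
  of regular functions of the ambient space. This gives open subspaces as well as closed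
  subvarieties with their reduced structure.
\<close>

definition subspace_of :: "'a fspace \<Rightarrow> 'a set \<Rightarrow> 'a fspace" where
  "subspace_of X S =
     \<lparr>Top = subtopology (Top X) S,
      Reg = (\<lambda>U. {f. \<forall>p\<in>U. \<exists>V. openin (Top X) V \<and> p \<in> V \<and> V \<inter> S \<subseteq> U \<and>
                        (\<exists>g\<in>Reg X V. \<forall>x\<in>V \<inter> S. f x = g x)})\<rparr>"

text \<open>
  The quotient by an equivalence relation \<open>r\<close>: the points are the \<open>r\<close>-classes, the topology is the
  quotient topology, and a function is regular if its pullback along the projection is regular.
\<close>

definition quotient_open :: "'a fspace \<Rightarrow> ('a \<times> 'a) set \<Rightarrow> 'a set set \<Rightarrow> bool" where
  "quotient_open X r U \<longleftrightarrow>
     U \<subseteq> pts X // r \<and> openin (Top X) {x \<in> pts X. r `` {x} \<in> U}"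

lemma istopology_final:
  "istopology (\<lambda>U. U \<subseteq> Q \<and> openin T {x \<in> topspace T. q x \<in> U})"
  unfolding istopology_def
proof (intro conjI allI impI)
  fix A B
  assume A: "A \<subseteq> Q \<and> openin T {x \<in> topspace T. q x \<in> A}"
    and B: "B \<subseteq> Q \<and> openin T {x \<in> topspace T. q x \<in> B}"
  have "{x \<in> topspace T. q x \<in> A \<inter> B} =
      {x \<in> topspace T. q x \<in> A} \<inter> {x \<in> topspace T. q x \<in> B}" by blast
  moreover have "openin T ({x \<in> topspace T. q x \<in> A} \<inter> {x \<in> topspace T. q x \<in> B})"
    using conjunct2[OF A] conjunct2[OF B] by (rule openin_Int)
  ultimately show "openin T {x \<in> topspace T. q x \<in> A \<inter> B}" by (rule ssubst)
  show "A \<inter> B \<subseteq> Q" using A by blast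
next
  fix K assume K: "\<forall>A\<in>K. A \<subseteq> Q \<and> openin T {x \<in> topspace T. q x \<in> A}"
  have "{x \<in> topspace T. q x \<in> \<Union>K} = (\<Union>A\<in>K. {x \<in> topspace T. q x \<in> A})" by blast
  moreover have "openin T (\<Union>A\<in>K. {x \<in> topspace T. q x \<in> A})"
    using K by (intro openin_Union) blast
  ultimately show "openin T {x \<in> topspace T. q x \<in> \<Union>K}" by (rule ssubst)
  show "\<Union>K \<subseteq> Q" using K by blast
qed

lemma istopology_quotient_open: "istopology (quotient_open X r)"
  using istopology_final[of "pts X // r" "Top X" "\<lambda>x. r `` {x}"]
  unfolding quotient_open_def[abs_def] .

definition quotient_space :: "'a fspace \<Rightarrow> ('a \<times> 'a) set \<Rightarrow> 'a set fspace" where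
  "quotient_space X r =
     \<lparr>Top = topology (quotient_open X r),
      Reg = (\<lambda>U. {f. (\<lambda>x. f (r `` {x})) \<in> Reg X {x \<in> pts X. r `` {x} \<in> U}})\<rparr>"

lemma openin_quotient_space: "openin (Top (quotient_space X r)) U \<longleftrightarrow> quotient_open X r U"
  by (simp add: quotient_space_def istopology_quotient_open)

text \<open>
  Birational equivalence: isomorphic dense open subspaces. The points need not have the same type.
\<close>

definition dense_open :: "'a fspace \<Rightarrow> 'a set \<Rightarrow> bool" where
  "dense_open X U \<longleftrightarrow> openin (Top X) U \<and> Top X closure_of U = pts X"

definition birational :: "'a fspace \<Rightarrow> 'b fspace \<Rightarrow> bool" (infix \<open>\<approx>\<^sub>b\<close> 50) where
  "X \<approx>\<^sub>b Y \<longleftrightarrow>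
     (\<exists>U V. dense_open X U \<and> dense_open Y V \<and>
            isomorphic (subspace_of X U) (subspace_of Y V))"


section \<open>Affine space\<close>

text \<open>
  Points of affine \<open>n\<close>-space are sequences \<open>x\<close> with coordinates \<open>x 1, \<dots>, x n\<close>, all other
  entries being \<open>0\<close>. Sequences rather than vectors of a fixed length type are used since the
  dimension is quantified in the definition of a variety.
\<close>

definition affine_pts :: "nat \<Rightarrow> (nat \<Rightarrow> complex) set" where
  "affine_pts n = {x. \<forall>i. i \<notin> {1..n} \<longrightarrow> x i = 0}"

inductive_set poly_funs :: "((nat \<Rightarrow> complex) \<Rightarrow> complex) set" where
  const: "(\<lambda>x. c) \<in> poly_funs"
| coord: "(\<lambda>x. x i) \<in> poly_funs"
| add: "p \<in> poly_funs \<Longrightarrow> q \<in> poly_funs \<Longrightarrow> (\<lambda>x. p x + q x) \<in> poly_funs"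
| mult: "p \<in> poly_funs \<Longrightarrow> q \<in> poly_funs \<Longrightarrow> (\<lambda>x. p x * q x) \<in> poly_funs"

definition zariski_open :: "nat \<Rightarrow> (nat \<Rightarrow> complex) set \<Rightarrow> bool" where
  "zariski_open n U \<longleftrightarrow> (\<exists>P \<subseteq> poly_funs. U = {x \<in> affine_pts n. \<exists>p\<in>P. p x \<noteq> 0})"

lemma istopology_zariski_open: "istopology (zariski_open n)"
  unfolding istopology_def
proof (intro conjI allI impI)
  fix S T assume "zariski_open n S" "zariski_open n T"
  then obtain P Q where P: "P \<subseteq> poly_funs" "S = {x \<in> affine_pts n. \<exists>p\<in>P. p x \<noteq> 0}"
    and Q: "Q \<subseteq> poly_funs" "T = {x \<in> affine_pts n. \<exists>p\<in>Q. p x \<noteq> 0}"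
    unfolding zariski_open_def by (elim exE conjE)
  define R where "R = {(\<lambda>x. p x * q x) | p q. p \<in> P \<and> q \<in> Q}"
  have "R \<subseteq> poly_funs"
    unfolding R_def using P(1) Q(1) by (blast intro: poly_funs.mult)
  moreover have "(\<exists>p\<in>R. p x \<noteq> 0) \<longleftrightarrow> (\<exists>p\<in>P. p x \<noteq> 0) \<and> (\<exists>q\<in>Q. q x \<noteq> 0)" for x
  proof
    assume "\<exists>p\<in>R. p x \<noteq> 0"
    then obtain p q where "p \<in> P" "q \<in> Q" "p x * q x \<noteq> 0" unfolding R_def by blast
    then show "(\<exists>p\<in>P. p x \<noteq> 0) \<and> (\<exists>q\<in>Q. q x \<noteq> 0)" by (intro conjI bexI) auto
  next
    assume "(\<exists>p\<in>P. p x \<noteq> 0) \<and> (\<exists>q\<in>Q. q x \<noteq> 0)"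
    then obtain p q where "p \<in> P" "q \<in> Q" "p x \<noteq> 0" "q x \<noteq> 0" by (elim conjE bexE)
    then show "\<exists>p\<in>R. p x \<noteq> 0"
      unfolding R_def by (intro bexI[of _ "\<lambda>x. p x * q x"]) auto
  qed
  then have "S \<inter> T = {x \<in> affine_pts n. \<exists>p\<in>R. p x \<noteq> 0}"
    unfolding P(2) Q(2) by (simp add: set_eq_iff) blast
  ultimately show "zariski_open n (S \<inter> T)"
    unfolding zariski_open_def by (intro exI[of _ R] conjI)
next
  fix K assume K: "\<forall>S\<in>K. zariski_open n S"
  define P where "P = {p \<in> poly_funs. \<forall>x\<in>affine_pts n. p x \<noteq> 0 \<longrightarrow> x \<in> \<Union>K}"
  have "x \<in> affine_pts n \<and> (\<exists>p\<in>P. p x \<noteq> 0)" if x: "x \<in> \<Union>K" for x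
  proof -
    from x obtain S where S: "S \<in> K" "x \<in> S" by (elim UnionE)
    have "zariski_open n S" using K S(1) by (rule bspec)
    then obtain Q where Q: "Q \<subseteq> poly_funs" "S = {x \<in> affine_pts n. \<exists>p\<in>Q. p x \<noteq> 0}"
      unfolding zariski_open_def by (elim exE conjE)
    have "x \<in> {x \<in> affine_pts n. \<exists>p\<in>Q. p x \<noteq> 0}" using S(2) unfolding Q(2) .
    then obtain p where p: "x \<in> affine_pts n" "p \<in> Q" "p x \<noteq> 0" by blast
    have "y \<in> \<Union>K" if "y \<in> affine_pts n" "p y \<noteq> 0" for y
    proof -
      have "y \<in> S" unfolding Q(2) using that p(2) by blast
      then show ?thesis using S(1) by (intro UnionI)
    qed
    then have "p \<in> P" unfolding P_def using Q(1) p(2) by blast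
    then show ?thesis using p(1,3) by (intro conjI bexI)
  qed
  moreover have "x \<in> \<Union>K" if "x \<in> affine_pts n" "p \<in> P" "p x \<noteq> 0" for x p
    using that unfolding P_def by blast
  ultimately have "\<Union>K = {x \<in> affine_pts n. \<exists>p\<in>P. p x \<noteq> 0}"
    by (intro set_eqI iffI) (simp, elim CollectE conjE bexE)
  moreover have "P \<subseteq> poly_funs" unfolding P_def by (rule Collect_restrict)
  ultimately show "zariski_open n (\<Union>K)"
    unfolding zariski_open_def by (intro exI[of _ P] conjI)
qed

definition affine_space :: "nat \<Rightarrow> (nat \<Rightarrow> complex) fspace" where
  "affine_space n =
     \<lparr>Top = topology (zariski_open n),
      Reg = (\<lambda>U. {f. \<forall>a\<in>U. \<exists>V p q. zariski_open n V \<and> a \<in> V \<and> V \<subseteq> U \<and>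
                        p \<in> poly_funs \<and> q \<in> poly_funs \<and>
                        (\<forall>x\<in>V. q x \<noteq> 0 \<and> f x = p x / q x)})\<rparr>"

lemma openin_affine_space: "openin (Top (affine_space n)) U \<longleftrightarrow> zariski_open n U"
  by (simp add: affine_space_def istopology_zariski_open)


section \<open>Varieties and resolutions of singularities\<close>

text \<open>
  The Zariski topology of the product of two spaces with functions, generated by the
  loci where a finite sum \<open>\<Sum> f k \<otimes> g k\<close> of products of regular functions does not vanish.
\<close>

definition product_top :: "'a fspace \<Rightarrow> 'b fspace \<Rightarrow> ('a \<times> 'b) topology" where
  "product_top X Y = topology_generated_by
     {{z \<in> U \<times> V. (\<Sum>k<m. f k (fst z) * g k (snd z)) \<noteq> 0} | U V f g (m::nat).
        openin (Top X) U \<and> openin (Top Y) V \<and> (\<forall>k<m. f k \<in> Reg X U \<and> g k \<in> Reg Y V)}"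

definition is_sheaf :: "'a fspace \<Rightarrow> bool" where
  "is_sheaf X \<longleftrightarrow>
     (\<forall>U f. openin (Top X) U \<longrightarrow>
        (f \<in> Reg X U \<longleftrightarrow>
           (\<forall>p\<in>U. \<exists>V. openin (Top X) V \<and> p \<in> V \<and> V \<subseteq> U \<and>
              (\<exists>g\<in>Reg X V. \<forall>x\<in>V. f x = g x))))"

definition affine_variety :: "'a fspace \<Rightarrow> bool" where
  "affine_variety X \<longleftrightarrow>
     (\<exists>n Z. closedin (Top (affine_space n)) Z \<and> isomorphic X (subspace_of (affine_space n) Z))"

text \<open>Varieties are separated and of finite type; they are not required to be irreducible.\<close>

definition variety :: "'a fspace \<Rightarrow> bool" where
  "variety X \<longleftrightarrow>
     is_sheaf X \<and>
     (\<exists>\<U>. finite \<U> \<and> \<Union>\<U> = pts X \<and>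
           (\<forall>U\<in>\<U>. openin (Top X) U \<and> affine_variety (subspace_of X U))) \<and>
     closedin (product_top X X) {(x, x) | x. x \<in> pts X}"

definition partial :: "nat \<Rightarrow> ((nat \<Rightarrow> complex) \<Rightarrow> complex) \<Rightarrow> (nat \<Rightarrow> complex) \<Rightarrow> complex" where
  "partial i p x = deriv (\<lambda>s. p (x(i := s))) (x i)"

text \<open>
  Smoothness by the Jacobian criterion: locally \<open>X\<close> is cut out, in an open subset of affine
  space, by polynomials whose gradients are linearly independent.
\<close>

definition smooth_variety :: "'a fspace \<Rightarrow> bool" where
  "smooth_variety X \<longleftrightarrow>
     variety X \<and>
     (\<forall>a\<in>pts X. \<exists>U n c Q p. openin (Top X) U \<and> a \<in> U \<and>
        zariski_open n Q \<and> (\<forall>k<c. p k \<in> poly_funs) \<and>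
        (let Z = {x \<in> Q. \<forall>k<(c::nat). p k x = 0} in
           isomorphic (subspace_of X U) (subspace_of (affine_space n) Z) \<and>
           (\<forall>x\<in>Z. \<forall>b. (\<forall>i\<in>{1..n}. (\<Sum>k<c. b k * partial i (p k) x) = 0)
                         \<longrightarrow> (\<forall>k<c. b k = 0))))"

text \<open>
  Properness is universal closedness (the source and target being separated and of finite type).
  Base change to the products with the affine spaces suffices, since every base change is
  locally a closed subspace of one of these.
\<close>

definition proper_morphism :: "'a fspace \<Rightarrow> 'b fspace \<Rightarrow> ('a \<Rightarrow> 'b) \<Rightarrow> bool" where
  "proper_morphism X Y f \<longleftrightarrow>
     is_morphism X Y f \<and>
     (\<forall>n. closed_map (product_top X (affine_space n)) (product_top Y (affine_space n))
            (map_prod f id))"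

definition birational_morphism :: "'a fspace \<Rightarrow> 'b fspace \<Rightarrow> ('a \<Rightarrow> 'b) \<Rightarrow> bool" where
  "birational_morphism X Y f \<longleftrightarrow>
     is_morphism X Y f \<and>
     (\<exists>V. dense_open Y V \<and> dense_open X {x \<in> pts X. f x \<in> V} \<and>
          is_isomorphism (subspace_of X {x \<in> pts X. f x \<in> V}) (subspace_of Y V) f)"

definition resolution_of :: "'a fspace \<Rightarrow> 'b fspace \<Rightarrow> bool" where
  "resolution_of W X \<longleftrightarrow>
     smooth_variety W \<and> (\<exists>\<pi>. proper_morphism W X \<pi> \<and> birational_morphism W X \<pi>)"


section \<open>Hypersurfaces in weighted projective spaces\<close>

text \<open>
  The weight of the coordinate \<open>x i\<close> is \<open>ws ! (i - 1)\<close>. A point of weighted projective space is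
  the orbit of its homogeneous coordinate vectors.
\<close>

type_synonym wpt = "(nat \<Rightarrow> complex) set"

definition punctured_affine :: "nat \<Rightarrow> (nat \<Rightarrow> complex) fspace" where
  "punctured_affine n = subspace_of (affine_space n) (affine_pts n - {\<lambda>i. 0})"

definition weighted_rel :: "nat list \<Rightarrow> ((nat \<Rightarrow> complex) \<times> (nat \<Rightarrow> complex)) set" where
  "weighted_rel ws =
     {(x, y). x \<in> affine_pts (length ws) - {\<lambda>i. 0} \<and> y \<in> affine_pts (length ws) - {\<lambda>i. 0} \<and>
              (\<exists>l. l \<noteq> 0 \<and> (\<forall>i\<in>{1..length ws}. y i = l ^ (ws ! (i - 1)) * x i))}"

definition weighted_proj :: "nat list \<Rightarrow> wpt fspace" where
  "weighted_proj ws = quotient_space (punctured_affine (length ws)) (weighted_rel ws)"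

text \<open>\<open>F\<close> is meant to be weighted homogeneous, so that its vanishing is independent of the representative.\<close>

definition hypersurface :: "nat list \<Rightarrow> ((nat \<Rightarrow> complex) \<Rightarrow> complex) \<Rightarrow> wpt fspace" where
  "hypersurface ws F =
     subspace_of (weighted_proj ws) {p \<in> pts (weighted_proj ws). \<forall>x\<in>p. F x = 0}"


section \<open>The hypergeometric families and their mirrors\<close>

text \<open>Only \<open>j = 5, 6, 8, 10\<close> are meaningful below.\<close>

definition cy_weights :: "nat \<Rightarrow> nat list" where
  "cy_weights j =
     (if j = 5 then [1, 1, 1, 1, 1]
      else if j = 6 then [1, 1, 1, 1, 2]
      else if j = 8 then [1, 1, 1, 1, 4]
      else if j = 10 then [1, 1, 1, 2, 5]
      else [])"

definition cy_V :: "nat \<Rightarrow> complex \<Rightarrow> wpt fspace" where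
  "cy_V j t = hypersurface (cy_weights j)
     (\<lambda>x. (\<Sum>i = 1..5. x i ^ (j div cy_weights j ! (i - 1))) - t * x 1 * x 2 * x 3 * x 4 * x 5)"

text \<open>
  The diagonal group is not divided by the elements that act trivially, as this does not affect
  the orbits and hence the quotient.
\<close>

definition cy_group :: "nat \<Rightarrow> (nat \<Rightarrow> complex) set" where
  "cy_group j =
     {e. (\<forall>i\<in>{1..5}. e i ^ (j div cy_weights j ! (i - 1)) = 1) \<and> (\<Prod>i = 1..5. e i) = 1}"

definition cy_orbit_rel :: "nat \<Rightarrow> complex \<Rightarrow> (wpt \<times> wpt) set" where
  "cy_orbit_rel j t =
     {(p, q). p \<in> pts (cy_V j t) \<and> q \<in> pts (cy_V j t) \<and>
              (\<exists>e\<in>cy_group j. q = (\<lambda>x i. e i * x i) ` p)}"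

definition cy_quotient :: "nat \<Rightarrow> complex \<Rightarrow> wpt set fspace" where
  "cy_quotient j t = quotient_space (cy_V j t) (cy_orbit_rel j t)"

definition is_mirror :: "nat \<Rightarrow> complex \<Rightarrow> 'w fspace \<Rightarrow> bool" where
  "is_mirror j t W \<longleftrightarrow> resolution_of W (cy_quotient j t)"


section \<open>The twelve families\<close>

definition fam_A1 :: "complex \<Rightarrow> wpt fspace" where
  "fam_A1 t = hypersurface [75, 84, 86, 98, 343]
     (\<lambda>x. x 1 ^ 8 * x 3 + x 2 * x 3 ^ 7 + x 2 ^ 7 * x 4 + x 4 ^ 7 + x 5 ^ 2
        - t * x 1 * x 2 * x 3 * x 4 * x 5)"

definition fam_A2 :: "complex \<Rightarrow> wpt fspace" where
  "fam_A2 t = hypersurface [43, 48, 56, 98, 147]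
     (\<lambda>x. x 1 ^ 8 * x 2 + x 2 ^ 7 * x 3 + x 3 ^ 7 + x 4 ^ 4 + x 4 * x 5 ^ 2
        - t * x 1 * x 2 * x 3 * x 4 * x 5)"

definition fam_A3 :: "complex \<Rightarrow> wpt fspace" where
  "fam_A3 t = hypersurface [48, 49, 56, 86, 153]
     (\<lambda>x. x 2 ^ 8 + x 1 ^ 7 * x 3 + x 3 ^ 7 + x 1 * x 4 ^ 4 + x 4 * x 5 ^ 2
        - t * x 1 * x 2 * x 3 * x 4 * x 5)"

definition fam_A4 :: "complex \<Rightarrow> wpt fspace" where
  "fam_A4 t = hypersurface [42, 43, 49, 75, 134]
     (\<lambda>x. x 1 * x 2 ^ 7 + x 1 ^ 7 * x 3 + x 3 ^ 7 + x 2 * x 4 ^ 4 + x 4 * x 5 ^ 2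
        - t * x 1 * x 2 * x 3 * x 4 * x 5)"

definition fam_B1 :: "complex \<Rightarrow> wpt fspace" where
  "fam_B1 t = hypersurface [73, 80, 90, 162, 405]
     (\<lambda>x. x 1 ^ 10 * x 2 + x 2 ^ 9 * x 3 + x 3 ^ 9 + x 4 ^ 5 + x 5 ^ 2
        - t * x 1 * x 2 * x 3 * x 4 * x 5)"

definition fam_B2 :: "complex \<Rightarrow> wpt fspace" where
  "fam_B2 t = hypersurface [64, 72, 73, 115, 324]
     (\<lambda>x. x 1 ^ 9 * x 2 + x 2 ^ 9 + x 1 * x 3 ^ 8 + x 3 * x 4 ^ 5 + x 5 ^ 2
        - t * x 1 * x 2 * x 3 * x 4 * x 5)"

definition fam_B3 :: "complex \<Rightarrow> wpt fspace" where
  "fam_B3 t = hypersurface [40, 45, 73, 81, 166]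
     (\<lambda>x. x 1 ^ 9 * x 2 + x 2 ^ 9 + x 1 * x 3 ^ 5 + x 4 ^ 5 + x 3 * x 5 ^ 2
        - t * x 1 * x 2 * x 3 * x 4 * x 5)"

definition fam_B4 :: "complex \<Rightarrow> wpt fspace" where
  "fam_B4 t = hypersurface [40, 45, 63, 64, 148]
     (\<lambda>x. x 1 ^ 9 + x 2 ^ 8 + x 2 * x 3 ^ 5 + x 1 * x 4 ^ 5 + x 4 * x 5 ^ 2
        - t * x 1 * x 2 * x 3 * x 4 * x 5)"

definition fam_C1 :: "complex \<Rightarrow> wpt fspace" where
  "fam_C1 t = hypersurface [52, 60, 63, 75, 125]
     (\<lambda>x. x 1 ^ 6 * x 3 + x 2 * x 3 ^ 5 + x 2 ^ 5 * x 4 + x 4 ^ 5 + x 5 ^ 3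
        - t * x 1 * x 2 * x 3 * x 4 * x 5)"

definition fam_C2 :: "complex \<Rightarrow> wpt fspace" where
  "fam_C2 t = hypersurface [48, 50, 60, 63, 79]
     (\<lambda>x. x 2 ^ 6 + x 1 ^ 5 * x 3 + x 3 ^ 5 + x 1 * x 4 ^ 4 + x 4 * x 5 ^ 3
        - t * x 1 * x 2 * x 3 * x 4 * x 5)"

definition fam_D1 :: "complex \<Rightarrow> wpt fspace" where
  "fam_D1 t = hypersurface [41, 48, 51, 52, 64]
     (\<lambda>x. x 1 ^ 5 * x 3 + x 3 ^ 4 * x 4 + x 2 * x 4 ^ 4 + x 2 ^ 4 * x 5 + x 5 ^ 4
        - t * x 1 * x 2 * x 3 * x 4 * x 5)"

definition fam_D2 :: "complex \<Rightarrow> wpt fspace" where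
  "fam_D2 t = hypersurface [51, 60, 64, 65, 80]
     (\<lambda>x. x 3 ^ 5 + x 1 ^ 5 * x 4 + x 2 * x 4 ^ 4 + x 2 ^ 4 * x 5 + x 5 ^ 4
        - t * x 1 * x 2 * x 3 * x 4 * x 5)"

end

theory Submission
  imports Defs "HOL-Computational_Algebra.Fundamental_Theorem_Algebra"
begin

text \<open>
  All the varieties are birational to one model that depends only on the weights \<open>w\<close> of
  the mirror family. Dividing the monomials other than \<open>t x\<^sub>1 \<cdots> x\<^sub>5\<close> by
  \<open>x\<^sub>1 \<cdots> x\<^sub>5\<close> gives functions \<open>y\<^sub>1, \<dots>, y\<^sub>5\<close> on the torus, and the
  equation becomes \<open>y\<^sub>1 + \<cdots> + y\<^sub>5 = t\<close>. In all cases the exponents of the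
  \<open>y\<^sub>i\<close> satisfy a single linear relation, which is \<open>w\<close> up to a permutation, so
  that \<open>\<Prod> y\<^sub>i ^ w\<^sub>i = 1\<close>. For the twelve families the \<open>y\<^sub>i\<close> generate all Laurent
  monomials of weight \<open>0\<close>, hence they identify the torus part of the hypersurface with the
  subvariety of the torus cut out by these two equations; for the Fermat hypersurfaces \<open>V\<^sub>j(t)\<close>
  they generate exactly those invariant under the group \<open>G\<close>, so the same
  subvariety is the torus part of \<open>V\<^sub>j(t)/G\<close>. The torus part is dense since no coordinate divides
  the defining polynomial.
\<close>

section \<open>Spaces with functions\<close>

text \<open>The shared model comes from a transposition. The right kernel of the exponent matrix of
  the \<open>y\<^sub>i\<close> is spanned by the weights of the ambient space, the left kernel by
  those of the mirror family, so hypersurfaces in different weighted spaces can have the same left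
  relation.

  Two obstacles shape the proof. Density of the torus part is claimed for every t, singular members
  included; it is obtained by perturbing zeros with an elementary bound on polynomials without small
  roots. For V_j(t) the map to the model is many-to-one even modulo the weights, so its inverse on
  the quotient is not given by Laurent monomials, and regularity has to descend from the covering
  torus. The mirror enters through the birational morphism that a resolution carries.\<close>

lemma pts_subspace [simp]: "pts (subspace_of X S) = pts X \<inter> S"
  by (simp add: subspace_of_def)

lemma openin_subspace:
  "openin (Top (subspace_of X S)) U \<longleftrightarrow> (\<exists>V. openin (Top X) V \<and> U = V \<inter> S)"
  by (simp add: subspace_of_def openin_subtopology)

lemma Reg_subspace_iff:
  "f \<in> Reg (subspace_of X S) U \<longleftrightarrow>
     (\<forall>p\<in>U. \<exists>V. openin (Top X) V \<and> p \<in> V \<and> V \<inter> S \<subseteq> U \<and> (\<exists>g\<in>Reg X V. \<forall>x\<in>V \<inter> S. f x = g x))"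
  by (simp add: subspace_of_def)

lemma is_sheafI:
  assumes "\<And>U f. openin (Top X) U \<Longrightarrow>
    \<forall>p\<in>U. \<exists>V g. openin (Top X) V \<and> p \<in> V \<and> V \<subseteq> U \<and> g \<in> Reg X V \<and> (\<forall>x\<in>V. f x = g x) \<Longrightarrow> f \<in> Reg X U"
  shows "is_sheaf X"
  unfolding is_sheaf_def
proof (intro allI impI iffI)
  fix U f assume "openin (Top X) U" "f \<in> Reg X U"
  then show "\<forall>p\<in>U. \<exists>V. openin (Top X) V \<and> p \<in> V \<and> V \<subseteq> U \<and> (\<exists>g\<in>Reg X V. \<forall>x\<in>V. f x = g x)"
    by blast
next
  fix U f assume "openin (Top X) U"
    "\<forall>p\<in>U. \<exists>V. openin (Top X) V \<and> p \<in> V \<and> V \<subseteq> U \<and> (\<exists>g\<in>Reg X V. \<forall>x\<in>V. f x = g x)"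
  then show "f \<in> Reg X U"
    by (intro assms) (assumption, blast)
qed

lemma sheaf_glue:
  assumes "is_sheaf X" "openin (Top X) U"
    "\<And>p. p \<in> U \<Longrightarrow> \<exists>V g. openin (Top X) V \<and> p \<in> V \<and> V \<subseteq> U \<and> g \<in> Reg X V \<and> (\<forall>x\<in>V. f x = g x)"
  shows "f \<in> Reg X U"
proof -
  have "\<exists>V. openin (Top X) V \<and> p \<in> V \<and> V \<subseteq> U \<and> (\<exists>g\<in>Reg X V. \<forall>x\<in>V. f x = g x)" if "p \<in> U" for p
    using assms(3)[OF that] by (elim exE conjE) (intro exI conjI bexI)
  then have "\<forall>p\<in>U. \<exists>V. openin (Top X) V \<and> p \<in> V \<and> V \<subseteq> U \<and> (\<exists>g\<in>Reg X V. \<forall>x\<in>V. f x = g x)"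
    by (rule ballI)
  with spec[OF spec[OF assms(1)[unfolded is_sheaf_def], of U], of f] assms(2) show ?thesis
    by (simp only: simp_thms)
qed

text \<open>Regularity on a subspace is defined by local representation in the ambient space, and
  two layers of local representation compose to one.\<close>

lemma is_sheaf_subspace: "is_sheaf (subspace_of X S)"
proof (rule is_sheafI)
  fix U f
  assume loc: "\<forall>p\<in>U. \<exists>V g. openin (Top (subspace_of X S)) V \<and> p \<in> V \<and> V \<subseteq> U \<and>
      g \<in> Reg (subspace_of X S) V \<and> (\<forall>x\<in>V. f x = g x)"
  show "f \<in> Reg (subspace_of X S) U"
    unfolding Reg_subspace_iff
  proof
    fix p assume "p \<in> U"
    from bspec[OF loc this]
    obtain V g where V: "p \<in> V" "V \<subseteq> U" "g \<in> Reg (subspace_of X S) V" "\<forall>x\<in>V. f x = g x"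
      by auto
    from bspec[OF V(3)[unfolded Reg_subspace_iff] V(1)]
    obtain V' g' where V': "openin (Top X) V'" "p \<in> V'" "V' \<inter> S \<subseteq> V" "g' \<in> Reg X V'"
      "\<forall>x\<in>V' \<inter> S. g x = g' x"
      by auto
    have "\<forall>x\<in>V' \<inter> S. f x = g' x" using V(4) V'(3,5) by auto
    then show "\<exists>V. openin (Top X) V \<and> p \<in> V \<and> V \<inter> S \<subseteq> U \<and> (\<exists>g\<in>Reg X V. \<forall>x\<in>V \<inter> S. f x = g x)"
      using V(2) V'(1-4) by (intro exI[of _ V'] conjI bexI[of _ g']) auto
  qed
qed

text \<open>The gluing condition \<^const>\<open>is_sheaf\<close> does not include the restriction maps.\<close>

definition is_presheaf :: "'a fspace \<Rightarrow> bool" where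
  "is_presheaf X \<longleftrightarrow>
     (\<forall>U V f. openin (Top X) U \<longrightarrow> openin (Top X) V \<longrightarrow> V \<subseteq> U \<longrightarrow> f \<in> Reg X U \<longrightarrow> f \<in> Reg X V)"

lemma presheaf_restrict:
  assumes "is_presheaf X" "f \<in> Reg X U" "openin (Top X) U" "openin (Top X) V" "V \<subseteq> U"
  shows "f \<in> Reg X V"
  using assms unfolding is_presheaf_def by blast

lemma is_presheaf_subspace:
  assumes "is_presheaf X"
  shows "is_presheaf (subspace_of X S)"
  unfolding is_presheaf_def
proof (intro allI impI)
  fix U V f assume V: "openin (Top (subspace_of X S)) V" "V \<subseteq> U"
    and f: "f \<in> Reg (subspace_of X S) U"
  from V obtain V' where V': "openin (Top X) V'" "V = V' \<inter> S" unfolding openin_subspace by blast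
  show "f \<in> Reg (subspace_of X S) V"
    unfolding Reg_subspace_iff
  proof
    fix p assume "p \<in> V"
    from bspec[OF f[unfolded Reg_subspace_iff] subsetD[OF V(2) this]]
    obtain W g where W: "openin (Top X) W" "p \<in> W" "g \<in> Reg X W" "\<forall>x\<in>W \<inter> S. f x = g x"
      by auto
    have "g \<in> Reg X (W \<inter> V')"
      using W V' by (intro presheaf_restrict[OF assms W(3)] openin_Int) auto
    with W V' \<open>p \<in> V\<close>
    show "\<exists>W. openin (Top X) W \<and> p \<in> W \<and> W \<inter> S \<subseteq> V \<and> (\<exists>g\<in>Reg X W. \<forall>x\<in>W \<inter> S. f x = g x)"
      by (intro exI[of _ "W \<inter> V'"]) (auto simp: openin_Int)
  qed
qed

section \<open>Morphisms and isomorphisms\<close>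

lemma is_morphismI:
  assumes "continuous_map (Top X) (Top Y) f"
    "\<And>V h. openin (Top Y) V \<Longrightarrow> h \<in> Reg Y V \<Longrightarrow> (\<lambda>x. h (f x)) \<in> Reg X {x \<in> pts X. f x \<in> V}"
  shows "is_morphism X Y f"
  using assms unfolding is_morphism_def comp_def by blast

lemma morphism_continuous: "is_morphism X Y f \<Longrightarrow> continuous_map (Top X) (Top Y) f"
  by (simp add: is_morphism_def)

lemma morphism_openin:
  "is_morphism X Y f \<Longrightarrow> openin (Top Y) V \<Longrightarrow> openin (Top X) {x \<in> pts X. f x \<in> V}"
  by (rule openin_continuous_map_preimage[OF morphism_continuous])

lemma morphism_Reg:
  "is_morphism X Y f \<Longrightarrow> openin (Top Y) V \<Longrightarrow> h \<in> Reg Y V \<Longrightarrow>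
     (\<lambda>x. h (f x)) \<in> Reg X {x \<in> pts X. f x \<in> V}"
  unfolding is_morphism_def comp_def by blast

lemma morphism_mem: "is_morphism X Y f \<Longrightarrow> x \<in> pts X \<Longrightarrow> f x \<in> pts Y"
  by (auto dest!: morphism_continuous continuous_map_image_subset_topspace)

lemma morphism_comp:
  assumes "is_morphism X Y f" "is_morphism Y Z g"
  shows "is_morphism X Z (\<lambda>x. g (f x))"
proof (rule is_morphismI)
  show "continuous_map (Top X) (Top Z) (\<lambda>x. g (f x))"
    using continuous_map_compose[OF morphism_continuous morphism_continuous, OF assms]
    by (simp add: comp_def)
next
  fix V h assume V: "openin (Top Z) V" "h \<in> Reg Z V"
  have "{x \<in> pts X. f x \<in> {y \<in> pts Y. g y \<in> V}} = {x \<in> pts X. g (f x) \<in> V}"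
    using morphism_mem[OF assms(1)] by blast
  then show "(\<lambda>x. h (g (f x))) \<in> Reg X {x \<in> pts X. g (f x) \<in> V}"
    using morphism_Reg[OF assms(1) morphism_openin[OF assms(2) V(1)] morphism_Reg[OF assms(2) V]]
    by simp
qed

text \<open>Pullbacks along \<open>f\<close> and \<open>g\<close> agree only on
  \<open>pts X\<close>, whereas \<open>Reg\<close> consists of total functions; the sheaf condition
  makes membership insensitive to values outside the open set.\<close>

lemma morphism_cong:
  assumes "is_sheaf X" "is_morphism X Y f" "\<And>x. x \<in> pts X \<Longrightarrow> f x = g x"
  shows "is_morphism X Y g"
proof (rule is_morphismI)
  show "continuous_map (Top X) (Top Y) g"
    using continuous_map_eq[OF morphism_continuous[OF assms(2)] assms(3)] .
next
  fix V h assume V: "openin (Top Y) V" "h \<in> Reg Y V"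
  have eq: "{x \<in> pts X. g x \<in> V} = {x \<in> pts X. f x \<in> V}" using assms(3) by auto
  show "(\<lambda>x. h (g x)) \<in> Reg X {x \<in> pts X. g x \<in> V}"
  proof (rule sheaf_glue[OF assms(1)], goal_cases)
    case 1 show ?case unfolding eq by (rule morphism_openin[OF assms(2) V(1)])
  next
    case (2 p)
    then show ?case
      using morphism_openin[OF assms(2) V(1)] morphism_Reg[OF assms(2) V] assms(3) unfolding eq
      by (intro exI[of _ "{x \<in> pts X. f x \<in> V}"] exI[of _ "\<lambda>x. h (f x)"]) auto
  qed
qed

lemma morphism_inclusion: "is_morphism (subspace_of X S) X (\<lambda>x. x)"
proof (rule is_morphismI)
  show "continuous_map (Top (subspace_of X S)) (Top X) (\<lambda>x. x)"
    by (simp add: subspace_of_def continuous_map_from_subtopology)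
next
  fix V h assume "openin (Top X) V" "h \<in> Reg X V"
  then show "h \<in> Reg (subspace_of X S) {x \<in> pts (subspace_of X S). x \<in> V}"
    unfolding Reg_subspace_iff using openin_subset[of "Top X" V]
    by (intro ballI exI[of _ V]) auto
qed

text \<open>A function regular on the subspace extends to \<open>Y\<close> only locally, so its
  pullback is glued from the pullbacks of the local extensions.\<close>

lemma morphism_into_subspace:
  assumes "is_sheaf X" "is_morphism X Y f" "\<And>x. x \<in> pts X \<Longrightarrow> f x \<in> T"
  shows "is_morphism X (subspace_of Y T) f"
proof (rule is_morphismI)
  show cont: "continuous_map (Top X) (Top (subspace_of Y T)) f"
    using assms(3) morphism_continuous[OF assms(2)]
    by (auto simp add: subspace_of_def continuous_map_in_subtopology)
  fix V h assume V: "openin (Top (subspace_of Y T)) V" "h \<in> Reg (subspace_of Y T) V"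
  show "(\<lambda>x. h (f x)) \<in> Reg X {x \<in> pts X. f x \<in> V}"
  proof (rule sheaf_glue[OF assms(1)])
    show "openin (Top X) {x \<in> pts X. f x \<in> V}"
      using openin_continuous_map_preimage[OF cont V(1)] .
    fix p assume "p \<in> {x \<in> pts X. f x \<in> V}"
    then have p: "p \<in> pts X" "f p \<in> V" by auto
    from bspec[OF V(2)[unfolded Reg_subspace_iff] p(2)]
    obtain W g where W: "openin (Top Y) W" "f p \<in> W" "W \<inter> T \<subseteq> V" "g \<in> Reg Y W"
      "\<forall>x\<in>W \<inter> T. h x = g x"
      by auto
    show "\<exists>V' g. openin (Top X) V' \<and> p \<in> V' \<and> V' \<subseteq> {x \<in> pts X. f x \<in> V} \<and> g \<in> Reg X V' \<and>
        (\<forall>x\<in>V'. h (f x) = g x)"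
      using morphism_openin[OF assms(2) W(1)] morphism_Reg[OF assms(2) W(1,4)] W p assms(3)
      by (intro exI[of _ "{x \<in> pts X. f x \<in> W}"] exI[of _ "\<lambda>x. g (f x)"]) auto
  qed
qed

lemma morphism_restrict_domain:
  assumes "is_morphism (subspace_of X S) Y f" "S' \<subseteq> S"
  shows "is_morphism (subspace_of X S') Y f"
proof -
  have "is_morphism (subspace_of X S') (subspace_of X S) (\<lambda>x. x)"
    using assms(2)
    by (intro morphism_into_subspace is_sheaf_subspace morphism_inclusion) auto
  from morphism_comp[OF this assms(1)] show ?thesis .
qed

lemma morphism_restrict:
  assumes "is_morphism (subspace_of X S) (subspace_of Y T) f" "S' \<subseteq> S"
    "\<And>x. x \<in> pts X \<Longrightarrow> x \<in> S' \<Longrightarrow> f x \<in> T'"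
  shows "is_morphism (subspace_of X S') (subspace_of Y T') f"
  using assms(3)
  by (intro morphism_into_subspace is_sheaf_subspace
      morphism_restrict_domain[OF morphism_comp[OF assms(1) morphism_inclusion] assms(2)]) auto

lemma is_isomorphismI:
  assumes "is_morphism X Y f" "is_morphism Y X g"
    "\<And>x. x \<in> pts X \<Longrightarrow> g (f x) = x" "\<And>y. y \<in> pts Y \<Longrightarrow> f (g y) = y"
  shows "is_isomorphism X Y f"
  using assms unfolding is_isomorphism_def homeomorphic_maps_def
  by (intro exI[of _ g]) (auto simp: morphism_continuous)

lemma is_isomorphismE:
  assumes "is_isomorphism X Y f"
  obtains g where "is_morphism X Y f" "is_morphism Y X g"
    "\<And>x. x \<in> pts X \<Longrightarrow> g (f x) = x" "\<And>y. y \<in> pts Y \<Longrightarrow> f (g y) = y"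
  using assms unfolding is_isomorphism_def homeomorphic_maps_def by blast

subsection \<open>Birational equivalence\<close>

lemma dense_open_iff:
  "dense_open X U \<longleftrightarrow>
     openin (Top X) U \<and> (\<forall>V. openin (Top X) V \<longrightarrow> V \<noteq> {} \<longrightarrow> (\<exists>x\<in>U. x \<in> V))"
  unfolding dense_open_def dense_intersects_open by (simp add: Bex_def disjoint_iff) blast

text \<open>Both inverse maps and both domains are kept explicit, since a composition of birational
  maps has to shrink the domains on either side.\<close>

definition birational_pair ::
    "'a fspace \<Rightarrow> 'b fspace \<Rightarrow> 'a set \<Rightarrow> 'b set \<Rightarrow> ('a \<Rightarrow> 'b) \<Rightarrow> ('b \<Rightarrow> 'a) \<Rightarrow> bool" where
  "birational_pair X Y U V f g \<longleftrightarrow> dense_open X U \<and> dense_open Y V \<and>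
     is_morphism (subspace_of X U) (subspace_of Y V) f \<and>
     is_morphism (subspace_of Y V) (subspace_of X U) g \<and>
     (\<forall>x\<in>U. f x \<in> V \<and> g (f x) = x) \<and> (\<forall>y\<in>V. g y \<in> U \<and> f (g y) = y)"

lemma birational_pair_sym: "birational_pair X Y U V f g \<Longrightarrow> birational_pair Y X V U g f"
  by (simp add: birational_pair_def)

lemma birational_iff: "X \<approx>\<^sub>b Y \<longleftrightarrow> (\<exists>U V f g. birational_pair X Y U V f g)"
proof
  assume "X \<approx>\<^sub>b Y"
  then obtain U V f where UV: "dense_open X U" "dense_open Y V"
    and iso: "is_isomorphism (subspace_of X U) (subspace_of Y V) f"
    unfolding birational_def isomorphic_def by blast
  from is_isomorphismE[OF iso] obtain g
    where fg: "is_morphism (subspace_of X U) (subspace_of Y V) f"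
    "is_morphism (subspace_of Y V) (subspace_of X U) g"
    "\<And>x. x \<in> pts (subspace_of X U) \<Longrightarrow> g (f x) = x"
    "\<And>y. y \<in> pts (subspace_of Y V) \<Longrightarrow> f (g y) = y"
    by blast
  have "pts (subspace_of X U) = U" "pts (subspace_of Y V) = V"
    using UV unfolding dense_open_def by (auto dest: openin_subset)
  then have "birational_pair X Y U V f g"
    unfolding birational_pair_def
    using UV fg morphism_mem[OF fg(1)] morphism_mem[OF fg(2)] by auto
  then show "\<exists>U V f g. birational_pair X Y U V f g" by blast
next
  assume "\<exists>U V f g. birational_pair X Y U V f g"
  then obtain U V f g where *: "birational_pair X Y U V f g" by blast
  then have "is_isomorphism (subspace_of X U) (subspace_of Y V) f"
    by (intro is_isomorphismI[of _ _ _ g]) (auto simp: birational_pair_def)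
  with * show "X \<approx>\<^sub>b Y"
    unfolding birational_def isomorphic_def birational_pair_def by blast
qed

lemma birational_sym: "X \<approx>\<^sub>b Y \<Longrightarrow> Y \<approx>\<^sub>b X"
  unfolding birational_iff by (blast intro: birational_pair_sym)

lemma morphism_openin_subspace:
  assumes "is_morphism (subspace_of X U) (subspace_of Y V) f" "openin (Top X) U"
    "\<And>x. x \<in> U \<Longrightarrow> f x \<in> V" "openin (Top Y) W"
  shows "openin (Top X) {x \<in> U. f x \<in> W}"
proof -
  have "openin (Top (subspace_of Y V)) (W \<inter> V)"
    using assms(4) unfolding openin_subspace by blast
  from morphism_openin[OF assms(1) this] obtain Q where
    "openin (Top X) Q" "{x \<in> pts (subspace_of X U). f x \<in> W \<inter> V} = Q \<inter> U"
    unfolding openin_subspace by blast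
  moreover have "{x \<in> pts (subspace_of X U). f x \<in> W \<inter> V} = {x \<in> U. f x \<in> W}"
    using assms(3) openin_subset[OF assms(2)] by auto
  ultimately show ?thesis using assms(2) by (metis openin_Int)
qed

text \<open>A nonempty open set of \<open>X\<close> meets \<open>U\<close>; its image in
  \<open>V\<close> is again nonempty and open, hence meets \<open>V'\<close>, and \<open>g\<close>
  carries a common point back.\<close>

lemma dense_open_preimage:
  assumes p: "birational_pair X Y U V f g" and V': "dense_open Y V'"
  shows "dense_open X {x \<in> U. f x \<in> V'}"
  unfolding dense_open_iff
proof (intro conjI allI impI)
  have open_UV: "openin (Top X) U" "openin (Top Y) V"
    and f: "is_morphism (subspace_of X U) (subspace_of Y V) f"
    and g: "is_morphism (subspace_of Y V) (subspace_of X U) g"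
    and fg: "\<And>x. x \<in> U \<Longrightarrow> f x \<in> V" "\<And>y. y \<in> V \<Longrightarrow> g y \<in> U" "\<And>x. x \<in> U \<Longrightarrow> g (f x) = x"
      "\<And>y. y \<in> V \<Longrightarrow> f (g y) = y"
    using p unfolding birational_pair_def dense_open_iff by blast+
  show "openin (Top X) {x \<in> U. f x \<in> V'}"
    using V' by (intro morphism_openin_subspace[OF f open_UV(1) fg(1)]) (auto simp: dense_open_iff)
  fix Q assume Q: "openin (Top X) Q" "Q \<noteq> {}"
  then obtain x where x: "x \<in> U" "x \<in> Q"
    using p unfolding birational_pair_def dense_open_iff by blast
  have "openin (Top Y) {y \<in> V. g y \<in> Q}"
    by (rule morphism_openin_subspace[OF g open_UV(2) fg(2) Q(1)])
  moreover have "f x \<in> {y \<in> V. g y \<in> Q}" using x fg by simp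
  ultimately obtain y where "y \<in> V'" "y \<in> V" "g y \<in> Q"
    using V' unfolding dense_open_iff by blast
  then show "\<exists>x\<in>{x \<in> U. f x \<in> V'}. x \<in> Q" using fg by (intro bexI[of _ "g y"]) auto
qed

lemma birational_trans [trans]:
  assumes "X \<approx>\<^sub>b Y" "Y \<approx>\<^sub>b Z"
  shows "X \<approx>\<^sub>b Z"
proof -
  obtain U V f g where 1: "birational_pair X Y U V f g"
    using assms(1) unfolding birational_iff by blast
  obtain U' V' f' g' where 2: "birational_pair Y Z U' V' f' g'"
    using assms(2) unfolding birational_iff by blast
  note d = 1[unfolded birational_pair_def] 2[unfolded birational_pair_def]
  \<comment> \<open>The composites are defined where the middle point lies in
    \<open>V \<inter> U'\<close>; these are the corresponding domains in \<open>X\<close> and in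
    \<open>Z\<close>.\<close>
  let ?U = "{x \<in> U. f x \<in> U'}" and ?V = "{z \<in> V'. g' z \<in> V}"
  have inv: "f x \<in> V" "g (f x) = x" if "x \<in> U" for x using d(1) that by blast+
  have inv_g: "g y \<in> U" "f (g y) = y" if "y \<in> V" for y using d(1) that by blast+
  have inv_f': "f' x \<in> V'" "g' (f' x) = x" if "x \<in> U'" for x using d(2) that by blast+
  have inv_g': "g' y \<in> U'" "f' (g' y) = y" if "y \<in> V'" for y using d(2) that by blast+
  have "is_morphism (subspace_of X U) (subspace_of Y V) f" using d(1) by blast
  then have "is_morphism (subspace_of X ?U) (subspace_of Y (V \<inter> U')) f"
    by (rule morphism_restrict) (simp_all add: inv Collect_restrict)
  moreover have "is_morphism (subspace_of Y V) (subspace_of X U) g" using d(1) by blast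
  then have "is_morphism (subspace_of Y (V \<inter> U')) (subspace_of X ?U) g"
    by (rule morphism_restrict) (simp_all add: inv_g)
  moreover have "is_morphism (subspace_of Y U') (subspace_of Z V') f'" using d(2) by blast
  then have "is_morphism (subspace_of Y (V \<inter> U')) (subspace_of Z ?V) f'"
    by (rule morphism_restrict) (simp_all add: inv_f')
  moreover have "is_morphism (subspace_of Z V') (subspace_of Y U') g'" using d(2) by blast
  then have "is_morphism (subspace_of Z ?V) (subspace_of Y (V \<inter> U')) g'"
    by (rule morphism_restrict) (simp_all add: inv_g' Collect_restrict)
  ultimately have "is_morphism (subspace_of X ?U) (subspace_of Z ?V) (\<lambda>x. f' (f x))"
    "is_morphism (subspace_of Z ?V) (subspace_of X ?U) (\<lambda>x. g (g' x))"
    by (blast intro: morphism_comp)+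
  moreover have "dense_open X ?U" using d(2) by (intro dense_open_preimage[OF 1]) blast
  moreover have "dense_open Z ?V"
    using d(1) by (intro dense_open_preimage[OF birational_pair_sym[OF 2]]) blast
  ultimately have "birational_pair X Z ?U ?V (\<lambda>x. f' (f x)) (\<lambda>x. g (g' x))"
    unfolding birational_pair_def by (simp add: inv inv_g inv_f' inv_g')
  then show ?thesis unfolding birational_iff by blast
qed

lemma resolution_birational:
  assumes "resolution_of W X"
  shows "X \<approx>\<^sub>b W"
proof (rule birational_sym)
  from assms obtain \<pi> V where "dense_open X V" "dense_open W {x \<in> pts W. \<pi> x \<in> V}"
    "is_isomorphism (subspace_of W {x \<in> pts W. \<pi> x \<in> V}) (subspace_of X V) \<pi>"
    unfolding resolution_of_def birational_morphism_def by (elim conjE exE)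
  then show "W \<approx>\<^sub>b X" unfolding birational_def isomorphic_def by (intro exI conjI)
qed

subsection \<open>Quotients\<close>

lemma quotient_open_pts: "quotient_open X r (pts X // r)"
proof -
  have "{x \<in> pts X. r `` {x} \<in> pts X // r} = pts X" by (auto intro: quotientI)
  then show ?thesis unfolding quotient_open_def by simp
qed

lemma pts_quotient [simp]: "pts (quotient_space X r) = pts X // r"
proof (rule antisym)
  have "quotient_open X r (pts (quotient_space X r))"
    by (simp only: openin_quotient_space[symmetric] openin_topspace)
  then show "pts (quotient_space X r) \<subseteq> pts X // r" unfolding quotient_open_def by (rule conjunct1)
  show "pts X // r \<subseteq> pts (quotient_space X r)"
    by (rule openin_subset) (simp only: openin_quotient_space quotient_open_pts)
qed

lemma Reg_quotient_iff:
  "f \<in> Reg (quotient_space X r) U \<longleftrightarrow> (\<lambda>x. f (r `` {x})) \<in> Reg X {x \<in> pts X. r `` {x} \<in> U}"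
  by (simp add: quotient_space_def)

lemma is_presheaf_quotient:
  assumes "is_presheaf X"
  shows "is_presheaf (quotient_space X r)"
  unfolding is_presheaf_def openin_quotient_space Reg_quotient_iff quotient_open_def
  by (auto elim!: presheaf_restrict[OF assms])

lemma morphism_projection: "is_morphism X (quotient_space X r) (\<lambda>x. r `` {x})"
proof (rule is_morphismI)
  show "continuous_map (Top X) (Top (quotient_space X r)) (\<lambda>x. r `` {x})"
    unfolding continuous_map openin_quotient_space pts_quotient
    by (auto simp: quotient_open_def intro: quotientI)
qed (simp add: Reg_quotient_iff)

text \<open>Universal property of the quotient over an open part \<open>T\<close>. Openness and
  regularity on the quotient are tested on \<open>X\<close>, while \<open>f\<close> is only known on
  the subspace \<open>S\<close>, whose regular functions extend locally to \<open>X\<close>; as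
  \<open>S\<close> is open, the extensions restrict to open subsets of \<open>S\<close> and
  glue.\<close>

lemma morphism_from_quotient:
  assumes "is_sheaf X" "is_presheaf X" and T: "openin (Top (quotient_space X r)) T"
    and S: "S = {x \<in> pts X. r `` {x} \<in> T}"
    and f: "is_morphism (subspace_of X S) Y (\<lambda>x. f (r `` {x}))"
  shows "is_morphism (subspace_of (quotient_space X r) T) Y f"
proof -
  have sub: "T \<subseteq> pts X // r" and open_S: "openin (Top X) S"
    using T unfolding openin_quotient_space quotient_open_def S by auto
  have preS: "{x \<in> pts X. r `` {x} \<in> {p \<in> T. f p \<in> V}} = {x \<in> S. f (r `` {x}) \<in> V}" for V
    unfolding S by blast
  have pre: "openin (Top X) {x \<in> S. f (r `` {x}) \<in> V}"
    and pre': "openin (Top (quotient_space X r)) {p \<in> T. f p \<in> V}"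
    if V: "openin (Top Y) V" for V
  proof -
    from morphism_openin[OF f V] obtain W where "openin (Top X) W"
      "{x \<in> S. f (r `` {x}) \<in> V} = W \<inter> S"
      unfolding openin_subspace S by auto
    then show 1: "openin (Top X) {x \<in> S. f (r `` {x}) \<in> V}" using open_S by (simp add: openin_Int)
    then show "openin (Top (quotient_space X r)) {p \<in> T. f p \<in> V}"
      unfolding openin_quotient_space quotient_open_def preS using 1 sub by auto
  qed
  show ?thesis
  proof (rule is_morphismI)
    have "f p \<in> pts Y" if "p \<in> T" for p
    proof -
      obtain x where "x \<in> pts X" "p = r `` {x}" using \<open>p \<in> T\<close> sub by (blast elim: quotientE)
      then show ?thesis using morphism_mem[OF f, of x] that unfolding S by simp
    qed
    moreover have "openin (Top (subspace_of (quotient_space X r) T)) {p \<in> T. f p \<in> V}"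
      if "openin (Top Y) V" for V
      unfolding openin_subspace using pre'[OF that] by (intro exI[of _ "{p \<in> T. f p \<in> V}"]) auto
    moreover have "pts (quotient_space X r) \<inter> T = T" using sub by auto
    ultimately show "continuous_map (Top (subspace_of (quotient_space X r) T)) (Top Y) f"
      unfolding continuous_map pts_subspace by auto
  next
    fix V h assume V: "openin (Top Y) V" "h \<in> Reg Y V"
    have "(\<lambda>x. h (f (r `` {x}))) \<in> Reg X {x \<in> S. f (r `` {x}) \<in> V}"
    proof (rule sheaf_glue[OF assms(1) pre[OF V(1)]])
      fix p assume p: "p \<in> {x \<in> S. f (r `` {x}) \<in> V}"
      have "pts (subspace_of X S) = S" using openin_subset[OF open_S] by auto
      have "{x \<in> pts (subspace_of X S). f (r `` {x}) \<in> V} = {x \<in> S. f (r `` {x}) \<in> V}"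
        unfolding pts_subspace S by blast
      with morphism_Reg[OF f V]
      have "(\<lambda>x. h (f (r `` {x}))) \<in> Reg (subspace_of X S) {x \<in> S. f (r `` {x}) \<in> V}" by simp
      from bspec[OF this[unfolded Reg_subspace_iff] p]
      obtain W g where W: "openin (Top X) W" "p \<in> W" "W \<inter> S \<subseteq> {x \<in> S. f (r `` {x}) \<in> V}"
        "g \<in> Reg X W" "\<forall>x\<in>W \<inter> S. h (f (r `` {x})) = g x"
        by auto
      have WS: "openin (Top X) (W \<inter> S)" using W(1) open_S by (rule openin_Int)
      have "g \<in> Reg X (W \<inter> S)"
        by (rule presheaf_restrict[OF assms(2) W(4,1) WS]) (rule Int_lower1)
      moreover have "p \<in> W \<inter> S" using W(2) p by simp
      ultimately show "\<exists>V' g. openin (Top X) V' \<and> p \<in> V' \<and> V' \<subseteq> {x \<in> S. f (r `` {x}) \<in> V} \<and>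
          g \<in> Reg X V' \<and> (\<forall>x\<in>V'. h (f (r `` {x})) = g x)"
        using WS W(3,5) by (intro exI conjI)
    qed
    then have "(\<lambda>p. h (f p)) \<in> Reg (quotient_space X r) {p \<in> T. f p \<in> V}"
      unfolding Reg_quotient_iff preS .
    then show "(\<lambda>p. h (f p)) \<in> Reg (subspace_of (quotient_space X r) T)
        {p \<in> pts (subspace_of (quotient_space X r) T). f p \<in> V}"
      unfolding Reg_subspace_iff using pre'[OF V(1)] sub
      by (intro ballI exI[of _ "{p \<in> T. f p \<in> V}"] conjI bexI[of _ "\<lambda>p. h (f p)"]) auto
  qed
qed

section \<open>Affine space and Laurent monomials\<close>

lemma pts_affine_space [simp]: "pts (affine_space n) = affine_pts n"
proof (rule antisym)
  have "zariski_open n (pts (affine_space n))"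
    by (simp only: openin_affine_space[symmetric] openin_topspace)
  then show "pts (affine_space n) \<subseteq> affine_pts n" unfolding zariski_open_def by blast
  have "zariski_open n (affine_pts n)"
    unfolding zariski_open_def by (rule exI[of _ "{\<lambda>x. 1}"]) (auto intro: poly_funs.const)
  then show "affine_pts n \<subseteq> pts (affine_space n)"
    by (intro openin_subset) (simp only: openin_affine_space)
qed

lemma zariski_open_nonzero: "p \<in> poly_funs \<Longrightarrow> zariski_open n {x \<in> affine_pts n. p x \<noteq> 0}"
  unfolding zariski_open_def by (rule exI[of _ "{p}"]) auto

lemma zariski_openE:
  assumes "zariski_open n U" "x \<in> U"
  obtains p where "p \<in> poly_funs" "p x \<noteq> 0" "\<And>y. y \<in> affine_pts n \<Longrightarrow> p y \<noteq> 0 \<Longrightarrow> y \<in> U"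
  using assms unfolding zariski_open_def by blast

lemma zariski_open_subset: "zariski_open n U \<Longrightarrow> U \<subseteq> affine_pts n"
  unfolding zariski_open_def by blast

lemma zariski_open_Int: "zariski_open n U \<Longrightarrow> zariski_open n V \<Longrightarrow> zariski_open n (U \<inter> V)"
  unfolding openin_affine_space[symmetric] by (rule openin_Int)

lemma Reg_affine_iff:
  "f \<in> Reg (affine_space n) U \<longleftrightarrow>
     (\<forall>a\<in>U. \<exists>V p q. zariski_open n V \<and> a \<in> V \<and> V \<subseteq> U \<and> p \<in> poly_funs \<and> q \<in> poly_funs \<and>
        (\<forall>x\<in>V. q x \<noteq> 0 \<and> f x = p x / q x))"
  by (simp add: affine_space_def)

lemma is_presheaf_affine_space: "is_presheaf (affine_space n)"
  unfolding is_presheaf_def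
proof (intro allI impI)
  fix U V f assume UV: "openin (Top (affine_space n)) V" "V \<subseteq> U" and f: "f \<in> Reg (affine_space n) U"
  show "f \<in> Reg (affine_space n) V"
    unfolding Reg_affine_iff
  proof
    fix a assume a: "a \<in> V"
    from bspec[OF f[unfolded Reg_affine_iff] subsetD[OF UV(2) a]]
    obtain W p q where "zariski_open n W" "a \<in> W" "p \<in> poly_funs" "q \<in> poly_funs"
      "\<forall>x\<in>W. q x \<noteq> 0 \<and> f x = p x / q x"
      by auto
    then show "\<exists>W p q. zariski_open n W \<and> a \<in> W \<and> W \<subseteq> V \<and> p \<in> poly_funs \<and> q \<in> poly_funs \<and>
        (\<forall>x\<in>W. q x \<noteq> 0 \<and> f x = p x / q x)"
      using a UV(1) unfolding openin_affine_space
      by (intro exI[of _ "W \<inter> V"] exI[of _ p] exI[of _ q]) (simp add: zariski_open_Int)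
  qed
qed

lemma Reg_affine_fraction:
  assumes "p \<in> poly_funs" "q \<in> poly_funs" "zariski_open n U" "\<And>x. x \<in> U \<Longrightarrow> q x \<noteq> 0"
  shows "(\<lambda>x. p x / q x) \<in> Reg (affine_space n) U"
  unfolding Reg_affine_iff using assms by (intro ballI exI[of _ U] exI[of _ p] exI[of _ q]) auto

section \<open>Arithmetic of polynomial and rational functions\<close>

lemma poly_funs_sum: "(\<And>i. i \<in> A \<Longrightarrow> p i \<in> poly_funs) \<Longrightarrow> (\<lambda>x. \<Sum>i\<in>A. p i x) \<in> poly_funs"
  by (induction A rule: infinite_finite_induct) (auto intro: poly_funs.intros)

lemma poly_funs_prod: "(\<And>i. i \<in> A \<Longrightarrow> p i \<in> poly_funs) \<Longrightarrow> (\<lambda>x. \<Prod>i\<in>A. p i x) \<in> poly_funs"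
  by (induction A rule: infinite_finite_induct) (auto intro: poly_funs.intros)

lemma poly_funs_power: "p \<in> poly_funs \<Longrightarrow> (\<lambda>x. p x ^ k) \<in> poly_funs"
  by (induction k) (auto intro: poly_funs.intros)

lemma poly_funs_diff:
  assumes "p \<in> poly_funs" "q \<in> poly_funs"
  shows "(\<lambda>x. p x - q x) \<in> poly_funs"
  using poly_funs.add[OF assms(1) poly_funs.mult[OF poly_funs.const[of "-1"] assms(2)]] by simp

lemma poly_funs_compose:
  assumes "p \<in> poly_funs" "\<And>i. (\<lambda>x. f x i) \<in> poly_funs"
  shows "(\<lambda>x. p (f x)) \<in> poly_funs"
  using assms(1) by induction (auto intro: poly_funs.intros assms(2))

text \<open>One global fraction on \<open>S\<close>, in contrast to the local fractions in
  \<open>Reg (affine_space n)\<close>; closure under arithmetic then involves no coverings.\<close>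

definition rational_on :: "(nat \<Rightarrow> complex) set \<Rightarrow> ((nat \<Rightarrow> complex) \<Rightarrow> complex) \<Rightarrow> bool" where
  "rational_on S f \<longleftrightarrow> (\<exists>p\<in>poly_funs. \<exists>q\<in>poly_funs. \<forall>x\<in>S. q x \<noteq> 0 \<and> f x = p x / q x)"

lemma rational_onI:
  "p \<in> poly_funs \<Longrightarrow> q \<in> poly_funs \<Longrightarrow> (\<And>x. x \<in> S \<Longrightarrow> q x \<noteq> 0 \<and> f x = p x / q x) \<Longrightarrow> rational_on S f"
  unfolding rational_on_def by blast

lemma rational_onE:
  assumes "rational_on S f"
  obtains p q where "p \<in> poly_funs" "q \<in> poly_funs" "\<And>x. x \<in> S \<Longrightarrow> q x \<noteq> 0"
    "\<And>x. x \<in> S \<Longrightarrow> f x = p x / q x"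
  using assms unfolding rational_on_def by blast

lemma rational_on_poly: "p \<in> poly_funs \<Longrightarrow> rational_on S p"
  by (rule rational_onI[of p "\<lambda>x. 1"]) (auto intro: poly_funs.const)

lemma rational_on_add:
  assumes "rational_on S f" "rational_on S g"
  shows "rational_on S (\<lambda>x. f x + g x)"
proof -
  obtain p q where 1: "p \<in> poly_funs" "q \<in> poly_funs" "\<And>x. x \<in> S \<Longrightarrow> q x \<noteq> 0"
    "\<And>x. x \<in> S \<Longrightarrow> f x = p x / q x" using assms(1) by (rule rational_onE) blast
  obtain r s where 2: "r \<in> poly_funs" "s \<in> poly_funs" "\<And>x. x \<in> S \<Longrightarrow> s x \<noteq> 0"
    "\<And>x. x \<in> S \<Longrightarrow> g x = r x / s x" using assms(2) by (rule rational_onE) blast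
  show ?thesis
    by (rule rational_onI[of "\<lambda>x. p x * s x + r x * q x" "\<lambda>x. q x * s x"])
      (auto intro!: poly_funs.intros simp: 1 2 add_frac_eq)
qed

lemma rational_on_mult:
  assumes "rational_on S f" "rational_on S g"
  shows "rational_on S (\<lambda>x. f x * g x)"
proof -
  obtain p q where 1: "p \<in> poly_funs" "q \<in> poly_funs" "\<And>x. x \<in> S \<Longrightarrow> q x \<noteq> 0"
    "\<And>x. x \<in> S \<Longrightarrow> f x = p x / q x" using assms(1) by (rule rational_onE) blast
  obtain r s where 2: "r \<in> poly_funs" "s \<in> poly_funs" "\<And>x. x \<in> S \<Longrightarrow> s x \<noteq> 0"
    "\<And>x. x \<in> S \<Longrightarrow> g x = r x / s x" using assms(2) by (rule rational_onE) blast
  show ?thesis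
    by (rule rational_onI[of "\<lambda>x. p x * r x" "\<lambda>x. q x * s x"])
      (auto intro!: poly_funs.intros simp: 1 2)
qed

lemma rational_on_inverse:
  assumes "rational_on S f" "\<And>x. x \<in> S \<Longrightarrow> f x \<noteq> 0"
  shows "rational_on S (\<lambda>x. inverse (f x))"
proof -
  obtain p q where pq: "p \<in> poly_funs" "q \<in> poly_funs" "\<And>x. x \<in> S \<Longrightarrow> q x \<noteq> 0"
    "\<And>x. x \<in> S \<Longrightarrow> f x = p x / q x" using assms(1) by (rule rational_onE) blast
  show ?thesis
  proof (rule rational_onI[OF pq(2,1)])
    fix x assume "x \<in> S"
    then show "p x \<noteq> 0 \<and> inverse (f x) = q x / p x"
      using pq(4) assms(2) by fastforce
  qed
qed

lemma rational_on_power: "rational_on S f \<Longrightarrow> rational_on S (\<lambda>x. f x ^ k)"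
  by (induction k) (auto intro: rational_on_mult rational_on_poly[OF poly_funs.const])

lemma rational_on_power_int:
  assumes "rational_on S f" "\<And>x. x \<in> S \<Longrightarrow> f x \<noteq> 0"
  shows "rational_on S (\<lambda>x. f x powi e)"
  using assms
  by (cases "0 \<le> e") (simp_all add: power_int_def rational_on_power rational_on_inverse)

lemma rational_on_prod:
  "(\<And>i. i \<in> A \<Longrightarrow> rational_on S (f i)) \<Longrightarrow> rational_on S (\<lambda>x. \<Prod>i\<in>A. f i x)"
  by (induction A rule: infinite_finite_induct)
    (auto intro: rational_on_mult rational_on_poly[OF poly_funs.const])

lemma rational_on_sum:
  "(\<And>i. i \<in> A \<Longrightarrow> rational_on S (f i)) \<Longrightarrow> rational_on S (\<lambda>x. \<Sum>i\<in>A. f i x)"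
  by (induction A rule: infinite_finite_induct)
    (auto intro: rational_on_add rational_on_poly[OF poly_funs.const])

lemma rational_on_compose:
  assumes "p \<in> poly_funs" "\<And>i. rational_on S (\<lambda>x. f x i)"
  shows "rational_on S (\<lambda>x. p (f x))"
  using assms(1)
  by induction (auto intro: rational_on_add rational_on_mult rational_on_poly[OF poly_funs.const] assms(2))

text \<open>A polynomial composed with \<open>f\<close> is again a fraction on \<open>S\<close>, so
  a nonvanishing locus pulls back to that of the numerator, and a local fraction to a quotient of
  two fractions.\<close>

lemma morphism_rational_map:
  assumes S: "S \<subseteq> affine_pts n" and f: "\<And>i. rational_on S (\<lambda>x. f x i)"
    and into: "\<And>x. x \<in> S \<Longrightarrow> f x \<in> affine_pts m"
  shows "is_morphism (subspace_of (affine_space n) S) (affine_space m) f"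
proof (rule is_morphismI)
  have ptsS: "pts (subspace_of (affine_space n) S) = S" using S by auto
  have pre: "\<exists>V. zariski_open n V \<and> x \<in> V \<and> (\<forall>y\<in>V \<inter> S. f y \<in> W)"
    if W: "zariski_open m W" and x: "x \<in> S" "f x \<in> W" for W x
  proof -
    obtain p where p: "p \<in> poly_funs" "p (f x) \<noteq> 0"
      "\<And>y. y \<in> affine_pts m \<Longrightarrow> p y \<noteq> 0 \<Longrightarrow> y \<in> W"
      using W x(2) by (rule zariski_openE) blast
    obtain a b where ab: "a \<in> poly_funs" "\<And>y. y \<in> S \<Longrightarrow> b y \<noteq> 0" "\<And>y. y \<in> S \<Longrightarrow> p (f y) = a y / b y"
      using rational_on_compose[where f=f, OF p(1) f] by (rule rational_onE) blast
    show ?thesis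
      using p x ab S into
      by (intro exI[of _ "{y \<in> affine_pts n. a y \<noteq> 0}"]) (auto simp: zariski_open_nonzero)
  qed
  have open_pre: "openin (Top (subspace_of (affine_space n) S)) {x \<in> S. f x \<in> W}"
    if W: "openin (Top (affine_space m)) W" for W
    unfolding openin_subopen[of _ "{x \<in> S. f x \<in> W}"]
  proof
    fix x assume "x \<in> {x \<in> S. f x \<in> W}"
    with pre[of W x] W obtain V where "zariski_open n V" "x \<in> V \<inter> S" "V \<inter> S \<subseteq> {x \<in> S. f x \<in> W}"
      by (auto simp: openin_affine_space)
    then show "\<exists>T. openin (Top (subspace_of (affine_space n) S)) T \<and> x \<in> T \<and> T \<subseteq> {x \<in> S. f x \<in> W}"
      unfolding openin_subspace openin_affine_space by blast
  qed
  then show "continuous_map (Top (subspace_of (affine_space n) S)) (Top (affine_space m)) f"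
    unfolding continuous_map ptsS pts_affine_space using into by auto
  fix V h assume V: "openin (Top (affine_space m)) V" and h: "h \<in> Reg (affine_space m) V"
  show "(\<lambda>x. h (f x)) \<in> Reg (subspace_of (affine_space n) S)
      {x \<in> pts (subspace_of (affine_space n) S). f x \<in> V}"
    unfolding Reg_subspace_iff ptsS
  proof
    fix x assume x: "x \<in> {x \<in> S. f x \<in> V}"
    then have "f x \<in> V" by simp
    from bspec[OF h[unfolded Reg_affine_iff] this]
    obtain W P Q where W: "zariski_open m W" "f x \<in> W" "W \<subseteq> V" "P \<in> poly_funs" "Q \<in> poly_funs"
      "\<forall>y\<in>W. Q y \<noteq> 0 \<and> h y = P y / Q y"
      by auto
    obtain a b where ab: "a \<in> poly_funs" "b \<in> poly_funs" "\<And>y. y \<in> S \<Longrightarrow> b y \<noteq> 0"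
      "\<And>y. y \<in> S \<Longrightarrow> P (f y) = a y / b y"
      using rational_on_compose[where f=f, OF W(4) f] by (rule rational_onE) blast
    obtain c d where cd: "c \<in> poly_funs" "d \<in> poly_funs" "\<And>y. y \<in> S \<Longrightarrow> d y \<noteq> 0"
      "\<And>y. y \<in> S \<Longrightarrow> Q (f y) = c y / d y"
      using rational_on_compose[where f=f, OF W(5) f] by (rule rational_onE) blast
    obtain V' where V': "zariski_open n V'" "x \<in> V'" "\<forall>y\<in>V' \<inter> S. f y \<in> W"
      using pre[OF W(1)] x W(2) by blast
    \<comment> \<open>The pullback of \<open>P / Q\<close> is
      \<open>(a / b) / (c / d) = (a d) / (b c)\<close>. The denominator is nonzero on
      \<open>V' \<inter> S\<close>, but a regular function on affine space needs it nonzero on a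
      whole open set.\<close>
    define N where "N = V' \<inter> {y \<in> affine_pts n. b y * c y \<noteq> 0}"
    have N: "zariski_open n N"
      unfolding N_def by (intro zariski_open_Int V' zariski_open_nonzero poly_funs.mult ab cd)
    have eq: "b y * c y \<noteq> 0 \<and> h (f y) = (a y * d y) / (b y * c y)" if "y \<in> V'" "y \<in> S" for y
    proof -
      have "f y \<in> W" using V'(3) that by blast
      then have "Q (f y) \<noteq> 0" "h (f y) = P (f y) / Q (f y)" using W(6) by blast+
      then show ?thesis using ab(3,4)[OF that(2)] cd(3,4)[OF that(2)] by auto
    qed
    have "(\<lambda>y. (a y * d y) / (b y * c y)) \<in> Reg (affine_space n) N"
      by (intro Reg_affine_fraction N poly_funs.mult ab cd) (simp add: N_def)
    moreover have "x \<in> N" "N \<inter> S \<subseteq> {x \<in> S. f x \<in> V}"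
      using x V' S W(3) eq[of x] by (auto simp: N_def)
    moreover have "\<forall>y\<in>N \<inter> S. h (f y) = (a y * d y) / (b y * c y)"
      using eq by (auto simp: N_def)
    ultimately show "\<exists>N. openin (Top (affine_space n)) N \<and> x \<in> N \<and> N \<inter> S \<subseteq> {x \<in> S. f x \<in> V} \<and>
        (\<exists>g\<in>Reg (affine_space n) N. \<forall>y\<in>N \<inter> S. h (f y) = g y)"
      using N unfolding openin_affine_space by (intro exI[of _ N] conjI bexI)
  qed
qed

subsection \<open>Tori\<close>

definition torus :: "nat \<Rightarrow> (nat \<Rightarrow> complex) set" where
  "torus n = {x \<in> affine_pts n. \<forall>i\<in>{1..n}. x i \<noteq> 0}"

definition laurent :: "nat \<Rightarrow> (nat \<Rightarrow> int) \<Rightarrow> (nat \<Rightarrow> complex) \<Rightarrow> complex" where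
  "laurent n e x = (\<Prod>k=1..n. x k powi e k)"

text \<open>The endomorphism of the torus with exponent matrix \<open>E\<close>; the value 0 outside
  \<open>{1..n}\<close> keeps the image in \<open>affine_pts n\<close>.\<close>

definition laurent_map :: "nat \<Rightarrow> (nat \<Rightarrow> nat \<Rightarrow> int) \<Rightarrow> (nat \<Rightarrow> complex) \<Rightarrow> nat \<Rightarrow> complex" where
  "laurent_map n E x = (\<lambda>i. if i \<in> {1..n} then laurent n (E i) x else 0)"

lemma torus_subset: "torus n \<subseteq> affine_pts n"
  by (auto simp: torus_def)

lemma zariski_open_torus: "zariski_open n (torus n)"
proof -
  have eq: "torus n = {x \<in> affine_pts n. (\<Prod>i=1..n. x i) \<noteq> 0}"
    by (auto simp: torus_def)
  show ?thesis
    unfolding eq by (rule zariski_open_nonzero) (intro poly_funs_prod poly_funs.coord)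
qed

lemma laurent_nonzero: "x \<in> torus n \<Longrightarrow> laurent n e x \<noteq> 0"
  by (auto simp: laurent_def torus_def)

lemma laurent_map_torus: "x \<in> torus n \<Longrightarrow> laurent_map n E x \<in> torus n"
  using laurent_nonzero by (auto simp: torus_def laurent_map_def affine_pts_def)

lemma rational_on_laurent: "rational_on (torus n) (laurent n e)"
  unfolding laurent_def[abs_def]
  by (intro rational_on_prod rational_on_power_int rational_on_poly poly_funs.coord) (simp add: torus_def)

lemma rational_on_subset: "rational_on S f \<Longrightarrow> T \<subseteq> S \<Longrightarrow> rational_on T f"
  unfolding rational_on_def by blast

lemma morphism_laurent_map:
  assumes "S \<subseteq> torus n"
  shows "is_morphism (subspace_of (affine_space n) S) (affine_space n) (laurent_map n E)"
proof (rule morphism_rational_map)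
  show "rational_on S (\<lambda>x. laurent_map n E x i)" for i
    using rational_on_subset[OF rational_on_laurent assms] rational_on_poly[OF poly_funs.const]
    unfolding laurent_map_def by (cases "i \<in> {1..n}") (simp_all only: if_True if_False)
qed (use assms torus_subset laurent_map_torus in blast)+

lemma laurent_mult: "laurent n e (\<lambda>k. x k * y k) = laurent n e x * laurent n e y"
  by (simp add: laurent_def power_int_mult_distrib prod.distrib)

lemma power_int_sum:
  fixes x :: "'a :: field"
  shows "x \<noteq> 0 \<Longrightarrow> x powi (\<Sum>i\<in>A. f i) = (\<Prod>i\<in>A. x powi f i)"
  by (induction A rule: infinite_finite_induct) (auto simp: power_int_add)

lemma power_int_prod:
  fixes f :: "'b \<Rightarrow> 'a :: field"
  shows "(\<Prod>i\<in>A. f i) powi e = (\<Prod>i\<in>A. f i powi e)"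
  by (induction A rule: infinite_finite_induct) (auto simp: power_int_mult_distrib)

text \<open>Composing monomial maps multiplies their exponent matrices, so inverting them
  birationally becomes integer linear algebra.\<close>

lemma laurent_laurent_map:
  assumes "x \<in> torus n"
  shows "laurent n e (laurent_map n E x) = laurent n (\<lambda>k. \<Sum>i=1..n. e i * E i k) x"
proof -
  have "laurent n e (laurent_map n E x) = (\<Prod>i=1..n. \<Prod>k=1..n. (x k powi E i k) powi e i)"
    by (simp add: laurent_def laurent_map_def power_int_prod)
  also have "\<dots> = (\<Prod>k=1..n. \<Prod>i=1..n. x k powi (e i * E i k))"
    by (subst prod.swap) (simp add: power_int_mult[symmetric] mult.commute)
  also have "\<dots> = laurent n (\<lambda>k. \<Sum>i=1..n. e i * E i k) x"
    unfolding laurent_def using assms by (intro prod.cong) (auto simp: power_int_sum torus_def)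
  finally show ?thesis .
qed

lemma laurent_cong: "(\<And>k. k \<in> {1..n} \<Longrightarrow> e k = f k) \<Longrightarrow> laurent n e x = laurent n f x"
  by (simp add: laurent_def)

lemma laurent_add:
  "x \<in> torus n \<Longrightarrow> laurent n (\<lambda>k. e k + f k) x = laurent n e x * laurent n f x"
  by (auto simp: laurent_def torus_def power_int_add simp flip: prod.distrib intro!: prod.cong)

lemma laurent_scale: "laurent n (\<lambda>k. c * e k) x = laurent n e x powi c"
  by (simp add: laurent_def power_int_mult power_int_prod mult.commute[of c])

lemma laurent_unit:
  assumes "i \<in> {1..n}"
  shows "laurent n (\<lambda>k. if k = i then 1 else 0) x = x i"
proof -
  have "laurent n (\<lambda>k. if k = i then 1 else 0) x = (\<Prod>k=1..n. if k = i then x k else 1)"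
    unfolding laurent_def by (intro prod.cong) auto
  then show ?thesis using assms by simp
qed

section \<open>Zeros on the torus\<close>

text \<open>The degree bound is uniform over all lines: in \<open>zeros_meet_torus\<close> the base
  point of the line varies while the constant \<open>2 ^ d\<close> has to stay fixed.\<close>

lemma poly_funs_line:
  assumes "p \<in> poly_funs"
  shows "\<exists>d. \<forall>a b. \<exists>r. degree r \<le> d \<and> (\<forall>s. p (\<lambda>i. a i + s * b i) = poly r s)"
  using assms
proof induction
  case (const c)
  show ?case by (intro exI[of _ 0] allI exI[of _ "[:c:]"]) auto
next
  case (coord i)
  have "\<exists>r. degree r \<le> 1 \<and> (\<forall>s. a i + s * b i = poly r s)" for a b :: "nat \<Rightarrow> complex"
    by (rule exI[of _ "[:a i, b i:]"]) auto
  then show ?case by blast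
next
  case (add p q)
  then obtain d d' where
    "\<forall>a b. \<exists>r. degree r \<le> d \<and> (\<forall>s. p (\<lambda>i. a i + s * b i) = poly r s)"
    "\<forall>a b. \<exists>r. degree r \<le> d' \<and> (\<forall>s. q (\<lambda>i. a i + s * b i) = poly r s)" by blast
  then show ?case
    by (intro exI[of _ "max d d'"] allI) (metis degree_add_le_max le_trans max.mono poly_add)
next
  case (mult p q)
  then obtain d d' where
    "\<forall>a b. \<exists>r. degree r \<le> d \<and> (\<forall>s. p (\<lambda>i. a i + s * b i) = poly r s)"
    "\<forall>a b. \<exists>r. degree r \<le> d' \<and> (\<forall>s. q (\<lambda>i. a i + s * b i) = poly r s)" by blast
  then show ?case
    by (intro exI[of _ "d + d'"] allI) (metis degree_mult_le le_trans add_mono poly_mult)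
qed

lemma poly_funs_lineE:
  assumes "p \<in> poly_funs"
  obtains r where "\<And>s. p (\<lambda>i. a i + s * b i) = poly r s"
  using poly_funs_line[OF assms] by blast

text \<open>Induction on the number of polynomials: on the line joining a good point for the old
  ones to a good point for the new one, each condition fails at only finitely many
  parameters.\<close>

lemma poly_funs_common_nonzero:
  assumes "finite I" "\<And>i. i \<in> I \<Longrightarrow> p i \<in> poly_funs"
    "\<And>i. i \<in> I \<Longrightarrow> \<exists>z\<in>affine_pts n. p i z \<noteq> 0"
  shows "\<exists>z\<in>affine_pts n. \<forall>i\<in>I. p i z \<noteq> 0"
  using assms
proof (induction I rule: finite_induct)
  case empty
  have "(\<lambda>i. 0) \<in> affine_pts n" by (simp add: affine_pts_def)
  then show ?case by blast
next
  case (insert j I)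
  have "\<exists>z\<in>affine_pts n. \<forall>i\<in>I. p i z \<noteq> 0" using insert.prems by (intro insert.IH) blast+
  then obtain z where z: "z \<in> affine_pts n" "\<forall>i\<in>I. p i z \<noteq> 0" by blast
  obtain w where w: "w \<in> affine_pts n" "p j w \<noteq> 0" using insert.prems(2)[of j] by blast
  have "(\<lambda>x. \<Prod>i\<in>I. p i x) \<in> poly_funs" using insert.prems(1) by (intro poly_funs_prod) simp
  then obtain r where r: "\<And>s. (\<Prod>i\<in>I. p i (\<lambda>k. z k + s * (w k - z k))) = poly r s"
    by (rule poly_funs_lineE[where a = z and b = "\<lambda>k. w k - z k"]) blast
  obtain r' where r': "\<And>s. p j (\<lambda>k. z k + s * (w k - z k)) = poly r' s"
    by (rule poly_funs_lineE[where a = z and b = "\<lambda>k. w k - z k"]) (use insert.prems(1) in blast)+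
  \<comment> \<open>The parameters 0 and 1 give \<open>z\<close> and \<open>w\<close>.\<close>
  have "poly r 0 \<noteq> 0" using r[of 0] z(2) insert.hyps(1) by (simp flip: r)
  moreover have "poly r' 1 \<noteq> 0" using r'[of 1] w(2) by simp
  ultimately have "r * r' \<noteq> 0" by auto
  then have "finite {s. poly (r * r') s = 0}" by (rule poly_roots_finite)
  then obtain s where "poly (r * r') s \<noteq> 0"
    using ex_new_if_finite[OF infinite_UNIV_char_0] by blast
  then have "p j (\<lambda>k. z k + s * (w k - z k)) \<noteq> 0" "\<forall>i\<in>I. p i (\<lambda>k. z k + s * (w k - z k)) \<noteq> 0"
    using insert.hyps(1) by (auto simp: prod_zero_iff simp flip: r r')
  moreover have "(\<lambda>k. z k + s * (w k - z k)) \<in> affine_pts n"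
    using z(1) w(1) by (auto simp: affine_pts_def)
  ultimately show ?case by blast
qed

text \<open>Every root \<open>z\<close> satisfies \<open>norm s < r \<le> norm z\<close>, so the
  factor \<open>s - z\<close> is at most twice as large as its value at 0; there are at most
  \<open>d\<close> factors. The contrapositive detects a root in the disc.\<close>

lemma poly_bound_without_roots:
  fixes q :: "complex poly"
  assumes "degree q \<le> d" "\<And>s. norm s < r \<Longrightarrow> poly q s \<noteq> 0" "norm s < r"
  shows "norm (poly q s) \<le> 2 ^ d * norm (poly q 0)"
  using assms
proof (induction d arbitrary: q)
  case 0
  then obtain c where "q = [:c:]" using degree_eq_zeroE by blast
  then show ?case by simp
next
  case (Suc d)
  show ?case
  proof (cases "degree q = 0")
    case True
    then obtain c where q: "q = [:c:]" using degree_eq_zeroE by blast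
    have "1 * norm c \<le> 2 ^ Suc d * norm c" by (intro mult_right_mono one_le_power) auto
    then show ?thesis by (simp add: q)
  next
    case False
    then have "\<not> constant (poly q)" by (simp add: constant_degree)
    then obtain z where "poly q z = 0" using fundamental_theorem_of_algebra by blast
    then obtain q' where q: "q = [:- z, 1:] * q'" by (auto simp: poly_eq_0_iff_dvd dvd_def)
    have z: "norm z \<ge> r" using \<open>poly q z = 0\<close> Suc.prems(2) not_less by blast
    have "q' \<noteq> 0" using q False by auto
    then have "degree q = Suc (degree q')" unfolding q by (subst degree_mult_eq) auto
    then have "norm (poly q' s) \<le> 2 ^ d * norm (poly q' 0)"
      using Suc.prems q by (intro Suc.IH) auto
    moreover have "norm (s - z) \<le> 2 * norm z"
      using norm_triangle_ineq4[of s z] Suc.prems(3) z by linarith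
    ultimately have "norm (s - z) * norm (poly q' s) \<le> (2 * norm z) * (2 ^ d * norm (poly q' 0))"
      by (intro mult_mono) auto
    moreover have "poly q s = (s - z) * poly q' s" "poly q 0 = (- z) * poly q' 0"
      unfolding q by (simp_all add: algebra_simps)
    ultimately show ?thesis by (simp only: norm_mult norm_minus_cancel power_Suc mult_ac)
  qed
qed

lemma continuous_poly_funs_plane:
  assumes "p \<in> poly_funs"
  shows "continuous_on UNIV (\<lambda>z. p (\<lambda>i. c i + fst z * u i + snd z * v i))"
  using assms by induction (auto intro!: continuous_intros)

text \<open>A zero \<open>x\<close> is moved into the torus along a generic direction \<open>u\<close> and then back to a nearby
  zero along a generic direction \<open>v\<close>; the zeros do not end up on a coordinate hyperplane since \<open>F\<close>
  does not vanish at the point where the corresponding line parallel to \<open>v\<close> meets that hyperplane.\<close>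

lemma zeros_meet_torus:
  assumes F: "F \<in> poly_funs" and n: "n > 0"
    and nz: "\<And>i. i \<in> {1..n} \<Longrightarrow> \<exists>z\<in>affine_pts n. z i = 0 \<and> F z \<noteq> 0"
    and U: "zariski_open n U" "x \<in> U" and x0: "F x = 0"
  shows "\<exists>y\<in>torus n. y \<in> U \<and> F y = 0"
proof -
  obtain g where g: "g \<in> poly_funs" "g x \<noteq> 0" "\<And>y. y \<in> affine_pts n \<Longrightarrow> g y \<noteq> 0 \<Longrightarrow> y \<in> U"
    using U by (rule zariski_openE) blast
  have x: "x \<in> affine_pts n" using U zariski_open_subset by blast
  \<comment> \<open>Index 0 carries \<open>F\<close> itself, the others ask that the new point
    differ from \<open>x\<close> in every coordinate. The direction \<open>v\<close> towards it is
    then transversal to all coordinate hyperplanes, and \<open>F\<close> is not identically zero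
    along it.\<close>
  let ?p = "\<lambda>i. if i = 0 then F else (\<lambda>z. z i - x i)"
  have "\<exists>z\<in>affine_pts n. \<forall>i\<in>{0..n}. ?p i z \<noteq> 0"
  proof (rule poly_funs_common_nonzero)
    show "\<exists>z\<in>affine_pts n. ?p i z \<noteq> 0" if "i \<in> {0..n}" for i
    proof (cases "i = 0")
      case True
      then show ?thesis using nz[of 1] n by auto
    next
      case False
      then have "(\<lambda>k. if k = i then x i + 1 else 0) \<in> affine_pts n"
        using that by (auto simp: affine_pts_def)
      then show ?thesis using False by (intro bexI[of _ "\<lambda>k. if k = i then x i + 1 else 0"]) auto
    qed
  qed (use F in \<open>auto intro: poly_funs_diff poly_funs.intros\<close>)
  then obtain z where z': "z \<in> affine_pts n" "\<forall>i\<in>{0..n}. ?p i z \<noteq> 0" by blast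
  have z: "z \<in> affine_pts n" "F z \<noteq> 0" "\<And>i. i \<in> {1..n} \<Longrightarrow> z i \<noteq> x i"
    using z'(1) z'(2)[THEN bspec, of 0] z'(2)[THEN bspec] by (simp, simp, force)
  define v where "v i = z i - x i" for i
  have v: "v \<in> affine_pts n" "\<And>i. i \<in> {1..n} \<Longrightarrow> v i \<noteq> 0"
    using z(1,3) x by (auto simp: v_def affine_pts_def)
  \<comment> \<open>\<open>pr i y\<close> is the point where the line through \<open>y\<close> in
    direction \<open>v\<close> meets the hyperplane on which coordinate \<open>i\<close> is
    0.\<close>
  define pr where "pr i y = (\<lambda>k. y k - (y i / v i) * v k)" for i :: nat and y :: "nat \<Rightarrow> complex"
  have "\<exists>z\<in>affine_pts n. \<forall>i\<in>{1..n}. F (pr i z) \<noteq> 0"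
  proof (rule poly_funs_common_nonzero)
    fix i assume i: "i \<in> {1..n}"
    have "(\<lambda>y. y k + y i * (- v k / v i)) \<in> poly_funs" for k
      by (intro poly_funs.intros)
    then have "(\<lambda>y. pr i y k) \<in> poly_funs" for k
      by (simp add: pr_def)
    then show "(\<lambda>y. F (pr i y)) \<in> poly_funs" by (rule poly_funs_compose[OF F])
    obtain w where "w \<in> affine_pts n" "w i = 0" "F w \<noteq> 0" using nz[OF i] by blast
    then show "\<exists>z\<in>affine_pts n. F (pr i z) \<noteq> 0" by (intro bexI[of _ w]) (auto simp: pr_def)
  qed auto
  then obtain w where w: "w \<in> affine_pts n" "\<And>i. i \<in> {1..n} \<Longrightarrow> F (pr i w) \<noteq> 0" by blast
  \<comment> \<open>Moving along \<open>u\<close> by \<open>a = 1\<close> reaches \<open>w\<close>,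
    all of whose projections \<open>pr i w\<close> avoid the zeros of \<open>F\<close>.\<close>
  define u where "u i = w i - x i" for i
  define pt where "pt a s = (\<lambda>i. x i + a * u i + s * v i)" for a s
  have pt: "pt a s \<in> affine_pts n" for a s
    using x v(1) w(1) by (auto simp: pt_def u_def affine_pts_def)
  have cont: "continuous_on UNIV (\<lambda>z. p (pt (fst z) (snd z)))" if "p \<in> poly_funs" for p
    unfolding pt_def by (rule continuous_poly_funs_plane[OF that])
  have pt0: "pt 0 0 = x" by (simp add: pt_def)
  obtain d where d: "\<And>a b. \<exists>r. degree r \<le> d \<and> (\<forall>s. F (\<lambda>i. a i + s * b i) = poly r s)"
    using poly_funs_line[OF F] by blast
  have "isCont (\<lambda>z. g (pt (fst z) (snd z))) (0, 0)"
    using cont[OF g(1)] by (simp add: continuous_on_eq_continuous_at)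
  then obtain e where e: "e > 0" "\<And>z. dist z (0, 0) < e \<Longrightarrow> g (pt (fst z) (snd z)) \<noteq> 0"
    using continuous_at_avoid[of "(0, 0)" "\<lambda>z. g (pt (fst z) (snd z))" 0] g(2) pt0
    by (auto simp: dist_commute)
  \<comment> \<open>\<open>F\<close> vanishes at \<open>pt 0 0\<close> but not at the nearby
    \<open>pt 0 s1\<close>; by continuity \<open>F (pt a s1)\<close> still dominates
    \<open>2 ^ d\<close> times \<open>F (pt a 0)\<close> for small \<open>a\<close>.\<close>
  obtain s1 where s1: "norm s1 < e / 2" "F (pt 0 s1) \<noteq> 0"
  proof -
    obtain r where r: "\<And>s. F (\<lambda>i. x i + s * v i) = poly r s"
      by (rule poly_funs_lineE[OF F, of x v]) blast
    have "poly r 1 \<noteq> 0" using z(2) by (simp flip: r add: v_def)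
    then have "r \<noteq> 0" by auto
    then have "finite {s. poly r s = 0}" by (rule poly_roots_finite)
    moreover have "infinite (ball (0::complex) (e / 2))" using e(1) by (intro uncountable_infinite uncountable_ball) auto
    ultimately have "\<not> ball 0 (e / 2) \<subseteq> {s. poly r s = 0}" using finite_subset by blast
    then obtain s where "s \<in> ball 0 (e / 2)" "poly r s \<noteq> 0" by blast
    then show ?thesis by (intro that[of s]) (auto simp: pt_def simp flip: r)
  qed
  have "continuous_on UNIV (\<lambda>a. F (pt a s))" for s
    using continuous_on_compose2[OF cont[OF F], of UNIV "\<lambda>a. (a, s)"]
    by (simp add: continuous_on_Pair)
  then have "open {a. 2 ^ d * norm (F (pt a 0)) < norm (F (pt a s1))}"
    by (intro open_Collect_less continuous_intros)
  moreover have "0 \<in> {a. 2 ^ d * norm (F (pt a 0)) < norm (F (pt a s1))}"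
    using s1(2) x0 by (simp add: pt0)
  ultimately obtain e' where e': "e' > 0"
    "\<And>a. norm a < e' \<Longrightarrow> 2 ^ d * norm (F (pt a 0)) < norm (F (pt a s1))"
    unfolding open_contains_ball by (metis (no_types, lifting) mem_ball_0 mem_Collect_eq subsetD)
  \<comment> \<open>In \<open>a\<close> this is a polynomial whose value at 1 is
    \<open>F (pr i w)\<close>, so it is not the zero polynomial.\<close>
  have "finite {a. F (pr i (pt a 0)) = 0}" if "i \<in> {1..n}" for i
  proof -
    obtain r where r: "\<And>a. F (\<lambda>k. pr i x k + a * pr i u k) = poly r a"
      by (rule poly_funs_lineE[OF F, of "pr i x" "pr i u"]) blast
    have eq: "pr i (pt a 0) = (\<lambda>k. pr i x k + a * pr i u k)" for a
      by (auto simp: pr_def pt_def algebra_simps add_divide_distrib)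
    have "pt 1 0 = w" by (simp add: pt_def u_def)
    then have "poly r 1 \<noteq> 0" using w(2)[OF that] eq[of 1] by (simp flip: r)
    then have "r \<noteq> 0" by auto
    then show ?thesis unfolding eq r by (rule poly_roots_finite)
  qed
  then have "finite (\<Union>i\<in>{1..n}. {a. F (pr i (pt a 0)) = 0})" by blast
  moreover have "infinite (ball (0::complex) (min e' (e / 2)))"
    using e(1) e'(1) by (intro uncountable_infinite uncountable_ball) auto
  ultimately have "\<not> ball 0 (min e' (e / 2)) \<subseteq> (\<Union>i\<in>{1..n}. {a. F (pr i (pt a 0)) = 0})"
    using finite_subset by blast
  then obtain a where "a \<in> ball 0 (min e' (e / 2))"
    "a \<notin> (\<Union>i\<in>{1..n}. {a. F (pr i (pt a 0)) = 0})"
    by blast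
  then have a: "norm a < e'" "norm a < e / 2" "\<And>i. i \<in> {1..n} \<Longrightarrow> F (pr i (pt a 0)) \<noteq> 0"
    by (simp_all only: mem_ball_0 min_less_iff_conj) blast
  obtain q where q: "degree q \<le> d" "\<And>s. F (pt a s) = poly q s"
    using d[of "\<lambda>i. x i + a * u i" v] unfolding pt_def by blast
  \<comment> \<open>Without a root in this disc, \<open>poly_bound_without_roots\<close> at
    \<open>s1\<close> would contradict the choice of \<open>e'\<close>.\<close>
  have "\<exists>s. norm s < e / 2 \<and> poly q s = 0"
    using poly_bound_without_roots[OF q(1), of "e / 2" s1] e'(2)[OF a(1)] s1(1)
    unfolding q(2) by fastforce
  then obtain s where s: "norm s < e / 2" "F (pt a s) = 0" using q(2) by auto
  have "dist (a, s) (0, 0) < e"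
    using norm_Pair_le[of a s] a(2) s(1) by (simp add: dist_norm flip: zero_prod_def)
  then have "pt a s \<in> U" using e(2)[of "(a, s)"] pt g(3) by simp
  moreover have "pt a s \<in> torus n"
    unfolding torus_def
  proof (intro CollectI conjI ballI pt notI)
    fix i assume i: "i \<in> {1..n}" "pt a s i = 0"
    \<comment> \<open>A point of the line with coordinate \<open>i\<close> equal to 0 is its
      intersection with that hyperplane, where \<open>F\<close> is nonzero by the choice of
      \<open>a\<close>.\<close>
    then have "s = - (pt a 0 i / v i)" using v(2) by (auto simp: pt_def field_simps add_eq_0_iff)
    then have "pt a s = pr i (pt a 0)" by (auto simp: pt_def pr_def)
    then show False using s(2) a(3)[OF i(1)] by simp
  qed
  ultimately show ?thesis using s(2) by blast
qed

section \<open>Hypersurfaces in weighted projective space\<close>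

lemma pts_punctured [simp]: "pts (punctured_affine n) = affine_pts n - {\<lambda>i. 0}"
  by (auto simp: punctured_affine_def)

lemma torus_subset_punctured: "n > 0 \<Longrightarrow> torus n \<subseteq> affine_pts n - {\<lambda>i. 0}"
  unfolding torus_def by (force intro: bexI[of _ n])

definition weighted_class :: "nat list \<Rightarrow> (nat \<Rightarrow> complex) \<Rightarrow> wpt" where
  "weighted_class ws x = weighted_rel ws `` {x}"

lemma pts_weighted_proj:
  "pts (weighted_proj ws) = weighted_class ws ` (affine_pts (length ws) - {\<lambda>i. 0})"
  by (auto simp: weighted_proj_def quotient_def weighted_class_def)

lemma equiv_weighted_rel: "equiv (affine_pts (length ws) - {\<lambda>i. 0}) (weighted_rel ws)"
proof (rule equivI)
  show "weighted_rel ws \<subseteq> (affine_pts (length ws) - {\<lambda>i. 0}) \<times> (affine_pts (length ws) - {\<lambda>i. 0})"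
    by (auto simp: weighted_rel_def)
  show "refl_on (affine_pts (length ws) - {\<lambda>i. 0}) (weighted_rel ws)"
    by (rule refl_onI) (auto simp: weighted_rel_def intro: exI[of _ 1])
  show "sym (weighted_rel ws)"
  proof (rule symI)
    fix x y assume "(x, y) \<in> weighted_rel ws"
    then obtain l where "x \<in> affine_pts (length ws) - {\<lambda>i. 0}" "y \<in> affine_pts (length ws) - {\<lambda>i. 0}"
      "l \<noteq> 0" "\<forall>i\<in>{1..length ws}. y i = l ^ (ws ! (i - 1)) * x i"
      by (auto simp: weighted_rel_def)
    then show "(y, x) \<in> weighted_rel ws"
      unfolding weighted_rel_def by (auto intro!: exI[of _ "inverse l"] simp: field_simps)
  qed
  show "trans (weighted_rel ws)"
  proof (rule transI)
    fix x y z assume "(x, y) \<in> weighted_rel ws" "(y, z) \<in> weighted_rel ws"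
    then obtain l m where "x \<in> affine_pts (length ws) - {\<lambda>i. 0}" "z \<in> affine_pts (length ws) - {\<lambda>i. 0}"
      "l \<noteq> 0" "\<forall>i\<in>{1..length ws}. y i = l ^ (ws ! (i - 1)) * x i"
      "m \<noteq> 0" "\<forall>i\<in>{1..length ws}. z i = m ^ (ws ! (i - 1)) * y i"
      by (auto simp: weighted_rel_def)
    then show "(x, z) \<in> weighted_rel ws"
      unfolding weighted_rel_def
      by (auto intro!: exI[of _ "l * m"] simp: power_mult_distrib)
  qed
qed

lemma weighted_class_eq_iff:
  assumes "x \<in> affine_pts (length ws) - {\<lambda>i. 0}" "y \<in> affine_pts (length ws) - {\<lambda>i. 0}"
  shows "weighted_class ws x = weighted_class ws y \<longleftrightarrow> (x, y) \<in> weighted_rel ws"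
  unfolding weighted_class_def using eq_equiv_class_iff[OF equiv_weighted_rel] assms by blast

lemma weighted_class_self:
  "x \<in> affine_pts (length ws) - {\<lambda>i. 0} \<Longrightarrow> x \<in> weighted_class ws x"
  unfolding weighted_class_def using equiv_class_self[OF equiv_weighted_rel] by blast

lemma mem_weighted_class:
  "y \<in> weighted_class ws x \<longleftrightarrow> (x, y) \<in> weighted_rel ws"
  by (auto simp: weighted_class_def)

lemma weighted_rel_torus: "(x, y) \<in> weighted_rel ws \<Longrightarrow> x \<in> torus (length ws) \<Longrightarrow> y \<in> torus (length ws)"
  by (auto simp: weighted_rel_def torus_def)

lemma morphism_weighted_class:
  "is_morphism (punctured_affine (length ws)) (weighted_proj ws) (weighted_class ws)"
  unfolding weighted_proj_def weighted_class_def[abs_def] by (rule morphism_projection)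

definition torus_classes :: "nat list \<Rightarrow> wpt set" where
  "torus_classes ws = weighted_class ws ` torus (length ws)"

lemma weighted_class_torus_iff:
  assumes "x \<in> affine_pts (length ws) - {\<lambda>i. 0}" "ws \<noteq> []"
  shows "weighted_class ws x \<in> torus_classes ws \<longleftrightarrow> x \<in> torus (length ws)"
proof
  assume "weighted_class ws x \<in> torus_classes ws"
  then obtain y where "y \<in> torus (length ws)" "weighted_class ws y = weighted_class ws x"
    by (auto simp: torus_classes_def)
  moreover from this have "y \<in> affine_pts (length ws) - {\<lambda>i. 0}"
    using torus_subset_punctured assms(2) by blast
  ultimately show "x \<in> torus (length ws)"
    using weighted_class_eq_iff[of y ws x] assms(1) weighted_rel_torus by blast
qed (simp add: torus_classes_def)

lemma openin_torus_classes:
  assumes "ws \<noteq> []"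
  shows "openin (Top (weighted_proj ws)) (torus_classes ws)"
proof -
  have sub: "torus (length ws) \<subseteq> affine_pts (length ws) - {\<lambda>i. 0}"
    using torus_subset_punctured assms by blast
  have "{x \<in> pts (punctured_affine (length ws)). weighted_rel ws `` {x} \<in> torus_classes ws}
      = torus (length ws)"
    using weighted_class_torus_iff[OF _ assms] sub by (auto simp: weighted_class_def)
  moreover have "openin (Top (punctured_affine (length ws))) (torus (length ws))"
    unfolding punctured_affine_def openin_subspace openin_affine_space
    using zariski_open_torus sub by blast
  moreover have "torus_classes ws \<subseteq> pts (punctured_affine (length ws)) // weighted_rel ws"
    using sub by (auto simp: torus_classes_def weighted_class_def intro: quotientI)
  ultimately show ?thesis
    unfolding weighted_proj_def openin_quotient_space quotient_open_def by simp
qed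

section \<open>Delsarte hypersurfaces and their torus part\<close>

definition delsarte_poly :: "nat \<Rightarrow> (nat \<Rightarrow> nat \<Rightarrow> nat) \<Rightarrow> complex \<Rightarrow> (nat \<Rightarrow> complex) \<Rightarrow> complex" where
  "delsarte_poly n A t x = (\<Sum>i=1..n. \<Prod>k=1..n. x k ^ A i k) - t * (\<Prod>k=1..n. x k)"

definition torus_model :: "nat \<Rightarrow> (nat \<Rightarrow> int) \<Rightarrow> complex \<Rightarrow> (nat \<Rightarrow> complex) set" where
  "torus_model n q t = {y \<in> torus n. (\<Sum>i=1..n. y i) = t \<and> laurent n q y = 1}"

text \<open>On the torus the hypersurface is described by the quotients \<open>y\<^sub>i\<close> of the monomials by
  \<open>x\<^sub>1 \<cdots> x\<^sub>n\<close>: they sum to \<open>t\<close>, and the left kernel vector \<open>q\<close> of the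
  matrix of their exponents gives the relation \<open>\<Prod> y\<^sub>i ^ q\<^sub>i = 1\<close>.\<close>

locale delsarte =
  fixes ws :: "nat list" and A :: "nat \<Rightarrow> nat \<Rightarrow> nat" and q :: "nat \<Rightarrow> int"
    and n :: nat and L :: "nat \<Rightarrow> nat \<Rightarrow> int"
  defines "n \<equiv> length ws" and "L \<equiv> \<lambda>i k. int (A i k) - 1"
  assumes weights_nonempty: "ws \<noteq> []"
    and homogeneous: "i \<in> {1..n} \<Longrightarrow> (\<Sum>k=1..n. L i k * int (ws ! (k - 1))) = 0"
    and relation: "k \<in> {1..n} \<Longrightarrow> (\<Sum>i=1..n. q i * L i k) = 0"
    and not_divisible: "k \<in> {1..n} \<Longrightarrow> \<exists>i\<in>{1..n}. A i k = 0"
begin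

abbreviation "F \<equiv> delsarte_poly n A"
abbreviation "P \<equiv> affine_pts n - {\<lambda>i. 0}"
abbreviation "X t \<equiv> hypersurface ws (F t)"
abbreviation "M \<equiv> torus_model n q"

definition torus_zeros :: "complex \<Rightarrow> (nat \<Rightarrow> complex) set" where
  "torus_zeros t = {x \<in> torus n. F t x = 0}"

definition torus_part :: "complex \<Rightarrow> wpt set" where
  "torus_part t = weighted_class ws ` torus_zeros t"

lemma n_pos: "n > 0"
  using weights_nonempty by (simp add: n_def)

lemma torus_punctured: "torus n \<subseteq> P"
  using torus_subset_punctured[OF n_pos] .

lemma pts_weighted_proj_n: "pts (weighted_proj ws) = weighted_class ws ` P"
  by (simp add: pts_weighted_proj n_def)

lemma class_self: "x \<in> P \<Longrightarrow> x \<in> weighted_class ws x"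
  by (simp add: weighted_class_self n_def)

lemma torus_classes_n: "torus_classes ws = weighted_class ws ` torus n"
  by (simp add: torus_classes_def n_def)

lemma F_poly: "F t \<in> poly_funs"
  unfolding delsarte_poly_def[abs_def]
  by (intro poly_funs_diff poly_funs.mult poly_funs.const poly_funs_sum poly_funs_prod poly_funs_power
      poly_funs.coord)

text \<open>At the point with coordinate \<open>k\<close> equal to 0 and all others 1, the
  deformation term vanishes and the value counts the monomials free of \<open>x k\<close>. By
  \<open>not_divisible\<close> this count is positive, hence nonzero in characteristic 0.\<close>

lemma F_nonzero_on_hyperplane:
  assumes k: "k \<in> {1..n}"
  shows "\<exists>z\<in>affine_pts n. z k = 0 \<and> F t z \<noteq> 0"
proof
  let ?z = "\<lambda>i. if i \<in> {1..n} \<and> i \<noteq> k then 1 else 0 :: complex"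
  show "?z \<in> affine_pts n" by (auto simp: affine_pts_def)
  have "(\<Prod>l=1..n. ?z l ^ A i l) = (if A i k = 0 then 1 else 0)" if "i \<in> {1..n}" for i
  proof (cases "A i k = 0")
    case True
    then have "\<And>l. l \<in> {1..n} \<Longrightarrow> ?z l ^ A i l = 1" by (auto simp: power_0_left)
    then show ?thesis using True by (simp add: prod.neutral)
  next
    case False
    then have "?z k ^ A i k = 0" by simp
    then show ?thesis using False k by (subst prod_zero) (auto intro!: bexI[of _ k])
  qed
  then have "(\<Sum>i=1..n. \<Prod>l=1..n. ?z l ^ A i l) = of_nat (card {i \<in> {1..n}. A i k = 0})"
    by (simp add: sum.If_cases Int_def)
  moreover have "(\<Prod>l=1..n. ?z l) = 0" using k by (intro prod_zero) auto
  moreover have "card {i \<in> {1..n}. A i k = 0} \<noteq> 0" using not_divisible[OF k] by auto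
  ultimately have "F t ?z \<noteq> 0"
    unfolding delsarte_poly_def by (simp only: mult_zero_right diff_zero of_nat_eq_0_iff not_False_eq_True)
  then show "?z k = 0 \<and> F t ?z \<noteq> 0" by simp
qed

lemma laurent_exponents:
  assumes "x \<in> torus n"
  shows "laurent n (L i) x = (\<Prod>k=1..n. x k ^ A i k) / (\<Prod>k=1..n. x k)"
  unfolding laurent_def L_def prod_dividef[symmetric]
  using assms by (intro prod.cong) (auto simp: power_int_diff torus_def)

lemma F_zero_iff:
  assumes "x \<in> torus n"
  shows "F t x = 0 \<longleftrightarrow> (\<Sum>i=1..n. laurent_map n L x i) = t"
proof -
  have "(\<Sum>i=1..n. laurent_map n L x i) = (\<Sum>i=1..n. \<Prod>k=1..n. x k ^ A i k) / (\<Prod>k=1..n. x k)"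
    using laurent_exponents[OF assms] by (simp add: laurent_map_def sum_divide_distrib)
  moreover have "(\<Prod>k=1..n. x k) \<noteq> 0" using assms by (simp add: torus_def)
  ultimately show ?thesis
    unfolding delsarte_poly_def by (simp only: divide_eq_eq right_minus_eq simp_thms if_False if_True)
qed

lemma relation_laurent: "x \<in> torus n \<Longrightarrow> laurent n q (laurent_map n L x) = 1"
  by (subst laurent_laurent_map) (simp_all add: laurent_def relation del: One_nat_def)

lemma torus_zeros_iff: "x \<in> torus n \<Longrightarrow> x \<in> torus_zeros t \<longleftrightarrow> laurent_map n L x \<in> M t"
  using F_zero_iff relation_laurent laurent_map_torus
  by (auto simp: torus_zeros_def torus_model_def)

text \<open>By \<open>homogeneous\<close> every row of \<open>L\<close> has weight 0, so the scalar
  \<open>l\<close> enters with exponent 0.\<close>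

lemma laurent_map_weighted_rel:
  assumes "(x, y) \<in> weighted_rel ws" "x \<in> torus n"
  shows "laurent_map n L y = laurent_map n L x"
proof -
  obtain l where l: "l \<noteq> 0" "\<And>k. k \<in> {1..n} \<Longrightarrow> y k = l ^ (ws ! (k - 1)) * x k"
    using assms(1) by (auto simp: weighted_rel_def n_def)
  have "laurent n (L i) y = laurent n (L i) x" if i: "i \<in> {1..n}" for i
  proof -
    have "laurent n (L i) y = (\<Prod>k=1..n. (l ^ (ws ! (k - 1))) powi L i k) * laurent n (L i) x"
      unfolding laurent_def using l(2) by (simp add: power_int_mult_distrib prod.distrib)
    also have "(\<Prod>k=1..n. (l ^ (ws ! (k - 1))) powi L i k)
        = (\<Prod>k=1..n. l powi (L i k * int (ws ! (k - 1))))"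
      by (simp add: power_int_mult mult.commute[of "L i _"])
    also have "\<dots> = l powi (\<Sum>k=1..n. L i k * int (ws ! (k - 1)))"
      using l(1) by (simp add: power_int_sum)
    finally show ?thesis using homogeneous[OF i] by simp
  qed
  then show ?thesis by (auto simp: laurent_map_def)
qed

lemma torus_zeros_weighted_rel:
  "(x, y) \<in> weighted_rel ws \<Longrightarrow> x \<in> torus_zeros t \<Longrightarrow> y \<in> torus_zeros t"
  using laurent_map_weighted_rel weighted_rel_torus torus_zeros_iff
  by (metis (no_types, lifting) mem_Collect_eq n_def torus_zeros_def)

lemma torus_zeros_subset: "torus_zeros t \<subseteq> torus n"
  by (auto simp: torus_zeros_def)

lemma pts_X: "pts (X t) = {p \<in> pts (weighted_proj ws). \<forall>x\<in>p. F t x = 0}"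
  by (auto simp: hypersurface_def)

lemma torus_part_eq: "torus_part t = pts (X t) \<inter> torus_classes ws"
proof (intro equalityI subsetI)
  fix p assume "p \<in> torus_part t"
  then obtain x where x: "p = weighted_class ws x" "x \<in> torus_zeros t" by (auto simp: torus_part_def)
  have "F t y = 0" if "y \<in> p" for y
    using torus_zeros_weighted_rel[of x y] x that by (simp add: mem_weighted_class torus_zeros_def)
  moreover have "x \<in> torus n" "x \<in> P" using x(2) torus_zeros_subset torus_punctured by blast+
  ultimately show "p \<in> pts (X t) \<inter> torus_classes ws"
    unfolding pts_X torus_classes_n pts_weighted_proj_n x(1) by blast
next
  fix p assume p: "p \<in> pts (X t) \<inter> torus_classes ws"
  then obtain x where x: "p = weighted_class ws x" "x \<in> torus n"
    by (auto simp: torus_classes_n)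
  then have "x \<in> p" using class_self torus_punctured by blast
  then show "p \<in> torus_part t" using p x by (auto simp: pts_X torus_part_def torus_zeros_def)
qed

text \<open>An open set of the hypersurface is the trace of an open set of the ambient space, whose
  pullback to homogeneous coordinates is Zariski open. This brings density within reach of
  \<open>zeros_meet_torus\<close>.\<close>

lemma openin_X_preimage:
  assumes "openin (Top (X t)) U"
  obtains W where "zariski_open n W"
    "\<And>x. x \<in> P \<Longrightarrow> weighted_class ws x \<in> pts (X t) \<Longrightarrow> weighted_class ws x \<in> U \<longleftrightarrow> x \<in> W"
proof -
  from assms obtain V where V: "openin (Top (weighted_proj ws)) V" "U = V \<inter> pts (X t)"
    unfolding hypersurface_def openin_subspace by (auto simp: pts_X hypersurface_def)
  from morphism_openin[OF morphism_weighted_class V(1)]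
  obtain W where W: "zariski_open n W" "{x \<in> P. weighted_class ws x \<in> V} = W \<inter> P"
    unfolding punctured_affine_def openin_subspace openin_affine_space by (auto simp: n_def)
  show ?thesis using W(2) V(2) by (intro that[OF W(1)]) blast
qed

lemma open_torus_part: "openin (Top (X t)) (torus_part t)"
  unfolding torus_part_eq pts_X using openin_torus_classes[OF weights_nonempty]
  unfolding hypersurface_def openin_subspace by blast

lemma dense_open_torus_part: "dense_open (X t) (torus_part t)"
  unfolding dense_open_iff
proof (intro conjI allI impI open_torus_part)
  fix U assume U: "openin (Top (X t)) U" "U \<noteq> {}"
  obtain W where W: "zariski_open n W"
    "\<And>x. x \<in> P \<Longrightarrow> weighted_class ws x \<in> pts (X t) \<Longrightarrow> weighted_class ws x \<in> U \<longleftrightarrow> x \<in> W"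
    using openin_X_preimage[OF U(1)] by blast
  from U obtain p where p: "p \<in> U" "p \<in> pts (X t)" using openin_subset by blast
  then obtain x where x: "p = weighted_class ws x" "x \<in> P"
    by (auto simp: pts_X pts_weighted_proj_n)
  have "F t x = 0" using p(2) class_self x by (auto simp: pts_X)
  moreover have "x \<in> W" using W(2) p x by blast
  ultimately obtain y where y: "y \<in> torus n" "y \<in> W" "F t y = 0"
    using zeros_meet_torus[OF F_poly n_pos F_nonzero_on_hyperplane W(1)] by blast
  then have "weighted_class ws y \<in> torus_part t" by (auto simp: torus_part_def torus_zeros_def)
  moreover from this have "weighted_class ws y \<in> U"
    using W(2) y torus_punctured by (auto simp: torus_part_eq)
  ultimately show "\<exists>p\<in>torus_part t. p \<in> U" by blast
qed

lemma morphism_torus_part: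
  "is_morphism (subspace_of (affine_space n) (torus_zeros t)) (subspace_of (X t) (torus_part t))
     (weighted_class ws)"
proof (intro morphism_into_subspace is_sheaf_subspace)
  have "is_morphism (subspace_of (affine_space n) (torus_zeros t)) (punctured_affine n) (\<lambda>x. x)"
    unfolding punctured_affine_def using torus_zeros_subset torus_punctured
    by (intro morphism_into_subspace is_sheaf_subspace morphism_inclusion) auto
  from morphism_comp[OF this[unfolded n_def] morphism_weighted_class]
  show "is_morphism (subspace_of (affine_space n) (torus_zeros t)) (X t) (weighted_class ws)"
    unfolding hypersurface_def n_def[symmetric]
    using torus_part_eq by (intro morphism_into_subspace is_sheaf_subspace) (auto simp: torus_part_def pts_X)
qed (auto simp: torus_part_def)

text \<open>Any representative serves: on classes of torus points
  \<open>laurent_map_weighted_rel\<close> makes the value independent of the choice.\<close>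

definition to_model :: "wpt \<Rightarrow> nat \<Rightarrow> complex" where
  "to_model p = laurent_map n L (SOME x. x \<in> p)"

lemma to_model_class:
  assumes "x \<in> torus n"
  shows "to_model (weighted_class ws x) = laurent_map n L x"
proof -
  have "x \<in> weighted_class ws x"
    using class_self assms torus_punctured by blast
  then have "(SOME y. y \<in> weighted_class ws x) \<in> weighted_class ws x"
    by (rule someI[of "\<lambda>y. y \<in> weighted_class ws x"])
  then show ?thesis
    unfolding to_model_def using laurent_map_weighted_rel assms by (simp add: mem_weighted_class)
qed

text \<open>The hypersurface is a subspace of a quotient, not itself a quotient. The universal
  property is therefore applied to all torus classes of the weighted projective space, and the
  result is restricted.\<close>

lemma morphism_to_model:
  "is_morphism (subspace_of (X t) (torus_part t)) (subspace_of (affine_space n) (M t)) to_model"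
proof (intro morphism_into_subspace is_sheaf_subspace)
  have "is_morphism (subspace_of (weighted_proj ws) (torus_classes ws)) (affine_space n) to_model"
    unfolding weighted_proj_def n_def[symmetric]
  proof (rule morphism_from_quotient)
    show "is_sheaf (punctured_affine n)" "is_presheaf (punctured_affine n)"
      unfolding punctured_affine_def
      by (intro is_sheaf_subspace is_presheaf_subspace is_presheaf_affine_space)+
    show "openin (Top (quotient_space (punctured_affine n) (weighted_rel ws))) (torus_classes ws)"
      using openin_torus_classes[OF weights_nonempty] by (simp add: weighted_proj_def n_def)
    show "torus n = {x \<in> pts (punctured_affine n). weighted_rel ws `` {x} \<in> torus_classes ws}"
      using weighted_class_torus_iff[OF _ weights_nonempty] torus_punctured
      by (auto simp: weighted_class_def n_def)
    have "is_morphism (subspace_of (punctured_affine n) (torus n)) (subspace_of (affine_space n) (torus n))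
        (\<lambda>x. x)"
      unfolding punctured_affine_def
      by (intro morphism_into_subspace is_sheaf_subspace morphism_comp[OF morphism_inclusion morphism_inclusion])
        auto
    from morphism_comp[OF this morphism_laurent_map[OF order_refl]]
    show "is_morphism (subspace_of (punctured_affine n) (torus n)) (affine_space n)
        (\<lambda>x. to_model (weighted_rel ws `` {x}))"
      by (rule morphism_cong[OF is_sheaf_subspace]) (use to_model_class in \<open>auto simp: weighted_class_def\<close>)
  qed
  moreover have "is_morphism (subspace_of (X t) (torus_part t))
      (subspace_of (weighted_proj ws) (torus_classes ws)) (\<lambda>x. x)"
    unfolding hypersurface_def torus_part_eq
    by (intro morphism_into_subspace is_sheaf_subspace morphism_comp[OF morphism_inclusion morphism_inclusion])
      auto
  ultimately show "is_morphism (subspace_of (X t) (torus_part t)) (affine_space n) to_model"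
    using morphism_comp by blast
  show "to_model p \<in> M t" if "p \<in> pts (subspace_of (X t) (torus_part t))" for p
  proof -
    from that obtain x where "x \<in> torus_zeros t" "p = weighted_class ws x"
      by (auto simp: torus_part_def)
    then show ?thesis using to_model_class torus_zeros_iff torus_zeros_subset by fastforce
  qed
qed

end

lemma dense_open_self: "dense_open X (pts X)"
  unfolding dense_open_iff using openin_subset by blast

text \<open>The matrix \<open>B\<close> is inverse to \<open>L\<close> up to the kernels of \<open>L\<close>, so the
  Laurent monomials with exponents \<open>B\<close> recover homogeneous coordinates from the \<open>y\<^sub>i\<close>.\<close>

lemma (in delsarte) birational_model:
  assumes BL: "\<And>i k. i \<in> {1..n} \<Longrightarrow> k \<in> {1..n} \<Longrightarrow>
      (\<Sum>l=1..n. B i l * L l k) = (if k = i then 1 else 0) + int (ws ! (i - 1)) * c k"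
    and LB: "\<And>i k. i \<in> {1..n} \<Longrightarrow> k \<in> {1..n} \<Longrightarrow>
      (\<Sum>l=1..n. L i l * B l k) = (if k = i then 1 else 0) + d i * q k"
  shows "X t \<approx>\<^sub>b subspace_of (affine_space n) (M t)"
proof -
  have M_torus: "M t \<subseteq> torus n" by (auto simp: torus_model_def)
  \<comment> \<open>The surplus term \<open>d i * q k\<close> contributes a power of
    \<open>laurent n q y\<close>, which is 1 on the model.\<close>
  have LB': "laurent_map n L (laurent_map n B y) = y" if y: "y \<in> M t" for y
  proof
    fix i
    have yt: "y \<in> torus n" "laurent n q y = 1" using y by (auto simp: torus_model_def)
    show "laurent_map n L (laurent_map n B y) i = y i"
    proof (cases "i \<in> {1..n}")
      case True
      have "laurent n (L i) (laurent_map n B y) = laurent n (\<lambda>k. (if k = i then 1 else 0) + d i * q k) y"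
        unfolding laurent_laurent_map[OF yt(1)] by (rule laurent_cong) (rule LB[OF True])
      also have "\<dots> = y i"
        using laurent_add[OF yt(1)] laurent_scale[of n "d i" q y] laurent_unit[OF True] yt(2) by simp
      finally show ?thesis using True by (simp add: laurent_map_def)
    next
      case False
      then show ?thesis using yt(1) by (auto simp: laurent_map_def torus_def affine_pts_def)
    qed
  qed
  have B_zeros: "laurent_map n B y \<in> torus_zeros t" if "y \<in> M t" for y
    using LB'[OF that] torus_zeros_iff laurent_map_torus M_torus that by auto
  \<comment> \<open>The surplus term rescales the coordinates by the weighted action of
    \<open>laurent n c x\<close>, which does not change the class.\<close>
  have BL': "weighted_class ws (laurent_map n B (laurent_map n L x)) = weighted_class ws x"
    if x: "x \<in> torus n" for x
  proof -
    have "laurent n (B i) (laurent_map n L x) = laurent n c x ^ (ws ! (i - 1)) * x i" if i: "i \<in> {1..n}" for i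
    proof -
      have "laurent n (B i) (laurent_map n L x)
          = laurent n (\<lambda>k. (if k = i then 1 else 0) + int (ws ! (i - 1)) * c k) x"
        unfolding laurent_laurent_map[OF x] by (rule laurent_cong) (rule BL[OF i])
      then show ?thesis
        using laurent_add[OF x] laurent_scale[of n "int (ws ! (i - 1))" c x] laurent_unit[OF i] by simp
    qed
    then have "\<forall>i\<in>{1..n}. laurent_map n B (laurent_map n L x) i = laurent n c x ^ (ws ! (i - 1)) * x i"
      unfolding laurent_map_def[of n B] by simp
    moreover have mem: "x \<in> P" "laurent_map n B (laurent_map n L x) \<in> P"
      using x laurent_map_torus torus_punctured by blast+
    ultimately have "(x, laurent_map n B (laurent_map n L x)) \<in> weighted_rel ws"
      using laurent_nonzero[OF x] unfolding weighted_rel_def n_def[symmetric] by blast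
    then show ?thesis
      using weighted_class_eq_iff[of x ws] mem unfolding n_def[symmetric] by blast
  qed
  have morph: "is_morphism (subspace_of (affine_space n) (M t)) (subspace_of (X t) (torus_part t))
      (\<lambda>y. weighted_class ws (laurent_map n B y))"
    by (rule morphism_comp[OF _ morphism_torus_part])
      (use B_zeros in \<open>intro morphism_into_subspace is_sheaf_subspace morphism_laurent_map M_torus, auto\<close>)
  have ptsM: "pts (subspace_of (affine_space n) (M t)) = M t"
    using M_torus torus_subset by auto
  have "birational_pair (X t) (subspace_of (affine_space n) (M t)) (torus_part t) (M t) to_model
      (\<lambda>y. weighted_class ws (laurent_map n B y))"
    unfolding birational_pair_def
  proof (intro conjI ballI dense_open_torus_part)
    show "dense_open (subspace_of (affine_space n) (M t)) (M t)"
      using dense_open_self[of "subspace_of (affine_space n) (M t)"] by (simp only: ptsM)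
    show "is_morphism (subspace_of (X t) (torus_part t)) (subspace_of (subspace_of (affine_space n) (M t)) (M t))
        to_model"
      using morphism_mem[OF morphism_to_model] ptsM
      by (intro morphism_into_subspace is_sheaf_subspace morphism_to_model) auto
    show "is_morphism (subspace_of (subspace_of (affine_space n) (M t)) (M t)) (subspace_of (X t) (torus_part t))
        (\<lambda>y. weighted_class ws (laurent_map n B y))"
      by (rule morphism_comp[OF morphism_inclusion morph])
  next
    fix p assume "p \<in> torus_part t"
    then obtain x where x: "p = weighted_class ws x" "x \<in> torus_zeros t" by (auto simp: torus_part_def)
    then show "to_model p \<in> M t" "weighted_class ws (laurent_map n B (to_model p)) = p"
      using to_model_class torus_zeros_iff torus_zeros_subset BL' by fastforce+
  next
    fix y assume "y \<in> M t"
    then show "weighted_class ws (laurent_map n B y) \<in> torus_part t"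
      "to_model (weighted_class ws (laurent_map n B y)) = y"
      using B_zeros to_model_class torus_zeros_subset LB' unfolding torus_part_def by fastforce+
  qed
  then show ?thesis unfolding birational_iff by blast
qed

section \<open>Quotients of tori by diagonal groups\<close>

text \<open>Elimination as in Artin's theorem: if \<open>ch k g \<noteq> ch j g\<close>, the
  relation at \<open>m g f\<close> minus \<open>ch k g\<close> times the relation at
  \<open>f\<close> removes \<open>k\<close> and multiplies the coefficients in the class of
  \<open>j\<close> by the nonzero \<open>ch j g - ch k g\<close>. Characters may coincide or take
  the value 0, hence the grouping and the factor \<open>ch j e\<close>.\<close>

lemma characters_independent:
  fixes ch :: "'i \<Rightarrow> 'g \<Rightarrow> 'a :: field"
  assumes "finite I" and closed: "\<And>e f. e \<in> K \<Longrightarrow> f \<in> K \<Longrightarrow> m e f \<in> K"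
    and mult: "\<And>i e f. e \<in> K \<Longrightarrow> f \<in> K \<Longrightarrow> ch i (m e f) = ch i e * ch i f"
    and "\<And>e. e \<in> K \<Longrightarrow> (\<Sum>i\<in>I. a i * ch i e) = 0" and "e \<in> K"
  shows "(\<Sum>i | i \<in> I \<and> (\<forall>e\<in>K. ch i e = ch j e). a i) * ch j e = 0"
  using assms(1,4)
proof (induction "card I" arbitrary: I a rule: less_induct)
  case less
  show ?case
  proof (cases "\<forall>i\<in>I. \<forall>e\<in>K. ch i e = ch j e")
    case True
    then have "{i. i \<in> I \<and> (\<forall>e\<in>K. ch i e = ch j e)} = I" by blast
    moreover have "(\<Sum>i\<in>I. a i * ch i e) = (\<Sum>i\<in>I. a i) * ch j e"
      using True \<open>e \<in> K\<close> by (simp add: sum_distrib_right)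
    ultimately show ?thesis using less.prems(2)[OF \<open>e \<in> K\<close>] by simp
  next
    case False
    then obtain k g where k: "k \<in> I" "g \<in> K" "ch k g \<noteq> ch j g" by blast
    let ?J = "{i. i \<in> I \<and> (\<forall>e\<in>K. ch i e = ch j e)}"
    let ?b = "\<lambda>i. a i * (ch i g - ch k g)"
    have "(\<Sum>i\<in>I - {k}. ?b i * ch i f) = 0" if f: "f \<in> K" for f
    proof -
      have "(\<Sum>i\<in>I - {k}. ?b i * ch i f) = (\<Sum>i\<in>I. ?b i * ch i f)"
        using less.prems(1) k(1) by (simp add: sum.remove)
      also have "\<dots> = (\<Sum>i\<in>I. a i * ch i (m g f)) - ch k g * (\<Sum>i\<in>I. a i * ch i f)"
        by (simp add: mult[OF k(2) f] sum_distrib_left sum_subtractf algebra_simps)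
      also have "\<dots> = 0" using less.prems(2)[OF closed[OF k(2) f]] less.prems(2)[OF f] by simp
      finally show ?thesis .
    qed
    moreover have "card (I - {k}) < card I" using less.prems(1) k(1) by (rule card_Diff1_less)
    ultimately have "(\<Sum>i | i \<in> I - {k} \<and> (\<forall>e\<in>K. ch i e = ch j e). ?b i) * ch j e = 0"
      using less.prems(1) by (intro less.hyps) simp_all
    moreover have "{i. i \<in> I - {k} \<and> (\<forall>e\<in>K. ch i e = ch j e)} = ?J" using k by blast
    moreover have "(\<Sum>i\<in>?J. ?b i) = (\<Sum>i\<in>?J. a i) * (ch j g - ch k g)"
      using k(2) by (simp add: sum_distrib_right)
    ultimately show ?thesis using k(3) by simp
  qed
qed

section \<open>Expansion of polynomial functions into monomials\<close>

definition monomial :: "nat \<Rightarrow> (nat \<Rightarrow> nat) \<Rightarrow> (nat \<Rightarrow> complex) \<Rightarrow> complex" where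
  "monomial n m x = (\<Prod>k=1..n. x k ^ m k)"

lemma monomial_mult: "monomial n m (\<lambda>k. x k * y k) = monomial n m x * monomial n m y"
  by (simp add: monomial_def power_mult_distrib prod.distrib)

lemma monomial_add: "monomial n (\<lambda>k. m k + m' k) x = monomial n m x * monomial n m' x"
  by (simp add: monomial_def power_add prod.distrib)

lemma monomial_nonzero: "x \<in> torus n \<Longrightarrow> monomial n m x \<noteq> 0"
  by (auto simp: monomial_def torus_def)

definition monomial_sum :: "nat \<Rightarrow> (nat \<Rightarrow> nat) set \<Rightarrow> ((nat \<Rightarrow> nat) \<Rightarrow> complex) \<Rightarrow> (nat \<Rightarrow> complex) \<Rightarrow> complex"
  where "monomial_sum n I a x = (\<Sum>m\<in>I. a m * monomial n m x)"

lemma monomial_sum_extend: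
  "finite J \<Longrightarrow> I \<subseteq> J \<Longrightarrow> monomial_sum n J (\<lambda>m. if m \<in> I then a m else 0) x = monomial_sum n I a x"
  unfolding monomial_sum_def by (intro sum.mono_neutral_cong_right) auto

text \<open>Agreement is asked on \<open>affine_pts n\<close> only: a polynomial function may read
  coordinates outside \<open>{1..n}\<close>, and these are 0 there.\<close>

definition monomial_span :: "nat \<Rightarrow> ((nat \<Rightarrow> complex) \<Rightarrow> complex) set" where
  "monomial_span n = {p. \<exists>I a. finite I \<and> (\<forall>x\<in>affine_pts n. p x = monomial_sum n I a x)}"

lemma monomial_span_add:
  assumes "p \<in> monomial_span n" "q \<in> monomial_span n"
  shows "(\<lambda>x. p x + q x) \<in> monomial_span n"
proof -
  obtain I a where p: "finite I" "\<forall>x\<in>affine_pts n. p x = monomial_sum n I a x"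
    using assms(1) unfolding monomial_span_def by blast
  obtain J b where q: "finite J" "\<forall>x\<in>affine_pts n. q x = monomial_sum n J b x"
    using assms(2) unfolding monomial_span_def by blast
  have "p x + q x = monomial_sum n (I \<union> J)
      (\<lambda>m. (if m \<in> I then a m else 0) + (if m \<in> J then b m else 0)) x" if "x \<in> affine_pts n" for x
    using p q that monomial_sum_extend[of "I \<union> J" I n a x] monomial_sum_extend[of "I \<union> J" J n b x]
    by (simp add: monomial_sum_def sum.distrib distrib_right)
  then show ?thesis using p(1) q(1) unfolding monomial_span_def by blast
qed

lemma monomial_span_monomial: "(\<lambda>x. c * monomial n m x) \<in> monomial_span n"
proof -
  have "\<forall>x\<in>affine_pts n. c * monomial n m x = monomial_sum n {m} (\<lambda>_. c) x"
    by (simp add: monomial_sum_def)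
  then show ?thesis unfolding monomial_span_def by blast
qed

lemma monomial_span_sum:
  "finite A \<Longrightarrow> (\<And>i. i \<in> A \<Longrightarrow> p i \<in> monomial_span n) \<Longrightarrow> (\<lambda>x. \<Sum>i\<in>A. p i x) \<in> monomial_span n"
proof (induction A rule: finite_induct)
  case empty
  show ?case using monomial_span_monomial[of 0] by simp
qed (auto intro: monomial_span_add)

lemma monomial_span_cong:
  assumes "p \<in> monomial_span n" "\<And>x. x \<in> affine_pts n \<Longrightarrow> p x = q x"
  shows "q \<in> monomial_span n"
  using assms unfolding monomial_span_def by auto

lemma poly_funs_monomial_span:
  assumes "p \<in> poly_funs"
  shows "p \<in> monomial_span n"
  using assms
proof induction
  case (const c)
  show ?case using monomial_span_monomial[of c n "\<lambda>_. 0"] by (simp add: monomial_def)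
next
  case (coord i)
  show ?case
  proof (cases "i \<in> {1..n}")
    case True
    have "monomial n (\<lambda>k. if k = i then 1 else 0) x = x i" for x :: "nat \<Rightarrow> complex"
    proof -
      have "monomial n (\<lambda>k. if k = i then 1 else 0) x = (\<Prod>k=1..n. if k = i then x k else 1)"
        unfolding monomial_def by (intro prod.cong) auto
      then show ?thesis using True by simp
    qed
    then show ?thesis using monomial_span_monomial[of 1 n "\<lambda>k. if k = i then 1 else 0"] by simp
  next
    case False
    show ?thesis
      by (rule monomial_span_cong[OF monomial_span_monomial[of 0]]) (use False in \<open>auto simp: affine_pts_def\<close>)
  qed
next
  case (add p q)
  then show ?case by (intro monomial_span_add)
next
  case (mult p q)
  obtain I a where p: "finite I" "\<forall>x\<in>affine_pts n. p x = monomial_sum n I a x"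
    using mult.IH(1) unfolding monomial_span_def by blast
  obtain J b where q: "finite J" "\<forall>x\<in>affine_pts n. q x = monomial_sum n J b x"
    using mult.IH(2) unfolding monomial_span_def by blast
  have "(\<lambda>x. \<Sum>m\<in>I. \<Sum>m'\<in>J. (a m * b m') * monomial n (\<lambda>k. m k + m' k) x) \<in> monomial_span n"
    by (intro monomial_span_sum p(1) q(1) monomial_span_monomial)
  moreover have "(\<Sum>m\<in>I. \<Sum>m'\<in>J. (a m * b m') * monomial n (\<lambda>k. m k + m' k) x) = p x * q x"
    if "x \<in> affine_pts n" for x
    using p(2) q(2) that by (simp add: monomial_sum_def sum_product monomial_add mult_ac)
  ultimately show ?case by (rule monomial_span_cong)
qed

text \<open>The condition \<open>lattice\<close> says that the Laurent monomials trivial on \<open>K\<close> are products of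
  powers of the components of the Laurent map.\<close>

locale laurent_quotient =
  fixes n :: nat and L :: "nat \<Rightarrow> nat \<Rightarrow> int" and K :: "(nat \<Rightarrow> complex) set"
  defines "K \<equiv> {e \<in> torus n. \<forall>i\<in>{1..n}. laurent n (L i) e = 1}"
  assumes lattice: "(\<And>e. e \<in> K \<Longrightarrow> monomial n m e = monomial n m' e) \<Longrightarrow>
    \<exists>\<kappa>. \<forall>x\<in>torus n. monomial n m x = monomial n m' x * laurent n \<kappa> (laurent_map n L x)"
begin

abbreviation "\<Phi> \<equiv> laurent_map n L"

lemma K_mult: "e \<in> K \<Longrightarrow> f \<in> K \<Longrightarrow> (\<lambda>k. e k * f k) \<in> K"
  by (auto simp: K_def laurent_mult torus_def affine_pts_def)

lemma torus_K: "e \<in> K \<Longrightarrow> x \<in> torus n \<Longrightarrow> (\<lambda>k. e k * x k) \<in> torus n"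
  by (auto simp: K_def torus_def affine_pts_def)

lemma laurent_map_K: "e \<in> K \<Longrightarrow> \<Phi> (\<lambda>k. e k * x k) = \<Phi> x"
  by (auto simp: laurent_map_def laurent_mult K_def)

lemma one_K: "(\<lambda>k. if k \<in> {1..n} then 1 else 0) \<in> K"
  by (auto simp: K_def torus_def affine_pts_def laurent_def)

text \<open>\<open>RP\<close> and \<open>RQ\<close> are isotypic components of \<open>P\<close> and \<open>Q\<close> under \<open>K\<close>, divided by a
  monomial.\<close>

lemma invariant_fraction:
  assumes "P \<in> poly_funs" "Q \<in> poly_funs" and x0: "x0 \<in> torus n" "Q x0 \<noteq> 0"
  shows "\<exists>RP RQ. rational_on (torus n) RP \<and> rational_on (torus n) RQ \<and> RQ (\<Phi> x0) \<noteq> 0 \<and>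
    (\<forall>x\<in>torus n. \<forall>c. (\<forall>e\<in>K. c * Q (\<lambda>k. e k * x k) = P (\<lambda>k. e k * x k)) \<longrightarrow>
       c * RQ (\<Phi> x) = RP (\<Phi> x))"
proof -
  obtain I1 a1 where 1: "finite I1" "\<forall>x\<in>affine_pts n. P x = monomial_sum n I1 a1 x"
    using poly_funs_monomial_span[OF assms(1)] unfolding monomial_span_def by blast
  obtain I2 b2 where 2: "finite I2" "\<forall>x\<in>affine_pts n. Q x = monomial_sum n I2 b2 x"
    using poly_funs_monomial_span[OF assms(2)] unfolding monomial_span_def by blast
  define I where "I = I1 \<union> I2"
  define a where "a m = (if m \<in> I1 then a1 m else 0)" for m
  define b where "b m = (if m \<in> I2 then b2 m else 0)" for m
  have I: "finite I" using 1 2 by (simp add: I_def)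
  have PQ: "P x = (\<Sum>m\<in>I. a m * monomial n m x)" "Q x = (\<Sum>m\<in>I. b m * monomial n m x)"
    if "x \<in> torus n" for x
    using 1(2) 2(2) that torus_subset monomial_sum_extend[of I I1 n a1 x] monomial_sum_extend[of I I2 n b2 x] I
    unfolding monomial_sum_def a_def b_def I_def by auto
  \<comment> \<open>The value 0 outside \<open>K\<close> turns equality of characters on
    \<open>K\<close> into equality of functions, so that \<open>I\<close> can be partitioned by
    \<open>ch\<close>.\<close>
  define ch where "ch m = (\<lambda>e. if e \<in> K then monomial n m e else 0)" for m
  have "(\<Sum>m\<in>I. b m * monomial n m x0) = (\<Sum>y\<in>ch ` I. \<Sum>m | m \<in> I \<and> ch m = y. b m * monomial n m x0)"
    by (rule sum.image_gen[OF I])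
  then have "\<exists>y\<in>ch ` I. (\<Sum>m | m \<in> I \<and> ch m = y. b m * monomial n m x0) \<noteq> 0"
    using x0 PQ(2) by (metis (no_types, lifting) sum.neutral)
  \<comment> \<open>The isotypic components of \<open>Q\<close> sum to \<open>Q x0\<close>, which is
    nonzero, so one of them is nonzero at \<open>x0\<close>; \<open>j\<close> selects it.\<close>
  then obtain j where j: "j \<in> I" "(\<Sum>m | m \<in> I \<and> ch m = ch j. b m * monomial n m x0) \<noteq> 0" by blast
  define J where "J = {m. m \<in> I \<and> ch m = ch j}"
  have J: "J = {m. m \<in> I \<and> (\<forall>e\<in>K. monomial n m e = monomial n j e)}"
    unfolding J_def ch_def by (auto simp: fun_eq_iff)
  have "\<exists>\<kappa>. \<forall>x\<in>torus n. monomial n m x = monomial n j x * laurent n \<kappa> (\<Phi> x)" if "m \<in> J" for m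
    using that by (intro lattice) (simp add: J)
  then obtain \<kappa> where \<kappa>: "\<And>m x. m \<in> J \<Longrightarrow> x \<in> torus n \<Longrightarrow>
      monomial n m x = monomial n j x * laurent n (\<kappa> m) (\<Phi> x)"
    by metis
  define RP where "RP y = (\<Sum>m\<in>J. a m * laurent n (\<kappa> m) y)" for y
  define RQ where "RQ y = (\<Sum>m\<in>J. b m * laurent n (\<kappa> m) y)" for y
  have R: "(\<Sum>m\<in>J. a m * monomial n m x) = monomial n j x * RP (\<Phi> x)"
    "(\<Sum>m\<in>J. b m * monomial n m x) = monomial n j x * RQ (\<Phi> x)" if "x \<in> torus n" for x
    using \<kappa> that by (simp_all add: RP_def RQ_def sum_distrib_left mult_ac)
  show ?thesis
  proof (intro exI conjI ballI allI impI)
    show "rational_on (torus n) RP" "rational_on (torus n) RQ"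
      unfolding RP_def[abs_def] RQ_def[abs_def]
      by (intro rational_on_sum rational_on_mult rational_on_laurent rational_on_poly[OF poly_funs.const])+
    show "RQ (\<Phi> x0) \<noteq> 0" using j(2) R(2)[OF x0(1)] by (auto simp flip: J_def)
    fix x c assume x: "x \<in> torus n"
      and c: "\<forall>e\<in>K. c * Q (\<lambda>k. e k * x k) = P (\<lambda>k. e k * x k)"
    \<comment> \<open>For fixed \<open>x\<close>, the identity \<open>c Q = P\<close> on the orbit
      is a linear relation between characters of \<open>e\<close>; its part of type \<open>j\<close>
      must vanish by itself.\<close>
    have "(\<Sum>m\<in>I. ((c * b m - a m) * monomial n m x) * monomial n m e) = 0" if e: "e \<in> K" for e
      using bspec[OF c e] PQ[OF torus_K[OF e x]]
      by (simp add: monomial_mult algebra_simps sum_subtractf sum_distrib_left)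
    from characters_independent[where K = K and ch = "monomial n" and m = "\<lambda>e f k. e k * f k" and j = j,
        OF I K_mult monomial_mult this one_K]
    have "(\<Sum>m\<in>J. (c * b m - a m) * monomial n m x) * monomial n j (\<lambda>k. if k \<in> {1..n} then 1 else 0) = 0"
      unfolding J .
    moreover have "monomial n j (\<lambda>k. if k \<in> {1..n} then 1 else 0) = 1" by (simp add: monomial_def)
    ultimately have "c * (\<Sum>m\<in>J. b m * monomial n m x) = (\<Sum>m\<in>J. a m * monomial n m x)"
      by (simp add: algebra_simps sum_subtractf sum_distrib_left)
    then show "c * RQ (\<Phi> x) = RP (\<Phi> x)"
      using R[OF x] monomial_nonzero[OF x, of j] by simp
  qed
qed

text \<open>Over \<open>M\<close> the map \<open>\<Phi>\<close> has the quotient property for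
  \<open>K\<close>: data given near one preimage \<open>x\<close> are replaced by their isotypic
  parts, which \<open>invariant_fraction\<close> turns into rational functions of
  \<open>\<Phi> x\<close>. This is done once for openness of preimages and once for pulled-back
  functions.\<close>

lemma descent:
  assumes f: "is_morphism (subspace_of (affine_space n) {x \<in> torus n. \<Phi> x \<in> M}) Y (\<lambda>x. f (\<Phi> x))"
    and surj: "\<And>y. y \<in> M \<Longrightarrow> \<exists>x\<in>torus n. \<Phi> x = y"
  shows "is_morphism (subspace_of (affine_space n) M) Y f"
proof -
  define S where "S = {x \<in> torus n. \<Phi> x \<in> M}"
  note f = f[folded S_def]
  have M_torus: "M \<subseteq> torus n" using surj laurent_map_torus by blast
  then have ptsM: "pts (subspace_of (affine_space n) M) = M" using torus_subset by auto
  have S_torus: "S \<subseteq> torus n" by (auto simp: S_def)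
  then have ptsS: "pts (subspace_of (affine_space n) S) = S" using torus_subset by auto
  have S_K: "(\<lambda>k. e k * x k) \<in> S" if "e \<in> K" "x \<in> S" for e x
    using that torus_K laurent_map_K by (auto simp: S_def)
  have lift: "\<exists>x\<in>S. \<Phi> x = y" if "y \<in> M" for y using surj[OF that] that by (auto simp: S_def)
  have nbhd: "\<exists>N. zariski_open n N \<and> y \<in> N \<and> (\<forall>z\<in>N \<inter> M. f z \<in> V)"
    if V: "openin (Top Y) V" and y: "y \<in> M" "f y \<in> V" for V y
  proof -
    obtain x where x: "x \<in> S" "\<Phi> x = y" using lift[OF y(1)] by blast
    obtain W where W: "zariski_open n W" "{x \<in> S. f (\<Phi> x) \<in> V} = W \<inter> S"
      using morphism_openin[OF f V] unfolding ptsS openin_subspace openin_affine_space by blast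
    have "x \<in> W" using W(2) x y by blast
    with W(1) obtain p where p: "p \<in> poly_funs" "p x \<noteq> 0"
      "\<And>z. z \<in> affine_pts n \<Longrightarrow> p z \<noteq> 0 \<Longrightarrow> z \<in> W"
      by (rule zariski_openE) blast
    \<comment> \<open>With numerator 0 the premise says that \<open>c * p\<close> vanishes on a
      whole \<open>K\<close>-orbit. Hence \<open>RQ\<close> is nonzero at \<open>y\<close>, and
      wherever it is nonzero some point of the orbit above lies in \<open>W\<close>.\<close>
    obtain RP RQ where R: "rational_on (torus n) RQ" "RQ (\<Phi> x) \<noteq> 0"
      "\<forall>x\<in>torus n. \<forall>c. (\<forall>e\<in>K. c * p (\<lambda>k. e k * x k) = 0) \<longrightarrow> c * RQ (\<Phi> x) = RP (\<Phi> x)"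
      using invariant_fraction[OF poly_funs.const[of 0] p(1) subsetD[OF S_torus x(1)] p(2)]
      by (elim exE conjE)
    obtain u v where uv: "u \<in> poly_funs" "\<And>z. z \<in> torus n \<Longrightarrow> v z \<noteq> 0"
      "\<And>z. z \<in> torus n \<Longrightarrow> RQ z = u z / v z"
      using R(1) by (rule rational_onE) blast
    have "f z \<in> V" if z: "z \<in> M" "u z \<noteq> 0" for z
    proof (rule ccontr)
      assume "f z \<notin> V"
      obtain x' where x': "x' \<in> S" "\<Phi> x' = z" using lift[OF z(1)] by blast
      have "p (\<lambda>k. e k * x' k) = 0" if e: "e \<in> K" for e
      proof (rule ccontr)
        assume "p (\<lambda>k. e k * x' k) \<noteq> 0"
        then have "(\<lambda>k. e k * x' k) \<in> W" using p(3) S_K[OF e x'(1)] S_torus torus_subset by blast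
        then have "f (\<Phi> (\<lambda>k. e k * x' k)) \<in> V" using W(2) S_K[OF e x'(1)] by blast
        then show False using laurent_map_K[OF e] x'(2) \<open>f z \<notin> V\<close> by simp
      qed
      then have "c * RQ z = RP z" for c using bspec[OF R(3), of x'] x' S_torus by auto
      \<comment> \<open>As \<open>p\<close> vanishes on the orbit, the identity holds for every
        \<open>c\<close>: \<open>c = 0\<close> gives \<open>RP z = 0\<close>, and then
        \<open>c = 1\<close> gives \<open>RQ z = 0\<close>.\<close>
      from this[of 0] this[of 1] have "RQ z = 0" by simp
      then show False using uv z M_torus by (metis divide_eq_0_iff subsetD)
    qed
    moreover have "u y \<noteq> 0" "y \<in> affine_pts n"
      using R(2) uv(3)[of y] x(2) y(1) M_torus torus_subset by auto
    ultimately show ?thesis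
      by (intro exI[of _ "{z \<in> affine_pts n. u z \<noteq> 0}"]) (auto intro: zariski_open_nonzero uv(1))
  qed
  have open_pre: "openin (Top (subspace_of (affine_space n) M)) {y \<in> M. f y \<in> V}"
    if V: "openin (Top Y) V" for V
    unfolding openin_subopen[of _ "{y \<in> M. f y \<in> V}"]
  proof
    fix y assume y: "y \<in> {y \<in> M. f y \<in> V}"
    with nbhd[OF V] obtain N where "zariski_open n N" "y \<in> N" "\<forall>z\<in>N \<inter> M. f z \<in> V" by blast
    then show "\<exists>T. openin (Top (subspace_of (affine_space n) M)) T \<and> y \<in> T \<and> T \<subseteq> {y \<in> M. f y \<in> V}"
      unfolding openin_subspace openin_affine_space using y by (intro exI[of _ "N \<inter> M"]) blast
  qed
  show ?thesis
  proof (rule is_morphismI)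
    have "f y \<in> pts Y" if "y \<in> M" for y
      using lift[OF that] morphism_mem[OF f] unfolding ptsS by blast
    then show "continuous_map (Top (subspace_of (affine_space n) M)) (Top Y) f"
      unfolding continuous_map ptsM using open_pre by blast
  next
    fix V h assume V: "openin (Top Y) V" and h: "h \<in> Reg Y V"
    show "(\<lambda>y. h (f y)) \<in> Reg (subspace_of (affine_space n) M)
        {y \<in> pts (subspace_of (affine_space n) M). f y \<in> V}"
      unfolding Reg_subspace_iff ptsM
    proof
      fix y assume y: "y \<in> {y \<in> M. f y \<in> V}"
      then obtain x where x: "x \<in> S" "\<Phi> x = y" using lift by blast
      have "x \<in> {x \<in> S. f (\<Phi> x) \<in> V}" using x y by simp
      from bspec[OF morphism_Reg[OF f V h, unfolded Reg_subspace_iff ptsS] this]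
      obtain W g where W: "x \<in> W" "W \<inter> S \<subseteq> {x \<in> S. f (\<Phi> x) \<in> V}"
        "g \<in> Reg (affine_space n) W" "\<forall>x\<in>W \<inter> S. h (f (\<Phi> x)) = g x"
        by auto
      from bspec[OF W(3)[unfolded Reg_affine_iff] W(1)]
      obtain W' P Q where W': "zariski_open n W'" "x \<in> W'" "W' \<subseteq> W" "P \<in> poly_funs" "Q \<in> poly_funs"
        "\<forall>x\<in>W'. Q x \<noteq> 0 \<and> g x = P x / Q x"
        by auto
      from W'(1,2) obtain p where p: "p \<in> poly_funs" "p x \<noteq> 0"
        "\<And>z. z \<in> affine_pts n \<Longrightarrow> p z \<noteq> 0 \<Longrightarrow> z \<in> W'"
        by (rule zariski_openE) blast
      \<comment> \<open>Multiplying numerator and denominator by \<open>p\<close> makes the identity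
        between \<open>h\<close>, \<open>P\<close> and \<open>Q\<close> hold on full
        \<open>K\<close>-orbits: \<open>g = P / Q\<close> is known only on \<open>W'\<close>, and
        \<open>p\<close> vanishes outside it.\<close>
      have "Q x * p x \<noteq> 0" using W'(2,6) p(2) by simp
      then obtain RP RQ where R: "rational_on (torus n) RP" "rational_on (torus n) RQ" "RQ (\<Phi> x) \<noteq> 0"
        "\<forall>x\<in>torus n. \<forall>c. (\<forall>e\<in>K.
            c * (Q (\<lambda>k. e k * x k) * p (\<lambda>k. e k * x k)) = P (\<lambda>k. e k * x k) * p (\<lambda>k. e k * x k)) \<longrightarrow>
          c * RQ (\<Phi> x) = RP (\<Phi> x)"
        using invariant_fraction[OF poly_funs.mult[OF W'(4) p(1)] poly_funs.mult[OF W'(5) p(1)]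
          subsetD[OF S_torus x(1)]]
        by (elim meta_impE exE conjE)
      obtain u v where uv: "u \<in> poly_funs" "v \<in> poly_funs" "\<And>z. z \<in> torus n \<Longrightarrow> v z \<noteq> 0"
        "\<And>z. z \<in> torus n \<Longrightarrow> RP z = u z / v z"
        using R(1) by (rule rational_onE) blast
      obtain u' v' where uv': "u' \<in> poly_funs" "v' \<in> poly_funs" "\<And>z. z \<in> torus n \<Longrightarrow> v' z \<noteq> 0"
        "\<And>z. z \<in> torus n \<Longrightarrow> RQ z = u' z / v' z"
        using R(2) by (rule rational_onE) blast
      obtain N0 where N0: "zariski_open n N0" "y \<in> N0" "\<forall>z\<in>N0 \<inter> M. f z \<in> V"
        using nbhd[OF V] y by blast
      have eq: "h (f z) = (u z * v' z) / (v z * u' z)" if z: "z \<in> M" "z \<in> N0" "u' z \<noteq> 0" for z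
      proof -
        obtain x' where x': "x' \<in> S" "\<Phi> x' = z" using lift[OF z(1)] by blast
        have "h (f z) * (Q (\<lambda>k. e k * x' k) * p (\<lambda>k. e k * x' k)) = P (\<lambda>k. e k * x' k) * p (\<lambda>k. e k * x' k)"
          if e: "e \<in> K" for e
        proof (cases "p (\<lambda>k. e k * x' k) = 0")
          case False
          then have "(\<lambda>k. e k * x' k) \<in> W'" using p(3) S_K[OF e x'(1)] S_torus torus_subset by blast
          moreover from this have "h (f (\<Phi> (\<lambda>k. e k * x' k))) = g (\<lambda>k. e k * x' k)"
            using W(4) W'(3) S_K[OF e x'(1)] by blast
          ultimately have "h (f z) = P (\<lambda>k. e k * x' k) / Q (\<lambda>k. e k * x' k)" "Q (\<lambda>k. e k * x' k) \<noteq> 0"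
            using W'(6) laurent_map_K[OF e] x'(2) by auto
          then show ?thesis by simp
        qed simp
        then have "h (f z) * RQ z = RP z" using bspec[OF R(4), of x'] x' S_torus by auto
        moreover have "z \<in> torus n" using z(1) M_torus by blast
        ultimately show ?thesis
          using uv(3,4)[of z] uv'(3,4)[of z] z(3) by (simp add: field_simps)
      qed
      define N where "N = N0 \<inter> {z \<in> affine_pts n. v z * u' z \<noteq> 0}"
      have N: "zariski_open n N"
        unfolding N_def by (intro zariski_open_Int N0 zariski_open_nonzero poly_funs.mult uv uv')
      have "(\<lambda>z. (u z * v' z) / (v z * u' z)) \<in> Reg (affine_space n) N"
        by (intro Reg_affine_fraction N poly_funs.mult uv uv') (simp add: N_def)
      moreover have "y \<in> torus n" "u' y \<noteq> 0"
        using R(3) uv'(4)[of y] x(2) y M_torus by auto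
      then have "y \<in> N" using N0(2) uv(3) torus_subset by (auto simp: N_def)
      moreover have "N \<inter> M \<subseteq> {y \<in> M. f y \<in> V}" using N0(3) by (auto simp: N_def)
      moreover have "\<forall>z\<in>N \<inter> M. h (f z) = (u z * v' z) / (v z * u' z)"
        using eq by (auto simp: N_def)
      ultimately show "\<exists>N. openin (Top (affine_space n)) N \<and> y \<in> N \<and> N \<inter> M \<subseteq> {y \<in> M. f y \<in> V} \<and>
          (\<exists>g\<in>Reg (affine_space n) N. \<forall>z\<in>N \<inter> M. h (f z) = g z)"
        using N unfolding openin_affine_space by (intro exI[of _ N] conjI bexI)
    qed
  qed
qed

end

section \<open>The twelve families\<close>

definition entry :: "'a list list \<Rightarrow> nat \<Rightarrow> nat \<Rightarrow> 'a" where
  "entry xss i k = xss ! (i - 1) ! (k - 1)"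

definition coord :: "nat list \<Rightarrow> nat \<Rightarrow> int" where
  "coord ws i = int (ws ! (i - 1))"

text \<open>The hypotheses of \<open>delsarte\<close> and \<open>birational_model\<close> in
  executable form: with lists and list sums they are decided by evaluation for concrete
  matrices.\<close>

definition delsarte_inverse ::
    "nat list \<Rightarrow> nat list list \<Rightarrow> nat list \<Rightarrow> int list list \<Rightarrow> int list \<Rightarrow> int list \<Rightarrow> bool" where
  "delsarte_inverse ws A q B c d \<longleftrightarrow> (let I = [1..<Suc (length ws)] in
     ws \<noteq> [] \<and>
     (\<forall>i\<in>set I. (\<Sum>k\<leftarrow>I. (int (entry A i k) - 1) * int (ws ! (k - 1))) = 0) \<and>
     (\<forall>k\<in>set I. (\<Sum>i\<leftarrow>I. coord q i * (int (entry A i k) - 1)) = 0) \<and>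
     (\<forall>k\<in>set I. \<exists>i\<in>set I. entry A i k = 0) \<and>
     (\<forall>i\<in>set I. \<forall>k\<in>set I. (\<Sum>l\<leftarrow>I. entry B i l * (int (entry A l k) - 1)) =
        (if k = i then 1 else 0) + int (ws ! (i - 1)) * c ! (k - 1)) \<and>
     (\<forall>i\<in>set I. \<forall>k\<in>set I. (\<Sum>l\<leftarrow>I. (int (entry A i l) - 1) * entry B l k) =
        (if k = i then 1 else 0) + d ! (i - 1) * coord q k))"

lemma birational_torus_model:
  assumes "delsarte_inverse ws A q B c d" "length ws = n" "\<And>x. f x = delsarte_poly n (entry A) t x"
  shows "hypersurface ws f \<approx>\<^sub>b subspace_of (affine_space n) (torus_model n (coord q) t)"
proof -
  have I: "set [1..<Suc (length ws)] = {1..length ws}" "distinct [1..<Suc (length ws)]"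
    by auto
  note * = assms(1)[unfolded delsarte_inverse_def Let_def
      sum_list_distinct_conv_sum_set[OF I(2)] I(1)]
  interpret delsarte ws "entry A" "coord q" "length ws" "\<lambda>i k. int (entry A i k) - 1"
    using * by unfold_locales blast+
  have "hypersurface ws (delsarte_poly (length ws) (entry A) t) \<approx>\<^sub>b
      subspace_of (affine_space (length ws)) (torus_model (length ws) (coord q) t)"
    using * by (intro birational_model[where B = "entry B" and c = "\<lambda>k. c ! (k - 1)"
      and d = "\<lambda>i. d ! (i - 1)"]) blast+
  moreover have "f = delsarte_poly n (entry A) t" using assms(3) by blast
  ultimately show ?thesis using assms(2) by simp
qed

lemmas delsarte_poly_entries = delsarte_poly_def entry_def sum.atLeast_Suc_atMost
  prod.atLeast_Suc_atMost eval_nat_numeral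

abbreviation model :: "nat list \<Rightarrow> complex \<Rightarrow> (nat \<Rightarrow> complex) fspace" where
  "model ws t \<equiv> subspace_of (affine_space 5) (torus_model 5 (coord ws) t)"

text \<open>Origin of the certificates, here and below: the identities force \<open>c\<close> to
  have product -1 with the ambient weights, so \<open>c\<close> is a Bezout vector showing that
  these are coprime. Likewise \<open>d\<close> has product -1 with the mirror weights, and as the
  first of them is 1, \<open>d = [-1, 0, 0, 0, 0]\<close> works: it solves the relation for the
  first \<open>y\<close>. Given \<open>c\<close> and \<open>d\<close>, \<open>B\<close> is unique up
  to multiples of the product of the two kernel vectors; making its first column 0 fixes it.\<close>

lemma fam_A1_model: "fam_A1 t \<approx>\<^sub>b model [1, 1, 1, 1, 4] t"
  unfolding fam_A1_def
  by (rule birational_torus_model[where d = "[-1, 0, 0, 0, 0]" and c = "[0, 1, 3, 0, -1]"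
      and A = "[[8, 0, 1, 0, 0], [0, 1, 7, 0, 0], [0, 7, 0, 1, 0], [0, 0, 0, 7, 0], [0, 0, 0, 0, 2]]"
      and B = "[[0, 32, 6, -1, -38], [0, 36, 7, -1, -42], [0, 37, 7, -1, -43], [0, 42, 8, -1, -49], [0, 147, 28, -4, -171]]"])
    (code_simp, simp, simp add: delsarte_poly_entries ac_simps)

lemma fam_A2_model: "fam_A2 t \<approx>\<^sub>b model [1, 1, 1, 1, 4] t"
  unfolding fam_A2_def
  by (rule birational_torus_model[where d = "[-1, 0, 0, 0, 0]" and c = "[0, 1, 0, 1, -1]"
      and A = "[[8, 1, 0, 0, 0], [0, 7, 1, 0, 0], [0, 0, 7, 0, 0], [0, 0, 0, 4, 0], [0, 0, 0, 1, 2]]"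
      and B = "[[0, 6, -1, 16, -22], [0, 7, -1, 18, -24], [0, 8, -1, 21, -28], [0, 14, -2, 37, -49], [0, 21, -3, 55, -73]]"])
    (code_simp, simp, simp add: delsarte_poly_entries ac_simps)

lemma fam_A3_model: "fam_A3 t \<approx>\<^sub>b model [1, 1, 1, 1, 4] t"
  unfolding fam_A3_def
  by (rule birational_torus_model[where d = "[-1, 0, 0, 0, 0]" and c = "[2, 0, 1, 0, -1]"
      and A = "[[0, 8, 0, 0, 0], [7, 0, 1, 0, 0], [0, 0, 7, 0, 0], [1, 0, 0, 4, 0], [0, 0, 0, 1, 2]]"
      and B = "[[0, 13, 5, 6, -24], [0, 13, 5, 6, -25], [0, 15, 6, 7, -28], [0, 23, 9, 11, -43], [0, 41, 16, 19, -76]]"])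
    (code_simp, simp, simp add: delsarte_poly_entries ac_simps)

lemma fam_A4_model: "fam_A4 t \<approx>\<^sub>b model [1, 1, 1, 1, 4] t"
  unfolding fam_A4_def
  by (rule birational_torus_model[where d = "[-1, 0, 0, 0, 0]" and c = "[2, 0, 1, 0, -1]"
      and A = "[[1, 7, 0, 0, 0], [7, 0, 1, 0, 0], [0, 0, 7, 0, 0], [0, 1, 0, 4, 0], [0, 0, 0, 1, 2]]"
      and B = "[[0, 13, 5, 6, -18], [0, 13, 5, 6, -19], [0, 15, 6, 7, -21], [0, 23, 9, 11, -32], [0, 41, 16, 19, -57]]"])
    (code_simp, simp, simp add: delsarte_poly_entries ac_simps)

lemma fam_B1_model: "fam_B1 t \<approx>\<^sub>b model [1, 1, 1, 2, 5] t"
  unfolding fam_B1_def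
  by (rule birational_torus_model[where d = "[-1, 0, 0, 0, 0]" and c = "[0, 1, 0, 2, -1]"
      and A = "[[10, 1, 0, 0, 0], [0, 9, 1, 0, 0], [0, 0, 9, 0, 0], [0, 0, 0, 5, 0], [0, 0, 0, 0, 2]]"
      and B = "[[0, 8, -1, 29, -37], [0, 9, -1, 32, -40], [0, 10, -1, 36, -45], [0, 18, -2, 65, -81], [0, 45, -5, 162, -202]]"])
    (code_simp, simp, simp add: delsarte_poly_entries ac_simps)

lemma fam_B2_model: "fam_B2 t \<approx>\<^sub>b model [1, 1, 1, 2, 5] t"
  unfolding fam_B2_def
  by (rule birational_torus_model[where d = "[-1, 0, 0, 0, 0]" and c = "[0, 1, -1, 0, 0]"
      and A = "[[9, 1, 0, 0, 0], [0, 9, 0, 0, 0], [1, 0, 8, 0, 0], [0, 0, 1, 5, 0], [0, 0, 0, 0, 2]]"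
      and B = "[[0, 6, -9, -2, -5], [0, 7, -10, -2, -5], [0, 7, -10, -2, -5], [0, 11, -16, -3, -8], [0, 31, -45, -9, -22]]"])
    (code_simp, simp, simp add: delsarte_poly_entries ac_simps)

lemma fam_B3_model: "fam_B3 t \<approx>\<^sub>b model [1, 1, 1, 2, 5] t"
  unfolding fam_B3_def
  by (rule birational_torus_model[where d = "[-1, 0, 0, 0, 0]" and c = "[0, -2, -1, 2, 0]"
      and A = "[[9, 1, 0, 0, 0], [0, 9, 0, 0, 0], [1, 0, 5, 0, 0], [0, 0, 0, 5, 0], [0, 0, 1, 0, 2]]"
      and B = "[[0, -10, -9, 14, -5], [0, -11, -10, 16, -5], [0, -18, -16, 26, -8], [0, -20, -18, 29, -9], [0, -41, -37, 59, -18]]"])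
    (code_simp, simp, simp add: delsarte_poly_entries ac_simps)

text \<open>The third and fourth monomials are exchanged in the matrix, so that its left kernel is
  \<open>[1, 1, 1, 2, 5]\<close> in this order.\<close>

lemma fam_B4_model: "fam_B4 t \<approx>\<^sub>b model [1, 1, 1, 2, 5] t"
  unfolding fam_B4_def
  by (rule birational_torus_model[where d = "[-1, 0, 0, 0, 0]" and c = "[0, 0, 1, -1, 0]"
      and A = "[[9, 0, 0, 0, 0], [0, 8, 0, 0, 0], [1, 0, 0, 5, 0], [0, 1, 5, 0, 0], [0, 0, 0, 1, 2]]"
      and B = "[[0, -2, -9, 6, -5], [0, -2, -10, 7, -5], [0, -3, -14, 10, -7], [0, -3, -14, 10, -7], [0, -7, -33, 23, -16]]"])
    (code_simp, simp, simp add: delsarte_poly_entries ac_simps)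

lemma fam_C1_model: "fam_C1 t \<approx>\<^sub>b model [1, 1, 1, 1, 2] t"
  unfolding fam_C1_def
  by (rule birational_torus_model[where d = "[-1, 0, 0, 0, 0]" and c = "[0, 0, -2, 0, 1]"
      and A = "[[6, 0, 1, 0, 0], [0, 1, 5, 0, 0], [0, 5, 0, 1, 0], [0, 0, 0, 5, 0], [0, 0, 0, 0, 3]]"
      and B = "[[0, -21, 4, -1, 17], [0, -24, 5, -1, 20], [0, -25, 5, -1, 21], [0, -30, 6, -1, 25], [0, -50, 10, -2, 42]]"])
    (code_simp, simp, simp add: delsarte_poly_entries ac_simps)

lemma fam_C2_model: "fam_C2 t \<approx>\<^sub>b model [1, 1, 1, 1, 2] t"
  unfolding fam_C2_def
  by (rule birational_torus_model[where d = "[-1, 0, 0, 0, 0]" and c = "[-1, 1, 1, -1, 0]"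
      and A = "[[0, 6, 0, 0, 0], [5, 0, 1, 0, 0], [0, 0, 5, 0, 0], [1, 0, 0, 4, 0], [0, 0, 0, 1, 3]]"
      and B = "[[0, -15, 3, -20, -16], [0, -16, 3, -21, -17], [0, -19, 4, -25, -20], [0, -20, 4, -26, -21], [0, -25, 5, -33, -26]]"])
    (code_simp, simp, simp add: delsarte_poly_entries ac_simps)

lemma fam_D1_model: "fam_D1 t \<approx>\<^sub>b model [1, 1, 1, 1, 1] t"
  unfolding fam_D1_def
  by (rule birational_torus_model[where d = "[-1, 0, 0, 0, 0]" and c = "[0, 0, 1, -1, 0]"
      and A = "[[5, 0, 1, 0, 0], [0, 0, 4, 1, 0], [0, 1, 0, 4, 0], [0, 4, 0, 0, 1], [0, 0, 0, 0, 4]]"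
      and B = "[[0, 10, -13, 3, -1], [0, 12, -15, 4, -1], [0, 13, -16, 4, -1], [0, 13, -16, 4, -1], [0, 16, -20, 5, -1]]"])
    (code_simp, simp, simp add: delsarte_poly_entries ac_simps)

lemma fam_D2_model: "fam_D2 t \<approx>\<^sub>b model [1, 1, 1, 1, 1] t"
  unfolding fam_D2_def
  by (rule birational_torus_model[where d = "[-1, 0, 0, 0, 0]" and c = "[0, 0, 1, -1, 0]"
      and A = "[[0, 0, 5, 0, 0], [5, 0, 0, 1, 0], [0, 1, 0, 4, 0], [0, 4, 0, 0, 1], [0, 0, 0, 0, 4]]"
      and B = "[[0, -10, -23, -7, -11], [0, -12, -27, -8, -13], [0, -13, -29, -9, -14], [0, -13, -29, -9, -14], [0, -16, -36, -11, -17]]"])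
    (code_simp, simp, simp add: delsarte_poly_entries ac_simps)

section \<open>The mirror quotients\<close>

text \<open>The first coordinate has weight 1 and thus exponent \<open>j\<close>. It serves as the
  place where products are corrected: multiplying it by a \<open>j\<close>-th root of unity does not
  change its monomial.\<close>

locale fermat =
  fixes ws :: "nat list" and j :: nat and n :: nat and A :: "nat \<Rightarrow> nat \<Rightarrow> nat"
  defines "n \<equiv> length ws" and "A \<equiv> \<lambda>i k. if k = i then j div ws ! (i - 1) else 0"
  assumes length_ws: "length ws \<ge> 2" and first_weight: "ws ! 0 = 1"
    and weights_dvd: "\<And>w. w \<in> set ws \<Longrightarrow> w dvd j" and sum_list_ws: "sum_list ws = j"
begin

abbreviation "a i \<equiv> j div ws ! (i - 1)"
abbreviation "w i \<equiv> ws ! (i - 1)"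

lemma n_ge: "n \<ge> 2"
  using length_ws by (simp add: n_def)

lemma j_pos: "j > 0"
proof -
  have "1 \<in> set ws" using first_weight length_ws nth_mem[of 0 ws] by fastforce
  then have "1 \<le> sum_list ws" by (rule member_le_sum_list) simp
  then show ?thesis using sum_list_ws by simp
qed

lemma exponent_weight: "i \<in> {1..n} \<Longrightarrow> a i * w i = j"
  using weights_dvd[of "w i"] by (auto simp: n_def)

lemma sum_weights: "(\<Sum>i=1..n. w i) = j"
proof -
  have "(\<Sum>i=1..n. w i) = (\<Sum>i<n. ws ! i)" by (simp add: sum.atLeast1_atMost_eq)
  then show ?thesis
    using sum_list_ws by (simp add: sum_list_sum_nth n_def atLeast0LessThan)
qed

lemma sum_exponent_row:
  "(\<Sum>k=1..n. (int (A i k) - 1) * f k) = (if i \<in> {1..n} then int (a i) * f i else 0) - (\<Sum>k=1..n. f k)"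
proof -
  have "(\<Sum>k=1..n. (int (A i k) - 1) * f k) = (\<Sum>k=1..n. if k = i then int (a i) * f k else 0) - (\<Sum>k=1..n. f k)"
    unfolding A_def sum_subtractf[symmetric] by (intro sum.cong) (auto simp: algebra_simps)
  then show ?thesis by (simp add: sum.delta)
qed

lemma sum_exponent_column:
  "(\<Sum>i=1..n. f i * (int (A i k) - 1)) = (if k \<in> {1..n} then f k * int (a k) else 0) - (\<Sum>i=1..n. f i)"
proof -
  have "(\<Sum>i=1..n. f i * (int (A i k) - 1)) = (\<Sum>i=1..n. if i = k then f i * int (a i) else 0) - (\<Sum>i=1..n. f i)"
    unfolding A_def sum_subtractf[symmetric] by (intro sum.cong) (auto simp: algebra_simps)
  then show ?thesis by (simp add: sum.delta)
qed

lemma sum_int_weights: "(\<Sum>i=1..n. int (w i)) = int j"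
  using sum_weights by (simp flip: of_nat_sum)

text \<open>The exponent matrix is diagonal, hence symmetric after subtracting 1 from all entries,
  so the weight vector is also its left kernel vector.\<close>

sublocale delsarte ws A "coord ws" n "\<lambda>i k. int (A i k) - 1"
proof unfold_locales
  show "ws \<noteq> []" using length_ws by auto
  show "(\<Sum>k=1..length ws. (int (A i k) - 1) * int (w k)) = 0" if "i \<in> {1..length ws}" for i
    unfolding n_def[symmetric] sum_exponent_row sum_int_weights
    using that exponent_weight[of i] by (simp add: n_def flip: of_nat_mult)
  show "(\<Sum>i=1..length ws. coord ws i * (int (A i k) - 1)) = 0" if "k \<in> {1..length ws}" for k
    unfolding n_def[symmetric] sum_exponent_column coord_def sum_int_weights
    using that exponent_weight[of k] by (simp add: n_def mult.commute flip: of_nat_mult)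
  show "\<exists>i\<in>{1..length ws}. A i k = 0" if "k \<in> {1..length ws}" for k
    using length_ws by (intro bexI[of _ "if k = 1 then 2 else 1"]) (auto simp: A_def)
qed

section \<open>The kernel of the monomial map and its characters\<close>

abbreviation "\<Psi> \<equiv> laurent_map n (\<lambda>i k. int (A i k) - 1)"

lemma laurent_row:
  assumes "x \<in> torus n" "i \<in> {1..n}"
  shows "laurent n (\<lambda>k. int (A i k) - 1) x = x i ^ a i / (\<Prod>k=1..n. x k)"
proof -
  have "(\<Prod>k=1..n. x k ^ A i k) = (\<Prod>k=1..n. if k = i then x k ^ a i else 1)"
    unfolding A_def by (intro prod.cong) auto
  then show ?thesis using laurent_exponents[OF assms(1)] assms(2) by simp
qed

text \<open>The kernel of \<open>\<Psi>\<close> as a homomorphism of tori, written without negative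
  exponents so that membership of test elements is easy to check.\<close>

definition diagonal_kernel :: "(nat \<Rightarrow> complex) set" where
  "diagonal_kernel = {e \<in> torus n. \<forall>i\<in>{1..n}. e i ^ a i = (\<Prod>k=1..n. e k)}"

lemma diagonal_kernel_eq:
  "diagonal_kernel = {e \<in> torus n. \<forall>i\<in>{1..n}. laurent n (\<lambda>k. int (A i k) - 1) e = 1}"
proof -
  have "(\<Prod>k=1..n. e k) \<noteq> 0" if "e \<in> torus n" for e using that by (simp add: torus_def)
  then show ?thesis unfolding diagonal_kernel_def using laurent_row by auto
qed

text \<open>Tested on the element \<open>2 ^ w k\<close> of the weight action: 2 is not a root of
  unity, so equal powers have equal exponents.\<close>

lemma weights_kernel:
  assumes "\<And>e. e \<in> diagonal_kernel \<Longrightarrow> monomial n m e = monomial n m' e"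
  shows "(\<Sum>k=1..n. int (w k) * (int (m k) - int (m' k))) = 0"
proof -
  define e where "e = (\<lambda>k. if k \<in> {1..n} then 2 ^ w k else 0 :: complex)"
  have mon: "monomial n m e = 2 ^ (\<Sum>k=1..n. w k * m k)" for m
    unfolding monomial_def power_sum by (intro prod.cong) (auto simp: e_def power_mult)
  have "(\<Prod>k=1..n. e k) = 2 ^ j"
    unfolding sum_weights[symmetric] power_sum by (intro prod.cong) (auto simp: e_def)
  moreover have "e i ^ a i = 2 ^ j" if "i \<in> {1..n}" for i
    using exponent_weight[OF that] that by (simp add: e_def mult.commute flip: power_mult)
  ultimately have "e \<in> diagonal_kernel"
    by (auto simp: diagonal_kernel_def torus_def affine_pts_def e_def)
  then have "(2::complex) ^ (\<Sum>k=1..n. w k * m k) = 2 ^ (\<Sum>k=1..n. w k * m' k)"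
    using assms mon by metis
  then have "norm ((2::complex) ^ (\<Sum>k=1..n. w k * m k)) = norm ((2::complex) ^ (\<Sum>k=1..n. w k * m' k))"
    by (rule arg_cong)
  then have "(\<Sum>k=1..n. w k * m k) = (\<Sum>k=1..n. w k * m' k)"
    by (simp add: norm_power)
  then have "int (\<Sum>k=1..n. w k * m k) = int (\<Sum>k=1..n. w k * m' k)" by (rule arg_cong)
  then show ?thesis by (simp add: right_diff_distrib sum_subtractf)
qed

text \<open>Tested on the element with a root of unity \<open>z\<close> at \<open>i\<close> and its
  inverse at coordinate 1. Since \<open>a i * w i = j\<close>, this \<open>z\<close> is a primitive
  root of order \<open>a i\<close>, which gives divisibility by \<open>a i\<close>.\<close>

lemma roots_of_unity_kernel:
  assumes "\<And>e. e \<in> diagonal_kernel \<Longrightarrow> monomial n m e = monomial n m' e" and i: "i \<in> {1..n}"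
  shows "int (a i) dvd (int (m i) - int (m' i)) - (int (m 1) - int (m' 1))"
proof (cases "i = 1")
  case False
  define z where "z = exp (2 * of_real pi * \<i> * of_nat (w i) / of_nat j)"
  have z_power: "z ^ p = exp (2 * of_real pi * \<i> * of_nat (w i * p) / of_nat j)" for p
    unfolding z_def exp_of_nat_mult[symmetric] by (simp add: mult_ac)
  have z: "z \<noteq> 0" "z ^ a i = 1" "z ^ j = 1"
    using complex_root_unity_eq_1[of j "w i * a i"] complex_root_unity_eq_1[of j "w i * j"] j_pos
      exponent_weight[OF i]
    unfolding z_power by (simp_all add: z_def mult.commute)
  define e where "e = (\<lambda>k. if k \<in> {1..n} then (if k = i then z else 1) * (if k = 1 then inverse z else 1) else 0)"
  have one: "1 \<in> {1..n}" using n_ge by simp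
  have mon: "monomial n m e = z ^ m i * inverse z ^ m 1" for m
  proof -
    have "monomial n m e = (\<Prod>k=1..n. (if k = i then z ^ m k else 1) * (if k = 1 then inverse z ^ m k else 1))"
      unfolding monomial_def by (intro prod.cong) (auto simp: e_def power_mult_distrib)
    then show ?thesis using i one by (simp add: prod.distrib del: One_nat_def)
  qed
  have "(\<Prod>k=1..n. e k) = 1" using mon[of "\<lambda>_. 1"] z(1) by (simp add: monomial_def)
  moreover have "e k ^ a k = 1" if "k \<in> {1..n}" for k
    using that z False first_weight by (auto simp: e_def power_inverse)
  ultimately have "e \<in> diagonal_kernel"
    using z(1) by (auto simp: diagonal_kernel_def torus_def affine_pts_def e_def)
  then have "z ^ m i * inverse z ^ m 1 = z ^ m' i * inverse z ^ m' 1" using assms(1) mon by metis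
  then have eq: "z ^ (m i + m' 1) = z ^ (m' i + m 1)"
    using z(1) by (simp add: power_add field_simps)
  have "(w i * (m i + m' 1)) mod j = (w i * (m' i + m 1)) mod j"
    using iffD1[OF complex_root_unity_eq eq[unfolded z_power]] j_pos by simp
  then have "int (w i * (m i + m' 1)) mod int j = int (w i * (m' i + m 1)) mod int j"
    unfolding of_nat_mod[symmetric] by (rule arg_cong)
  then have "int j dvd int (w i * (m i + m' 1)) - int (w i * (m' i + m 1))"
    by (rule mod_eq_dvd_iff[THEN iffD1])
  also have "int (w i * (m i + m' 1)) - int (w i * (m' i + m 1))
      = int (w i) * ((int (m i) - int (m' i)) - (int (m 1) - int (m' 1)))"
    by (simp add: algebra_simps)
  finally have "int (w i) * int (a i) dvd int (w i) * ((int (m i) - int (m' i)) - (int (m 1) - int (m' 1)))"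
    using exponent_weight[OF i] by (simp add: mult.commute flip: of_nat_mult)
  moreover have "w i \<noteq> 0" using exponent_weight[OF i] j_pos by (metis mult_0_right neq0_conv)
  ultimately show ?thesis by (simp only: dvd_mult_cancel_left of_nat_eq_0_iff) blast
qed simp

text \<open>The vector \<open>N\<close> of exponent differences must be an integral combination of
  the rows, that is, \<open>\<kappa> i * a i\<close> minus the sum of all \<open>\<kappa>\<close>
  must equal \<open>N i\<close>. Roots of unity make \<open>\<kappa> i = (N i - N 1) / a i\<close>
  integral; the weighted sum of these equations, with \<open>N\<close> of weight 0, shows that the
  sum of the \<open>\<kappa>\<close> is \<open>- N 1\<close>.\<close>

sublocale laurent_quotient n "\<lambda>i k. int (A i k) - 1" diagonal_kernel
proof (unfold_locales, goal_cases)
  case (1 m m')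
  then have *: "\<And>e. e \<in> diagonal_kernel \<Longrightarrow> monomial n m e = monomial n m' e"
    unfolding diagonal_kernel_eq by simp
  define N where "N k = int (m k) - int (m' k)" for k
  define \<kappa> where "\<kappa> i = (N i - N 1) div int (a i)" for i
  have \<kappa>: "\<kappa> i * int (a i) = N i - N 1" if "i \<in> {1..n}" for i
    using roots_of_unity_kernel[OF * that] by (simp add: \<kappa>_def N_def)
  have "int j * ((\<Sum>i=1..n. \<kappa> i) + N 1) = (\<Sum>i=1..n. int (w i) * (\<kappa> i * int (a i))) + (\<Sum>i=1..n. int (w i)) * N 1"
  proof -
    have "int j * (\<Sum>i=1..n. \<kappa> i) = (\<Sum>i=1..n. int (w i) * (\<kappa> i * int (a i)))"
      unfolding sum_distrib_left
    proof (intro sum.cong refl)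
      fix i assume "i \<in> {1..n}"
      then have "int j = int (a i) * int (w i)" using exponent_weight by (simp flip: of_nat_mult)
      then show "int j * \<kappa> i = int (w i) * (\<kappa> i * int (a i))" by simp
    qed
    then show ?thesis using sum_int_weights by (simp add: distrib_left)
  qed
  also have "\<dots> = (\<Sum>i=1..n. int (w i) * N i)"
    using \<kappa> by (simp add: right_diff_distrib sum_subtractf sum_distrib_right)
  also have "\<dots> = 0" using weights_kernel[OF *] by (simp add: N_def)
  finally have sum_\<kappa>: "(\<Sum>i=1..n. \<kappa> i) = - N 1" using j_pos by simp
  have "monomial n m x = monomial n m' x * laurent n \<kappa> (\<Psi> x)" if x: "x \<in> torus n" for x
  proof -
    have "laurent n \<kappa> (\<Psi> x) = laurent n N x"
      unfolding laurent_laurent_map[OF x] sum_exponent_column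
      by (rule laurent_cong) (simp add: \<kappa> sum_\<kappa> del: One_nat_def)
    moreover have "monomial n m x = monomial n m' x * laurent n N x"
      unfolding monomial_def laurent_def N_def prod.distrib[symmetric] using x
      by (intro prod.cong) (auto simp: power_int_diff torus_def)
    ultimately show ?thesis by simp
  qed
  then show ?case by blast
qed (rule eq_reflection[OF diagonal_kernel_eq])

section \<open>The diagonal group and its orbits\<close>

definition diagonal_group :: "(nat \<Rightarrow> complex) set" where
  "diagonal_group = {e. (\<forall>i\<in>{1..n}. e i ^ a i = 1) \<and> (\<Prod>i=1..n. e i) = 1}"

definition orbit_rel :: "complex \<Rightarrow> (wpt \<times> wpt) set" where
  "orbit_rel t = {(p, p'). p \<in> pts (X t) \<and> p' \<in> pts (X t) \<and>
     (\<exists>e\<in>diagonal_group. p' = (\<lambda>x i. e i * x i) ` p)}"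

lemma orbit_relI:
  assumes "p \<in> pts (X t)" "p' \<in> pts (X t)" "e \<in> diagonal_group" "p' = (\<lambda>x i. e i * x i) ` p"
  shows "(p, p') \<in> orbit_rel t"
  unfolding orbit_rel_def by (intro CollectI case_prodI conjI assms(1,2) bexI[of _ e] assms(3,4))

lemma diagonal_group_nonzero: "e \<in> diagonal_group \<Longrightarrow> i \<in> {1..n} \<Longrightarrow> e i \<noteq> 0"
  unfolding diagonal_group_def by (metis (mono_tags, lifting) finite_atLeastAtMost mem_Collect_eq prod_zero_iff zero_neq_one)

lemma diagonal_group_inverse: "e \<in> diagonal_group \<Longrightarrow> (\<lambda>i. inverse (e i)) \<in> diagonal_group"
  by (simp add: diagonal_group_def power_inverse prod_inversef[unfolded comp_def])

lemma diagonal_group_mult: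
  "e \<in> diagonal_group \<Longrightarrow> e' \<in> diagonal_group \<Longrightarrow> (\<lambda>i. e i * e' i) \<in> diagonal_group"
  by (simp add: diagonal_group_def power_mult_distrib prod.distrib)

lemma diagonal_group_one: "(\<lambda>i. 1) \<in> diagonal_group"
  by (simp add: diagonal_group_def)

text \<open>Group elements are arbitrary outside \<open>{1..n}\<close> and may be 0 there;
  cancellation holds because the coordinates of \<open>x\<close> vanish at those indices.\<close>

lemma inverse_act:
  assumes "e \<in> diagonal_group" "x \<in> affine_pts n"
  shows "(\<lambda>i. inverse (e i) * (e i * x i)) = x"
proof
  fix i show "inverse (e i) * (e i * x i) = x i"
    using diagonal_group_nonzero[OF assms(1), of i] assms(2)
    by (cases "i \<in> {1..n}") (auto simp: affine_pts_def)
qed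

lemma act_P:
  assumes "e \<in> diagonal_group" "x \<in> P"
  shows "(\<lambda>i. e i * x i) \<in> P"
proof -
  have "(\<lambda>i. e i * x i) \<in> affine_pts n" using assms(2) by (auto simp: affine_pts_def)
  moreover have "(\<lambda>i. e i * x i) \<noteq> (\<lambda>i. 0)"
  proof
    assume "(\<lambda>i. e i * x i) = (\<lambda>i. 0)"
    then have "e i * x i = 0" for i by (rule fun_cong)
    then have "(\<lambda>i. inverse (e i) * (e i * x i)) = (\<lambda>i. 0)" by (simp only: mult_zero_right)
    then show False using inverse_act[OF assms(1), of x] assms(2) by simp
  qed
  ultimately show ?thesis by blast
qed

lemma weighted_rel_act:
  assumes "e \<in> diagonal_group" "(x, y) \<in> weighted_rel ws"
  shows "((\<lambda>i. e i * x i), (\<lambda>i. e i * y i)) \<in> weighted_rel ws"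
proof -
  obtain l where l: "x \<in> P" "y \<in> P" "l \<noteq> 0" "\<forall>i\<in>{1..n}. y i = l ^ w i * x i"
    using assms(2) unfolding weighted_rel_def n_def[symmetric] by blast
  then have "\<forall>i\<in>{1..n}. e i * y i = l ^ w i * (e i * x i)" by simp
  with l act_P[OF assms(1) l(1)] act_P[OF assms(1) l(2)] show ?thesis
    unfolding weighted_rel_def n_def[symmetric] by blast
qed

lemma act_class:
  assumes e: "e \<in> diagonal_group" and x: "x \<in> P"
  shows "(\<lambda>x i. e i * x i) ` weighted_class ws x = weighted_class ws (\<lambda>i. e i * x i)"
proof (intro equalityI subsetI)
  fix y assume "y \<in> (\<lambda>x i. e i * x i) ` weighted_class ws x"
  then show "y \<in> weighted_class ws (\<lambda>i. e i * x i)"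
    using weighted_rel_act[OF e] by (auto simp: mem_weighted_class)
next
  fix y assume y: "y \<in> weighted_class ws (\<lambda>i. e i * x i)"
  then have y': "y \<in> affine_pts n" by (simp add: mem_weighted_class weighted_rel_def n_def)
  have "((\<lambda>i. inverse (e i) * (e i * x i)), (\<lambda>i. inverse (e i) * y i)) \<in> weighted_rel ws"
    using weighted_rel_act[OF diagonal_group_inverse[OF e]] y by (simp add: mem_weighted_class)
  then have mem: "(\<lambda>i. inverse (e i) * y i) \<in> weighted_class ws x"
    using inverse_act[OF e] x by (simp add: mem_weighted_class)
  show "y \<in> (\<lambda>x i. e i * x i) ` weighted_class ws x"
    by (rule image_eqI[OF _ mem]) (use inverse_act[OF diagonal_group_inverse[OF e] y'] in simp)
qed

lemma pts_X_subset: "p \<in> pts (X t) \<Longrightarrow> p \<subseteq> affine_pts n"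
proof
  fix y assume "p \<in> pts (X t)" "y \<in> p"
  then obtain x where "y \<in> weighted_class ws x" by (auto simp: pts_X pts_weighted_proj_n)
  then show "y \<in> affine_pts n" by (simp add: mem_weighted_class weighted_rel_def n_def)
qed

lemma equiv_orbit_rel: "equiv (pts (X t)) (orbit_rel t)"
proof (rule equivI)
  show "orbit_rel t \<subseteq> pts (X t) \<times> pts (X t)" by (auto simp: orbit_rel_def)
  show "refl_on (pts (X t)) (orbit_rel t)"
    by (rule refl_onI) (auto intro: orbit_relI[OF _ _ diagonal_group_one])
  show "sym (orbit_rel t)"
  proof (rule symI)
    fix p p' assume "(p, p') \<in> orbit_rel t"
    then obtain e where e: "p \<in> pts (X t)" "p' \<in> pts (X t)" "e \<in> diagonal_group"
      "p' = (\<lambda>x i. e i * x i) ` p" unfolding orbit_rel_def by blast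
    have "(\<lambda>x i. inverse (e i) * x i) ` p' = (\<lambda>x. x) ` p"
      unfolding e(4) image_image
      by (rule image_cong[OF refl], rule inverse_act[OF e(3)]) (use pts_X_subset[OF e(1)] in blast)
    then have "p = (\<lambda>x i. inverse (e i) * x i) ` p'" by simp
    then show "(p', p) \<in> orbit_rel t"
      by (rule orbit_relI[OF e(2,1) diagonal_group_inverse[OF e(3)]])
  qed
  show "trans (orbit_rel t)"
  proof (rule transI)
    fix p p' p'' assume "(p, p') \<in> orbit_rel t" "(p', p'') \<in> orbit_rel t"
    then obtain e e' where e: "p \<in> pts (X t)" "p'' \<in> pts (X t)" "e \<in> diagonal_group" "e' \<in> diagonal_group"
      "p'' = (\<lambda>x i. e' i * x i) ` (\<lambda>x i. e i * x i) ` p" unfolding orbit_rel_def by blast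
    have "p'' = (\<lambda>x i. (e' i * e i) * x i) ` p" unfolding e(5) image_image by (simp add: mult.assoc)
    then show "(p, p'') \<in> orbit_rel t"
      by (rule orbit_relI[OF e(1,2) diagonal_group_mult[OF e(4,3)]])
  qed
qed

text \<open>The kernel of the map to the \<open>y\<^sub>i\<close> is generated by \<open>diagonal_group\<close> and the one-parameter
  group of the weights.\<close>

lemma fibre_orbit:
  assumes x: "x \<in> torus n" and y: "y \<in> torus n" and eq: "\<Psi> x = \<Psi> y"
  shows "\<exists>e\<in>diagonal_group. ((\<lambda>i. e i * x i), y) \<in> weighted_rel ws"
proof -
  have nz: "x i \<noteq> 0" "y i \<noteq> 0" if "i \<in> {1..n}" for i using x y that by (auto simp: torus_def)
  define \<mu> where "\<mu> = (\<Prod>k=1..n. y k) / (\<Prod>k=1..n. x k)"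
  have "\<mu> \<noteq> 0" using nz by (simp add: \<mu>_def)
  have ratio: "(y i / x i) ^ a i = \<mu>" if i: "i \<in> {1..n}" for i
  proof -
    have "x i ^ a i / (\<Prod>k=1..n. x k) = y i ^ a i / (\<Prod>k=1..n. y k)"
      using fun_cong[OF eq, of i] laurent_row[OF x i] laurent_row[OF y i] i by (simp add: laurent_map_def)
    moreover have "(\<Prod>k=1..n. x k) \<noteq> 0" "(\<Prod>k=1..n. y k) \<noteq> 0" using nz by simp_all
    ultimately show ?thesis using nz[OF i] unfolding \<mu>_def power_divide
      by (simp add: frac_eq_eq divide_simps mult_ac)
  qed
  \<comment> \<open>All \<open>(y i / x i) ^ a i\<close> equal \<open>\<mu>\<close>. Dividing the
    ratios by \<open>l ^ w i\<close> turns these powers into 1, and the product of the ratios, also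
    \<open>\<mu>\<close>, into 1, because the weights sum to \<open>j\<close>.\<close>
  obtain l where l: "l ^ j = \<mu>" using nth_root_exists[OF j_pos] by blast
  have "l \<noteq> 0" using l \<open>\<mu> \<noteq> 0\<close> j_pos by auto
  define e where "e i = (y i / x i) / l ^ w i" for i
  have "e i ^ a i = 1" if i: "i \<in> {1..n}" for i
    using ratio[OF i] l \<open>\<mu> \<noteq> 0\<close> exponent_weight[OF i]
    unfolding e_def power_divide power_mult[symmetric] by (simp add: mult.commute)
  moreover have "(\<Prod>i=1..n. e i) = 1"
  proof -
    have "(\<Prod>i=1..n. l ^ w i) = \<mu>" unfolding power_sum[symmetric] sum_weights l ..
    then show ?thesis using \<open>\<mu> \<noteq> 0\<close> unfolding e_def prod_dividef by (simp add: \<mu>_def prod_dividef)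
  qed
  ultimately have e: "e \<in> diagonal_group" by (simp add: diagonal_group_def)
  have "\<forall>i\<in>{1..n}. y i = l ^ w i * (e i * x i)"
    using nz \<open>l \<noteq> 0\<close> by (simp add: e_def)
  moreover have "y \<in> P" "(\<lambda>i. e i * x i) \<in> P"
    using x y torus_punctured act_P[OF e] by blast+
  ultimately have "((\<lambda>i. e i * x i), y) \<in> weighted_rel ws"
    unfolding weighted_rel_def n_def[symmetric] using \<open>l \<noteq> 0\<close> by blast
  then show ?thesis using e by blast
qed

lemma diagonal_group_kernel:
  assumes "e \<in> diagonal_group"
  shows "(\<lambda>i. if i \<in> {1..n} then e i else 0) \<in> diagonal_kernel"
  using assms diagonal_group_nonzero[OF assms]
  by (auto simp: diagonal_kernel_def diagonal_group_def torus_def affine_pts_def)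

lemma laurent_map_act:
  assumes "e \<in> diagonal_group" "x \<in> torus n"
  shows "\<Psi> (\<lambda>i. e i * x i) = \<Psi> x"
proof -
  have "(\<lambda>i. e i * x i) = (\<lambda>i. (if i \<in> {1..n} then e i else 0) * x i)"
    using assms(2) by (auto simp: torus_def affine_pts_def)
  then show ?thesis using laurent_map_K[OF diagonal_group_kernel[OF assms(1)], of x] by simp
qed

text \<open>Take roots \<open>c i\<close> of the \<open>y i\<close>. Their product
  \<open>\<mu>\<close> satisfies \<open>\<mu> ^ j = 1\<close> by the relation defining the model, so
  dividing the first root by \<open>\<mu>\<close> makes the product 1 and keeps its
  \<open>j\<close>-th power.\<close>

lemma laurent_map_onto_model:
  assumes y: "y \<in> M t"
  shows "\<exists>x\<in>torus n. \<Psi> x = y"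
proof -
  have yt: "y \<in> torus n" "laurent n (coord ws) y = 1" using y by (auto simp: torus_model_def)
  have "\<exists>z. z ^ a i = y i" if "i \<in> {1..n}" for i
    using exponent_weight[OF that] j_pos by (intro nth_root_exists) (auto intro: Nat.gr0I)
  then obtain c where c: "\<And>i. i \<in> {1..n} \<Longrightarrow> c i ^ a i = y i" by metis
  have y_nz: "y i \<noteq> 0" if "i \<in> {1..n}" for i using yt(1) that by (auto simp: torus_def)
  have a_pos: "a i > 0" if "i \<in> {1..n}" for i
    using exponent_weight[OF that] j_pos by (metis mult_eq_0_iff neq0_conv)
  have c_nz: "c i \<noteq> 0" if "i \<in> {1..n}" for i
  proof
    assume "c i = 0"
    then have "y i = 0 ^ a i" using c[OF that] by metis
    also have "\<dots> = 0" by (rule zero_power[OF a_pos[OF that]])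
    finally show False using y_nz[OF that] by contradiction
  qed
  define \<mu> where "\<mu> = (\<Prod>k=1..n. c k)"
  have "\<mu> \<noteq> 0" using c_nz by (simp add: \<mu>_def)
  have "\<mu> ^ j = (\<Prod>k=1..n. y k ^ w k)"
    unfolding \<mu>_def prod_power_distrib
  proof (intro prod.cong refl)
    fix k assume k: "k \<in> {1..n}"
    show "c k ^ j = y k ^ w k"
      using exponent_weight[OF k] c[OF k] by (metis power_mult)
  qed
  also have "\<dots> = 1" using yt(2) by (simp add: laurent_def coord_def)
  finally have \<mu>: "\<mu> ^ j = 1" .
  define x where "x = (\<lambda>k. if k \<in> {1..n} then c k * (if k = 1 then inverse \<mu> else 1) else 0)"
  have x: "x \<in> torus n"
    using c_nz \<open>\<mu> \<noteq> 0\<close> by (auto simp: x_def torus_def affine_pts_def)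
  have one: "1 \<in> {1..n}" using n_ge by simp
  have "(\<Prod>k=1..n. x k) = (\<Prod>k=1..n. c k * (if k = 1 then inverse \<mu> else 1))"
    by (intro prod.cong) (auto simp: x_def)
  also have "\<dots> = \<mu> * inverse \<mu>" using one by (simp add: prod.distrib \<mu>_def del: One_nat_def)
  finally have prod_x: "(\<Prod>k=1..n. x k) = 1" using \<open>\<mu> \<noteq> 0\<close> by simp
  have "x i ^ a i = y i" if i: "i \<in> {1..n}" for i
    using c[OF i] i \<mu> first_weight by (auto simp: x_def power_mult_distrib power_inverse)
  then have "\<Psi> x = y"
    using laurent_row[OF x] prod_x yt(1) by (auto simp: laurent_map_def torus_def affine_pts_def fun_eq_iff)
  then show ?thesis using x by blast
qed

section \<open>The torus part of the quotient and its identification with the model\<close>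

lemma torus_part_subset: "torus_part t \<subseteq> pts (X t)"
  using torus_part_eq by blast

lemma orbit_self: "p \<in> pts (X t) \<Longrightarrow> p \<in> orbit_rel t `` {p}"
  using equiv_class_self[OF equiv_orbit_rel] by blast

lemma orbit_rel_torus_part:
  assumes "(p, p') \<in> orbit_rel t" "p \<in> torus_part t"
  shows "p' \<in> torus_part t" "to_model p' = to_model p"
proof -
  obtain e where e: "p' \<in> pts (X t)" "e \<in> diagonal_group" "p' = (\<lambda>x i. e i * x i) ` p"
    using assms(1) unfolding orbit_rel_def by blast
  obtain x where x: "x \<in> torus n" "p = weighted_class ws x"
    using assms(2) torus_zeros_subset unfolding torus_part_def by blast
  have p': "p' = weighted_class ws (\<lambda>i. e i * x i)"
    using act_class[OF e(2)] e(3) x torus_punctured by blast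
  have ex: "(\<lambda>i. e i * x i) \<in> torus n"
    using x(1) diagonal_group_nonzero[OF e(2)] by (simp add: torus_def affine_pts_def)
  show "p' \<in> torus_part t"
    unfolding torus_part_eq torus_classes_n using e(1) p' ex by blast
  show "to_model p' = to_model p"
    unfolding p' x(2) to_model_class[OF ex] to_model_class[OF x(1)] by (rule laurent_map_act[OF e(2) x(1)])
qed

definition quotient_torus_part :: "complex \<Rightarrow> wpt set set" where
  "quotient_torus_part t = (\<lambda>p. orbit_rel t `` {p}) ` torus_part t"

lemma quotient_torus_part_preimage:
  "{p \<in> pts (X t). orbit_rel t `` {p} \<in> quotient_torus_part t} = torus_part t"
proof (intro equalityI subsetI)
  fix p assume p: "p \<in> {p \<in> pts (X t). orbit_rel t `` {p} \<in> quotient_torus_part t}"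
  then obtain p' where "p' \<in> torus_part t" "orbit_rel t `` {p} = orbit_rel t `` {p'}"
    unfolding quotient_torus_part_def by blast
  moreover have "p \<in> orbit_rel t `` {p}" using p orbit_self by blast
  ultimately show "p \<in> torus_part t" using orbit_rel_torus_part(1) by blast
next
  fix p assume "p \<in> torus_part t"
  then show "p \<in> {p \<in> pts (X t). orbit_rel t `` {p} \<in> quotient_torus_part t}"
    using torus_part_subset unfolding quotient_torus_part_def by blast
qed

text \<open>Density is inherited from \<open>X t\<close>: a nonempty open set of orbits has a
  nonempty open preimage, which meets the torus part.\<close>

lemma dense_open_quotient_torus_part:
  "dense_open (quotient_space (X t) (orbit_rel t)) (quotient_torus_part t)"
  unfolding dense_open_iff
proof (intro conjI allI impI)
  show "openin (Top (quotient_space (X t) (orbit_rel t))) (quotient_torus_part t)"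
    unfolding openin_quotient_space quotient_open_def quotient_torus_part_preimage
    using open_torus_part torus_part_subset
    by (auto simp: quotient_torus_part_def intro: quotientI)
  fix U assume U: "openin (Top (quotient_space (X t) (orbit_rel t))) U" "U \<noteq> {}"
  let ?U = "{p \<in> pts (X t). orbit_rel t `` {p} \<in> U}"
  have "openin (Top (X t)) ?U" "U \<subseteq> pts (X t) // orbit_rel t"
    using U(1) unfolding openin_quotient_space quotient_open_def by blast+
  moreover from this have "?U \<noteq> {}" using U(2) by (blast elim: quotientE)
  ultimately obtain p where "p \<in> torus_part t" "p \<in> ?U"
    using dense_open_torus_part unfolding dense_open_iff by blast
  then show "\<exists>p\<in>quotient_torus_part t. p \<in> U" unfolding quotient_torus_part_def by blast
qed

definition quotient_to_model :: "wpt set \<Rightarrow> nat \<Rightarrow> complex" where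
  "quotient_to_model p = to_model (SOME p'. p' \<in> p)"

lemma quotient_to_model_class:
  assumes p: "p \<in> torus_part t"
  shows "quotient_to_model (orbit_rel t `` {p}) = to_model p"
proof -
  have "p \<in> orbit_rel t `` {p}" using p torus_part_subset orbit_self by blast
  then have "(SOME p'. p' \<in> orbit_rel t `` {p}) \<in> orbit_rel t `` {p}"
    by (rule someI[of "\<lambda>p'. p' \<in> orbit_rel t `` {p}"])
  then show ?thesis
    unfolding quotient_to_model_def using orbit_rel_torus_part(2)[OF _ p] by blast
qed

text \<open>The chosen preimages need not vary algebraically with \<open>y\<close>. Their orbits are
  independent of the choice by \<open>fibre_orbit\<close>, and regularity comes from
  \<open>descent\<close>.\<close>

definition model_to_quotient :: "complex \<Rightarrow> (nat \<Rightarrow> complex) \<Rightarrow> wpt set" where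
  "model_to_quotient t y = orbit_rel t `` {weighted_class ws (SOME x. x \<in> torus n \<and> \<Psi> x = y)}"

lemma weighted_class_torus_part: "x \<in> torus_zeros t \<Longrightarrow> weighted_class ws x \<in> torus_part t"
  by (simp add: torus_part_def)

lemma model_to_quotient_map:
  assumes x: "x \<in> torus_zeros t"
  shows "model_to_quotient t (\<Psi> x) = orbit_rel t `` {weighted_class ws x}"
proof -
  define x' where "x' = (SOME x'. x' \<in> torus n \<and> \<Psi> x' = \<Psi> x)"
  have xt: "x \<in> torus n" using x torus_zeros_subset by blast
  have "x' \<in> torus n \<and> \<Psi> x' = \<Psi> x"
    unfolding x'_def by (rule someI[of _ x]) (simp add: xt)
  then have x': "x' \<in> torus n" "\<Psi> x' = \<Psi> x" by blast+
  then have x'z: "x' \<in> torus_zeros t" using torus_zeros_iff x xt by metis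
  obtain e where e: "e \<in> diagonal_group" "((\<lambda>i. e i * x' i), x) \<in> weighted_rel ws"
    using fibre_orbit[OF x'(1) xt x'(2)] by blast
  have "x' \<in> P" "x \<in> P" using x'(1) xt torus_punctured by blast+
  then have "weighted_class ws x = weighted_class ws (\<lambda>i. e i * x' i)"
    using e weighted_class_eq_iff[of "\<lambda>i. e i * x' i" ws x] act_P[OF e(1)] unfolding n_def[symmetric] by blast
  also have "\<dots> = (\<lambda>x i. e i * x i) ` weighted_class ws x'"
    using act_class[OF e(1) \<open>x' \<in> P\<close>] by simp
  finally have "(weighted_class ws x', weighted_class ws x) \<in> orbit_rel t"
    using e(1) weighted_class_torus_part x x'z torus_part_subset by (intro orbit_relI[of _ t _ e]) blast+
  then show ?thesis
    unfolding model_to_quotient_def x'_def[symmetric] by (rule equiv_class_eq[OF equiv_orbit_rel])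
qed

lemma birational_quotient_model:
  "quotient_space (X t) (orbit_rel t) \<approx>\<^sub>b subspace_of (affine_space n) (M t)"
proof -
  let ?Q = "quotient_space (X t) (orbit_rel t)" and ?T = "quotient_torus_part t"
  have M_torus: "M t \<subseteq> torus n" by (auto simp: torus_model_def)
  then have ptsM: "pts (subspace_of (affine_space n) (M t)) = M t"
    using torus_subset by auto
  have zeros: "torus_zeros t = {x \<in> torus n. \<Psi> x \<in> M t}"
    using torus_zeros_iff torus_zeros_subset by blast
  have lift: "\<exists>x\<in>torus_zeros t. \<Psi> x = y" if "y \<in> M t" for y
    using laurent_map_onto_model[OF that] that unfolding zeros by blast
  have to: "is_morphism (subspace_of ?Q ?T) (subspace_of (affine_space n) (M t)) quotient_to_model"
  proof (rule morphism_from_quotient)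
    show "is_sheaf (X t)" unfolding hypersurface_def by (rule is_sheaf_subspace)
    show "is_presheaf (X t)"
      unfolding hypersurface_def weighted_proj_def punctured_affine_def
      by (intro is_presheaf_subspace is_presheaf_quotient is_presheaf_affine_space)
    show "openin (Top ?Q) ?T" using dense_open_quotient_torus_part unfolding dense_open_iff by blast
    show "torus_part t = {p \<in> pts (X t). orbit_rel t `` {p} \<in> ?T}"
      by (rule quotient_torus_part_preimage[symmetric])
    show "is_morphism (subspace_of (X t) (torus_part t)) (subspace_of (affine_space n) (M t))
        (\<lambda>p. quotient_to_model (orbit_rel t `` {p}))"
      by (rule morphism_cong[OF is_sheaf_subspace morphism_to_model])
        (simp add: quotient_to_model_class)
  qed
  have "is_morphism (subspace_of (affine_space n) (torus_zeros t)) ?Q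
      (\<lambda>x. orbit_rel t `` {weighted_class ws x})"
    by (rule morphism_comp[OF morphism_comp[OF morphism_torus_part morphism_inclusion] morphism_projection])
  \<comment> \<open>After pullback along \<open>\<Psi>\<close> the choice disappears: the map sends
    homogeneous coordinates to the orbit of their class.\<close>
  then have lifted: "is_morphism (subspace_of (affine_space n) (torus_zeros t)) ?Q
      (\<lambda>x. model_to_quotient t (\<Psi> x))"
    by (rule morphism_cong[OF is_sheaf_subspace]) (simp add: model_to_quotient_map)
  have "is_morphism (subspace_of (affine_space n) (M t)) ?Q (model_to_quotient t)"
    by (rule descent[OF lifted[unfolded zeros] laurent_map_onto_model])
  moreover have from_mem: "model_to_quotient t y \<in> ?T" if "y \<in> M t" for y
  proof -
    obtain x where x: "x \<in> torus_zeros t" "\<Psi> x = y" using lift[OF \<open>y \<in> M t\<close>] by blast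
    then show ?thesis
      using model_to_quotient_map[OF x(1)] weighted_class_torus_part[OF x(1)]
      unfolding quotient_torus_part_def by blast
  qed
  ultimately have from_model: "is_morphism (subspace_of (affine_space n) (M t)) (subspace_of ?Q ?T) (model_to_quotient t)"
    using ptsM by (intro morphism_into_subspace is_sheaf_subspace) blast+
  have "birational_pair ?Q (subspace_of (affine_space n) (M t)) ?T (M t) quotient_to_model (model_to_quotient t)"
    unfolding birational_pair_def
  proof (intro conjI ballI dense_open_quotient_torus_part)
    show "dense_open (subspace_of (affine_space n) (M t)) (M t)"
      using dense_open_self[of "subspace_of (affine_space n) (M t)"] by (simp only: ptsM)
    show "is_morphism (subspace_of ?Q ?T) (subspace_of (subspace_of (affine_space n) (M t)) (M t))
        quotient_to_model"
      using morphism_mem[OF to] ptsM by (intro morphism_into_subspace is_sheaf_subspace to) blast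
    show "is_morphism (subspace_of (subspace_of (affine_space n) (M t)) (M t)) (subspace_of ?Q ?T)
        (model_to_quotient t)"
      by (rule morphism_comp[OF morphism_inclusion from_model])
  next
    fix p assume "p \<in> ?T"
    then obtain x where x: "p = orbit_rel t `` {weighted_class ws x}" "x \<in> torus_zeros t"
      unfolding quotient_torus_part_def torus_part_def by blast
    have xt: "x \<in> torus n" using x(2) torus_zeros_subset by blast
    have eq: "quotient_to_model p = \<Psi> x"
      unfolding x(1) quotient_to_model_class[OF weighted_class_torus_part[OF x(2)]]
      by (rule to_model_class[OF xt])
    show "quotient_to_model p \<in> M t" unfolding eq using x(2) zeros by blast
    show "model_to_quotient t (quotient_to_model p) = p"
      unfolding eq model_to_quotient_map[OF x(2)] by (rule x(1)[symmetric])
  next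
    fix y assume y: "y \<in> M t"
    then show "model_to_quotient t y \<in> ?T" by (rule from_mem)
    obtain x where x: "x \<in> torus_zeros t" "\<Psi> x = y" using lift[OF y] by blast
    have xt: "x \<in> torus n" using x(1) torus_zeros_subset by blast
    show "quotient_to_model (model_to_quotient t y) = y"
      unfolding x(2)[symmetric] model_to_quotient_map[OF x(1)]
        quotient_to_model_class[OF weighted_class_torus_part[OF x(1)]]
      by (rule to_model_class[OF xt])
  qed
  then show ?thesis unfolding birational_iff by blast
qed

end

lemma (in fermat) F_fermat: "F t x = (\<Sum>i=1..n. x i ^ a i) - t * (\<Prod>k=1..n. x k)"
proof -
  have "(\<Prod>k=1..n. x k ^ A i k) = x i ^ a i" if "i \<in> {1..n}" for i
  proof -
    have "(\<Prod>k=1..n. x k ^ A i k) = (\<Prod>k=1..n. if k = i then x k ^ a i else 1)"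
      unfolding A_def by (intro prod.cong) auto
    then show ?thesis using that by simp
  qed
  then show ?thesis by (simp add: delsarte_poly_def)
qed

section \<open>Mirror families and conclusion\<close>

lemma fermat_cy_weights: "j \<in> {5, 6, 8, 10} \<Longrightarrow> fermat (cy_weights j) j"
  by (auto simp: fermat_def cy_weights_def)

lemma cy_quotient_model:
  assumes j: "j \<in> {5, 6, 8, 10}"
  shows "cy_quotient j t \<approx>\<^sub>b model (cy_weights j) t"
proof -
  have length_cy: "length (cy_weights j) = 5" using j by (auto simp: cy_weights_def)
  interpret fermat "cy_weights j" j "length (cy_weights j)"
    "\<lambda>i k. if k = i then j div cy_weights j ! (i - 1) else 0"
    by (rule fermat_cy_weights[OF j])
  have V: "cy_V j t = X t"
    unfolding cy_V_def
  proof (intro arg_cong2[of _ _ _ _ hypersurface] refl ext)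
    fix x :: "nat \<Rightarrow> complex"
    have "(\<Prod>k=1..5. x k) = x 1 * x 2 * x 3 * x 4 * x 5"
      by (simp add: prod.atLeast_Suc_atMost eval_nat_numeral)
    then show "(\<Sum>i = 1..5. x i ^ (j div cy_weights j ! (i - 1))) - t * x 1 * x 2 * x 3 * x 4 * x 5 = F t x"
      unfolding F_fermat by (simp only: length_cy mult.assoc)
  qed
  have "cy_group j = diagonal_group"
    by (simp only: cy_group_def diagonal_group_def length_cy)
  then have "cy_orbit_rel j t = orbit_rel t"
    by (simp only: cy_orbit_rel_def orbit_rel_def V)
  then show ?thesis
    using birational_quotient_model[of t] by (simp only: cy_quotient_def V length_cy)
qed

lemma mirror_model: "j \<in> {5, 6, 8, 10} \<Longrightarrow> is_mirror j t W \<Longrightarrow> W \<approx>\<^sub>b model (cy_weights j) t"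
  unfolding is_mirror_def
  using birational_sym[OF resolution_birational] cy_quotient_model birational_trans by blast

lemma birational_via: "X \<approx>\<^sub>b Z \<Longrightarrow> Y \<approx>\<^sub>b Z \<Longrightarrow> X \<approx>\<^sub>b Y"
  using birational_trans birational_sym by blast

theorem theorem4p2:
  fixes t :: complex
  shows
    "(fam_A1 t \<approx>\<^sub>b fam_A2 t \<and>
      fam_A2 t \<approx>\<^sub>b fam_A3 t \<and>
      fam_A3 t \<approx>\<^sub>b fam_A4 t \<and>
      fam_A4 t \<approx>\<^sub>b cy_quotient 8 t \<and>
      (\<forall>W :: 'w fspace. is_mirror 8 t W \<longrightarrow> fam_A4 t \<approx>\<^sub>b W)) \<and>
     (fam_B1 t \<approx>\<^sub>b fam_B2 t \<and>
      fam_B2 t \<approx>\<^sub>b fam_B3 t \<and>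
      fam_B3 t \<approx>\<^sub>b fam_B4 t \<and>
      fam_B4 t \<approx>\<^sub>b cy_quotient 10 t \<and>
      (\<forall>W :: 'w fspace. is_mirror 10 t W \<longrightarrow> fam_B4 t \<approx>\<^sub>b W)) \<and>
     (fam_C1 t \<approx>\<^sub>b fam_C2 t \<and>
      fam_C2 t \<approx>\<^sub>b cy_quotient 6 t \<and>
      (\<forall>W :: 'w fspace. is_mirror 6 t W \<longrightarrow> fam_C2 t \<approx>\<^sub>b W)) \<and>
     (fam_D1 t \<approx>\<^sub>b fam_D2 t \<and>
      fam_D2 t \<approx>\<^sub>b cy_quotient 5 t \<and>
      (\<forall>W :: 'w fspace. is_mirror 5 t W \<longrightarrow> fam_D2 t \<approx>\<^sub>b W))"
proof -
  have ws: "cy_weights 8 = [1, 1, 1, 1, 4]" "cy_weights 10 = [1, 1, 1, 2, 5]"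
    "cy_weights 6 = [1, 1, 1, 1, 2]" "cy_weights 5 = [1, 1, 1, 1, 1]"
    by (simp_all add: cy_weights_def)
  have quotient: "cy_quotient j t \<approx>\<^sub>b model (cy_weights j) t"
    and mirror: "is_mirror j t W \<Longrightarrow> W \<approx>\<^sub>b model (cy_weights j) t"
    if "j \<in> {5, 6, 8, 10}" for j and W :: "'w fspace"
    using cy_quotient_model[OF that] mirror_model[OF that] by blast+
  have quotients:
    "cy_quotient 8 t \<approx>\<^sub>b model [1, 1, 1, 1, 4] t" "cy_quotient 10 t \<approx>\<^sub>b model [1, 1, 1, 2, 5] t"
    "cy_quotient 6 t \<approx>\<^sub>b model [1, 1, 1, 1, 2] t" "cy_quotient 5 t \<approx>\<^sub>b model [1, 1, 1, 1, 1] t"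
    using quotient[of 8] quotient[of 10] quotient[of 6] quotient[of 5] unfolding ws by simp_all
  have mirrors:
    "is_mirror 8 t W \<Longrightarrow> W \<approx>\<^sub>b model [1, 1, 1, 1, 4] t" "is_mirror 10 t W \<Longrightarrow> W \<approx>\<^sub>b model [1, 1, 1, 2, 5] t"
    "is_mirror 6 t W \<Longrightarrow> W \<approx>\<^sub>b model [1, 1, 1, 1, 2] t" "is_mirror 5 t W \<Longrightarrow> W \<approx>\<^sub>b model [1, 1, 1, 1, 1] t"
    for W :: "'w fspace"
    using mirror[of 8 W] mirror[of 10 W] mirror[of 6 W] mirror[of 5 W] unfolding ws by simp_all
  show ?thesis
    by (intro conjI allI impI
        birational_via[OF fam_A1_model fam_A2_model] birational_via[OF fam_A2_model fam_A3_model]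
        birational_via[OF fam_A3_model fam_A4_model] birational_via[OF fam_A4_model quotients(1)]
        birational_via[OF fam_A4_model mirrors(1)]
        birational_via[OF fam_B1_model fam_B2_model] birational_via[OF fam_B2_model fam_B3_model]
        birational_via[OF fam_B3_model fam_B4_model] birational_via[OF fam_B4_model quotients(2)]
        birational_via[OF fam_B4_model mirrors(2)]
        birational_via[OF fam_C1_model fam_C2_model] birational_via[OF fam_C2_model quotients(3)]
        birational_via[OF fam_C2_model mirrors(3)]
        birational_via[OF fam_D1_model fam_D2_model] birational_via[OF fam_D2_model quotients(4)]
        birational_via[OF fam_D2_model mirrors(4)])
qed

end
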